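(* Let $X$ be a homogeneous tree of infinite degree (every vertex has countably infinitely many neighbours), with graph distance $\mathrm d$ and a distinguished vertex $x_0\in X$. Let $\dot\varphi:\mathbb N_0\to\mathbb C$ be given and let $\tilde\varphi(x,y)=\dot\varphi(\mathrm d(x,y))$ $(x,y\in X)$. Let $H=(h_{i,j})_{i,j\in\mathbb N_0}$ be the Hankel matrix $h_{i,j}=\dot\varphi(i+j)-\dot\varphi(i+j+2)$. Then the following are equivalent: (i) $\tilde\varphi$ is a Schur multiplier on $X\times X$; (ii) $H$ is of trace class on $\ell^2(\mathbb N_0)$. If these equivalent conditions hold, then there exist unique constants $c_\pm\in\mathbb C$ and a unique $\dot\psi:\mathbb N_0\to\mathbb C$ with $\dot\varphi(n)=c_++c_-(-1)^n+\dot\psi(n)$ for all $n$ and $\lim_{n\to\infty}\dot\psi(n)=0$, and $$\|\tilde\varphi\|_S=|c_+|+|c_-|+\|H\|_1.$$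
   Context: A tree is a connected graph without cycles; $\mathrm d$ is the graph distance. For a set $Y$, a function $\psi:Y\times Y\to\mathbb C$ is a Schur multiplier if for every bounded operator $A=(a_{x,y})$ on $\ell^2(Y)$ the matrix $(\psi(x,y)a_{x,y})$ again defines a bounded operator $M_\psi A$; $\|\psi\|_S:=\|M_\psi\|$. $\|\cdot\|_1$ denotes the trace class norm. *)

theory Defs
  imports "HOL-Analysis.Analysis"
begin

definition walk :: "('a \<Rightarrow> 'a \<Rightarrow> bool) \<Rightarrow> 'a list \<Rightarrow> bool" where
  "walk E xs \<longleftrightarrow> xs \<noteq> [] \<and> (\<forall>i. Suc i < length xs \<longrightarrow> E (xs ! i) (xs ! Suc i))"

definition is_tree :: "('a \<Rightarrow> 'a \<Rightarrow> bool) \<Rightarrow> bool" where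
  "is_tree E \<longleftrightarrow>
     (\<forall>x y. E x y \<longrightarrow> E y x) \<and> (\<forall>x. \<not> E x x) \<and>
     (\<forall>x y. \<exists>xs. walk E xs \<and> hd xs = x \<and> last xs = y) \<and>
     \<not> (\<exists>xs. walk E xs \<and> length xs \<ge> 3 \<and> distinct xs \<and> E (last xs) (hd xs))"

definition homogeneous_tree_infinite_degree :: "('a \<Rightarrow> 'a \<Rightarrow> bool) \<Rightarrow> bool" where
  "homogeneous_tree_infinite_degree E \<longleftrightarrow>
     is_tree E \<and> (\<forall>x. infinite {y. E x y} \<and> countable {y. E x y})"

definition graph_dist :: "('a \<Rightarrow> 'a \<Rightarrow> bool) \<Rightarrow> 'a \<Rightarrow> 'a \<Rightarrow> nat" where
  "graph_dist E x y =
     (LEAST n. \<exists>xs. walk E xs \<and> hd xs = x \<and> last xs = y \<and> length xs = Suc n)"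

text \<open>A matrix a on Y (indexed by the type 'a) defines a bounded operator on l2(Y)
  iff the bilinear forms of its finite sections are uniformly bounded on unit vectors;
  the operator norm is the supremum of these values.\<close>

definition matrix_form_values :: "('a \<Rightarrow> 'a \<Rightarrow> complex) \<Rightarrow> real set" where
  "matrix_form_values a =
     {cmod (\<Sum>x\<in>F. \<Sum>y\<in>F. cnj (g x) * a x y * f y) | F f g.
        finite F \<and> (\<Sum>x\<in>F. (cmod (f x))\<^sup>2) \<le> 1 \<and> (\<Sum>x\<in>F. (cmod (g x))\<^sup>2) \<le> 1}"

definition bounded_matrix :: "('a \<Rightarrow> 'a \<Rightarrow> complex) \<Rightarrow> bool" where
  "bounded_matrix a \<longleftrightarrow> bdd_above (matrix_form_values a)"

definition matrix_norm :: "('a \<Rightarrow> 'a \<Rightarrow> complex) \<Rightarrow> real" where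
  "matrix_norm a = Sup (matrix_form_values a)"

definition schur_multiplier :: "('a \<Rightarrow> 'a \<Rightarrow> complex) \<Rightarrow> bool" where
  "schur_multiplier \<psi> \<longleftrightarrow>
     (\<forall>a. bounded_matrix a \<longrightarrow> bounded_matrix (\<lambda>x y. \<psi> x y * a x y))"

definition schur_norm :: "('a \<Rightarrow> 'a \<Rightarrow> complex) \<Rightarrow> real" where
  "schur_norm \<psi> =
     Sup {matrix_norm (\<lambda>x y. \<psi> x y * a x y) | a. bounded_matrix a \<and> matrix_norm a \<le> 1}"

definition l2_summable :: "(nat \<Rightarrow> complex) \<Rightarrow> bool" where
  "l2_summable u \<longleftrightarrow> summable (\<lambda>i. (cmod (u i))\<^sup>2)"

definition l2_norm_seq :: "(nat \<Rightarrow> complex) \<Rightarrow> real" where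
  "l2_norm_seq u = sqrt (\<Sum>i. (cmod (u i))\<^sup>2)"

text \<open>Nuclear (= trace class) representations h = sum_k v_k (x) u_k with
  sum_k |u_k| |v_k| < infinity; the trace norm is the infimum of these sums.\<close>

definition nuclear_reps ::
  "(nat \<Rightarrow> nat \<Rightarrow> complex) \<Rightarrow> ((nat \<Rightarrow> nat \<Rightarrow> complex) \<times> (nat \<Rightarrow> nat \<Rightarrow> complex)) set" where
  "nuclear_reps h =
     {(u, v). (\<forall>k. l2_summable (u k) \<and> l2_summable (v k)) \<and>
              summable (\<lambda>k. l2_norm_seq (u k) * l2_norm_seq (v k)) \<and>
              (\<forall>i j. (\<lambda>k. u k i * v k j) sums h i j)}"

definition trace_class :: "(nat \<Rightarrow> nat \<Rightarrow> complex) \<Rightarrow> bool" where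
  "trace_class h \<longleftrightarrow> nuclear_reps h \<noteq> {}"

definition trace_norm :: "(nat \<Rightarrow> nat \<Rightarrow> complex) \<Rightarrow> real" where
  "trace_norm h =
     Inf ((\<lambda>(u, v). \<Sum>k. l2_norm_seq (u k) * l2_norm_seq (v k)) ` nuclear_reps h)"

end

theory Submission
  imports Defs
begin

text \<open>Upper bound: extend the tree by a virtual ray above the root, so that every vertex \<open>x\<close> has ancestors
  \<open>x\<^sub>0, x\<^sub>1, \<dots>\<close>. Ancestors of \<open>x\<close> and \<open>y\<close> agree, \<open>x\<^sub>i = y\<^sub>j\<close>, exactly for
  \<open>(i, j) = (i\<^sub>0 + m, j\<^sub>0 + m)\<close> with \<open>i\<^sub>0 + j\<^sub>0 = d(x, y)\<close>, so \<open>\<psi>(d(x, y))\<close> is the telescoping sum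
  of \<open>h\<^sub>i\<^sub>j\<close> over these pairs. A decomposition of \<open>H\<close> into rank one matrices \<open>u v\<close> thus gives a
  decomposition of \<open>\<psi>(d(x, y))\<close> into Gram kernels of vectors of norms \<open>\<bar>u\<bar>\<close> and \<open>\<bar>v\<bar>\<close>.

  Lower bound: embed the \<open>q\<close>-ary tree of words. Contractions \<open>Z\<^sub>p\<close> (\<open>p < N\<close>) on the levels \<open>k < N\<close> yield a contraction on
  words that acts by \<open>Z\<^sub>p\<close> on the part of \<open>l\<^sup>2\<close> depending on exactly the last \<open>p\<close> letters. Its Schur product with
  \<open>\<phi>(d)\<close>, tested on normalized radial vectors, tends for \<open>q \<rightarrow> \<infinity>\<close> to the mean over the levels of \<open>Z\<^sub>0(k, l) \<phi>(k + l)\<close>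
  plus \<open>Z\<^sub>p(k, l) h(k - p, l - p)\<close> for \<open>p > 0\<close>. Taking a shifted contraction \<open>T\<close> for \<open>p > 0\<close> and an antidiagonal matrix
  for \<open>p = 0\<close> bounds \<open>\<bar>c\<^sub>+\<bar> + \<bar>c\<^sub>-\<bar> + \<bar>tr (T H)\<bar>\<close>, and the trace norm is dual to the operator norm.\<close>

text \<open>\<open>schur_norm\<close> is a supremum over matrices, \<open>trace_norm\<close> an
  infimum over representations. The upper bound only has to estimate a given representation, but the
  lower bound has to produce one. Hahn-Banach in finite dimension does this for each finite section
  of \<open>H\<close>; gluing the sections needs more than bounded trace norms, namely that they are
  Cauchy in the trace norm. Moreover, a Schur multiplier is only assumed to preserve boundedness, so
  a bound common to all contractions has to be extracted before anything can be tested.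

  Why the test sees \<open>H\<close>: the part depending on exactly the last \<open>p\<close>
  letters belongs to the difference of the projections of depths \<open>p\<close> and
  \<open>p - 1\<close>. Words of lengths \<open>k\<close> and \<open>l\<close> sharing exactly
  \<open>p\<close> final letters have distance \<open>k + l - 2 p\<close>, so the two projections
  average \<open>\<phi>\<close> to \<open>\<phi> (k + l - 2 p)\<close> and
  \<open>\<phi> (k + l - 2 p + 2)\<close>, the two terms of \<open>h\<close>. These parts are
  mutually orthogonal, so each \<open>p\<close> may carry its own contraction. A fixed
  \<open>T\<close> fits at all but a bounded number of the \<open>N\<close> depths, hence loses
  nothing in the mean, while the block at \<open>p = 0\<close> only sees \<open>\<phi>\<close> near
  \<open>N\<close>.\<close>

section \<open>Bilinear forms on finite sections\<close>

definition l2n :: "'i set \<Rightarrow> ('i \<Rightarrow> complex) \<Rightarrow> real" where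
  "l2n F f = L2_set (\<lambda>x. cmod (f x)) F"

text \<open>The form is bilinear, not sesquilinear; conjugating \<open>g\<close> does not change its norm.\<close>

definition bform :: "'i set \<Rightarrow> ('i \<Rightarrow> 'i \<Rightarrow> complex) \<Rightarrow> ('i \<Rightarrow> complex) \<Rightarrow> ('i \<Rightarrow> complex) \<Rightarrow> complex" where
  "bform F a g f = (\<Sum>x\<in>F. \<Sum>y\<in>F. g x * a x y * f y)"

text \<open>An inequality for all vectors on one finite set passes through sums, scalings and limits
  without any prior boundedness, unlike the supremum in \<open>matrix_norm\<close>.\<close>

definition op_le :: "'i set \<Rightarrow> ('i \<Rightarrow> 'i \<Rightarrow> complex) \<Rightarrow> real \<Rightarrow> bool" where
  "op_le F a C \<longleftrightarrow> (\<forall>g f. cmod (bform F a g f) \<le> C * l2n F g * l2n F f)"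

lemma l2n_nonneg [simp]: "0 \<le> l2n F f"
  by (simp add: l2n_def)

lemma l2n_power2: "(l2n F f)\<^sup>2 = (\<Sum>x\<in>F. (cmod (f x))\<^sup>2)"
  by (simp add: l2n_def L2_set_def sum_nonneg)

lemma l2n_le_iff: "0 \<le> c \<Longrightarrow> l2n F f \<le> c \<longleftrightarrow> (\<Sum>x\<in>F. (cmod (f x))\<^sup>2) \<le> c\<^sup>2"
  by (metis l2n_nonneg l2n_power2 power2_le_imp_le power_mono)

lemma l2n_cong: "(\<And>x. x \<in> F \<Longrightarrow> cmod (f x) = cmod (g x)) \<Longrightarrow> l2n F f = l2n F g"
  unfolding l2n_def by (rule L2_set_cong) auto

lemma l2n_cnj [simp]: "l2n F (\<lambda>x. cnj (f x)) = l2n F f"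
  by (rule l2n_cong) simp

lemma l2n_scale: "l2n F (\<lambda>x. c * f x) = cmod c * l2n F f"
  by (simp add: l2n_def L2_set_right_distrib norm_mult)

lemma sum_mult_le_sqrt:
  fixes a b :: "'i \<Rightarrow> real"
  assumes "\<And>i. i \<in> I \<Longrightarrow> 0 \<le> a i" "\<And>i. i \<in> I \<Longrightarrow> 0 \<le> b i"
  shows "(\<Sum>i\<in>I. a i * b i) \<le> sqrt (\<Sum>i\<in>I. (a i)\<^sup>2) * sqrt (\<Sum>i\<in>I. (b i)\<^sup>2)"
proof -
  have "(\<Sum>i\<in>I. a i * b i) = (\<Sum>i\<in>I. \<bar>a i\<bar> * \<bar>b i\<bar>)"
    using assms by (intro sum.cong) auto
  then show ?thesis using L2_set_mult_ineq[of a b I] by (simp add: L2_set_def)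
qed

lemma bform_scale: "bform F a (\<lambda>x. c * g x) (\<lambda>x. d * f x) = c * d * bform F a g f"
  by (simp add: bform_def sum_distrib_left mult_ac)

lemma bform_cong:
  assumes "\<And>x y. x \<in> F \<Longrightarrow> y \<in> F \<Longrightarrow> g x * a x y * f y = g' x * a' x y * f' y"
  shows "bform F a g f = bform F a' g' f'"
  unfolding bform_def by (intro sum.cong) (auto simp: assms)

lemma op_leI:
  assumes "finite F" and "\<And>g f. l2n F g = 1 \<Longrightarrow> l2n F f = 1 \<Longrightarrow> cmod (bform F a g f) \<le> C"
  shows "op_le F a C"
  unfolding op_le_def
proof (intro allI)
  fix g f
  show "cmod (bform F a g f) \<le> C * l2n F g * l2n F f"
  proof (cases "l2n F g = 0 \<or> l2n F f = 0")
    case True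
    then have "(\<forall>x\<in>F. g x = 0) \<or> (\<forall>x\<in>F. f x = 0)"
      using assms(1) by (auto simp: l2n_def L2_set_eq_0_iff)
    then have "bform F a g f = 0" by (auto simp: bform_def intro!: sum.neutral)
    with True show ?thesis by auto
  next
    case False
    define s t where "s = l2n F g" and "t = l2n F f"
    have pos: "s > 0" "t > 0" using False by (auto simp: s_def t_def less_le)
    let ?g = "\<lambda>x. complex_of_real (1 / s) * g x"
    let ?f = "\<lambda>x. complex_of_real (1 / t) * f x"
    have "l2n F ?g = 1" "l2n F ?f = 1"
      unfolding l2n_scale using pos by (simp_all add: s_def t_def norm_divide)
    then have "cmod (bform F a ?g ?f) \<le> C" by (rule assms(2))
    then have "cmod (bform F a g f) / (s * t) \<le> C"
      unfolding bform_scale using pos by (simp add: norm_mult norm_divide)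
    then have "cmod (bform F a g f) \<le> C * s * t"
      using pos by (simp add: divide_le_eq mult.assoc)
    then show ?thesis by (simp add: s_def t_def)
  qed
qed

lemma op_leD: "op_le F a C \<Longrightarrow> cmod (bform F a g f) \<le> C * l2n F g * l2n F f"
  by (simp add: op_le_def)

lemma op_le_mono:
  assumes "op_le F a C" "C \<le> D" shows "op_le F a D"
  unfolding op_le_def
proof (intro allI)
  fix g f
  have "cmod (bform F a g f) \<le> C * l2n F g * l2n F f" using assms(1) by (rule op_leD)
  also have "\<dots> \<le> D * l2n F g * l2n F f" by (intro mult_right_mono assms) simp_all
  finally show "cmod (bform F a g f) \<le> D * l2n F g * l2n F f" .
qed

lemma zero_in_matrix_form_values: "0 \<in> matrix_form_values a"
  unfolding matrix_form_values_def by (simp, rule exI[of _ "{}"]) auto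

lemma bounded_matrixI:
  assumes "0 \<le> C" and "\<And>F. finite F \<Longrightarrow> op_le F a C"
  shows "bounded_matrix a \<and> matrix_norm a \<le> C"
proof -
  have *: "r \<le> C" if r: "r \<in> matrix_form_values a" for r
  proof -
    obtain F f g where F: "finite F" and r: "r = cmod (bform F a (\<lambda>x. cnj (g x)) f)"
      and le: "(\<Sum>x\<in>F. (cmod (f x))\<^sup>2) \<le> 1" "(\<Sum>x\<in>F. (cmod (g x))\<^sup>2) \<le> 1"
      using r unfolding matrix_form_values_def bform_def by auto
    have "l2n F f \<le> 1" "l2n F g \<le> 1" using le by (simp_all add: l2n_le_iff)
    have "r \<le> C * l2n F g * l2n F f"
      unfolding r using op_leD[OF assms(2)[OF F], of "\<lambda>x. cnj (g x)" f] by simp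
    also have "\<dots> \<le> C * 1 * 1"
      by (intro mult_mono assms \<open>l2n F f \<le> 1\<close> \<open>l2n F g \<le> 1\<close>) (auto simp: assms)
    finally show ?thesis by simp
  qed
  then have "bdd_above (matrix_form_values a)" by (auto simp: bdd_above_def)
  moreover have "Sup (matrix_form_values a) \<le> C"
    by (rule cSup_least) (use zero_in_matrix_form_values[of a] * in auto)
  ultimately show ?thesis by (simp add: bounded_matrix_def matrix_norm_def)
qed

lemma matrix_norm_nonneg: "bounded_matrix a \<Longrightarrow> 0 \<le> matrix_norm a"
  unfolding bounded_matrix_def matrix_norm_def
  by (rule cSup_upper) (rule zero_in_matrix_form_values)

lemma bounded_matrixD:
  assumes "bounded_matrix a" "finite F" shows "op_le F a (matrix_norm a)"
proof (rule op_leI[OF assms(2)])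
  fix g f :: "'a \<Rightarrow> complex" assume gf: "l2n F g = 1" "l2n F f = 1"
  have "cmod (bform F a g f) \<in> matrix_form_values a"
    unfolding matrix_form_values_def
  proof (rule CollectI, intro exI conjI)
    show "cmod (bform F a g f) = cmod (\<Sum>x\<in>F. \<Sum>y\<in>F. cnj (cnj (g x)) * a x y * f y)"
      by (simp add: bform_def)
    show "(\<Sum>x\<in>F. (cmod (f x))\<^sup>2) \<le> 1" "(\<Sum>x\<in>F. (cmod (cnj (g x)))\<^sup>2) \<le> 1"
      using gf by (simp_all flip: l2n_power2)
  qed (rule assms)
  then show "cmod (bform F a g f) \<le> matrix_norm a"
    using assms(1) unfolding bounded_matrix_def matrix_norm_def by (rule cSup_upper)
qed

subsection \<open>Trees\<close>

lemma walk_Cons_Cons: "walk E (x # y # zs) \<longleftrightarrow> E x y \<and> walk E (y # zs)"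
  unfolding walk_def by (auto simp: nth_Cons split: nat.splits)

lemma walk_singleton [simp]: "walk E [x]"
  by (simp add: walk_def)

lemma walk_append:
  "walk E xs \<Longrightarrow> walk E ys \<Longrightarrow> E (last xs) (hd ys) \<Longrightarrow> walk E (xs @ ys)"
proof (induction xs rule: induct_list012)
  case 1 then show ?case by (simp add: walk_def)
next
  case (2 x) then show ?case by (cases ys) (auto simp: walk_Cons_Cons)
next
  case (3 x y zs) then show ?case by (simp add: walk_Cons_Cons)
qed

text \<open>Relational powers replace vertex lists: they compose by addition of exponents and can be
  peeled off at either end.\<close>

lemma walk_iff_relpowp:
  "(\<exists>xs. walk E xs \<and> hd xs = x \<and> last xs = y \<and> length xs = Suc n) \<longleftrightarrow> (E ^^ n) x y"
proof (induction n arbitrary: x)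
  case 0
  show ?case by (auto simp: length_Suc_conv intro!: exI[of _ "[y]"])
next
  case (Suc n)
  show ?case
  proof
    assume "\<exists>xs. walk E xs \<and> hd xs = x \<and> last xs = y \<and> length xs = Suc (Suc n)"
    then obtain z zs where "walk E (x # z # zs)" "last (z # zs) = y" "length (z # zs) = Suc n"
      by (auto simp: length_Suc_conv)
    then have "E x z" "(E ^^ n) z y"
      using Suc.IH[of z] by (auto simp: walk_Cons_Cons simp del: length_Cons intro!: exI[of _ "z # zs"])
    then show "(E ^^ Suc n) x y" by (rule relpowp_Suc_I2)
  next
    assume "(E ^^ Suc n) x y"
    then obtain z where z: "E x z" "(E ^^ n) z y" by (rule relpowp_Suc_E2)
    then obtain zs where "walk E zs" "hd zs = z" "last zs = y" "length zs = Suc n"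
      using Suc.IH[of z] by auto
    with z show "\<exists>xs. walk E xs \<and> hd xs = x \<and> last xs = y \<and> length xs = Suc (Suc n)"
      by (intro exI[of _ "x # zs"]) (cases zs; auto simp: walk_Cons_Cons)
  qed
qed

lemma graph_dist_eq: "graph_dist E x y = (LEAST n. (E ^^ n) x y)"
  by (simp add: graph_dist_def walk_iff_relpowp)

locale rooted_tree =
  fixes E :: "'a \<Rightarrow> 'a \<Rightarrow> bool" and x0 :: 'a
  assumes tree: "is_tree E"
begin

lemma sym: "E x y \<Longrightarrow> E y x"
  using tree by (auto simp: is_tree_def)

lemma irrefl: "\<not> E x x"
  using tree by (auto simp: is_tree_def)

lemma connected: "\<exists>n. (E ^^ n) x y"
proof -
  obtain xs where xs: "walk E xs" "hd xs = x" "last xs = y"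
    using tree unfolding is_tree_def by blast
  then have "length xs = Suc (length xs - 1)" by (cases xs) (auto simp: walk_def)
  with xs have "(E ^^ (length xs - 1)) x y"
    unfolding walk_iff_relpowp[symmetric] by blast
  then show ?thesis ..
qed

lemma acyclic: "walk E xs \<Longrightarrow> distinct xs \<Longrightarrow> E (last xs) (hd xs) \<Longrightarrow> length xs < 3"
  using tree unfolding is_tree_def by (meson not_le)

lemma dist_walk: "(E ^^ graph_dist E x y) x y"
  unfolding graph_dist_eq using connected[of x y] by (rule LeastI_ex)

lemma dist_le: "(E ^^ n) x y \<Longrightarrow> graph_dist E x y \<le> n"
  unfolding graph_dist_eq by (rule Least_le)

lemma relpowp_sym: "(E ^^ n) x y \<Longrightarrow> (E ^^ n) y x"
proof (induction n arbitrary: y)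
  case (Suc n)
  then obtain z where "(E ^^ n) x z" "E z y" by (auto elim: relpowp_Suc_E)
  with Suc.IH sym show ?case by (blast intro: relpowp_Suc_I2)
qed simp

definition level :: "'a \<Rightarrow> nat" where "level x = graph_dist E x x0"

text \<open>With the root as its own parent, \<open>up i x\<close> stays at the root for
  \<open>i\<close> beyond \<open>level x\<close>; the virtual ray comes from the second coordinate
  of \<open>anc\<close>.\<close>

definition parent :: "'a \<Rightarrow> 'a" where
  "parent x = (if x = x0 then x0 else (SOME y. E x y \<and> level x = Suc (level y)))"

lemma level_eq_0_iff [simp]: "level x = 0 \<longleftrightarrow> x = x0"
  using dist_walk[of x x0] dist_le[of 0 x0 x0] by (auto simp: level_def)

lemma level_edge: "E x y \<Longrightarrow> level x \<le> Suc (level y)"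
  unfolding level_def by (rule dist_le) (blast intro: relpowp_Suc_I2 dist_walk)

lemma parent_root [simp]: "parent x0 = x0"
  by (simp add: parent_def)

lemma parent_edge:
  assumes "x \<noteq> x0" shows "E x (parent x) \<and> level x = Suc (level (parent x))"
proof -
  obtain n where n: "level x = Suc n" using assms by (metis level_eq_0_iff not0_implies_Suc)
  then obtain z where z: "E x z" "(E ^^ n) z x0"
    using dist_walk[of x x0] unfolding level_def by (metis relpowp_Suc_D2)
  have "level z \<le> n" unfolding level_def using z(2) by (rule dist_le)
  then have "E x z \<and> level x = Suc (level z)" using n z level_edge[of x z] by auto
  then have "\<exists>z. E x z \<and> level x = Suc (level z)" ..
  from someI_ex[OF this] show ?thesis unfolding parent_def using assms by simp
qed

abbreviation up :: "nat \<Rightarrow> 'a \<Rightarrow> 'a" where "up i \<equiv> parent ^^ i"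

lemma level_parent: "level (parent x) = level x - 1"
  using parent_edge[of x] iffD2[OF level_eq_0_iff, of x0] by (cases "x = x0") (simp_all del: level_eq_0_iff)

lemma level_up: "level (up i x) = level x - i"
  by (induction i) (auto simp: level_parent)

lemma up_level [simp]: "up (level x) x = x0"
  using level_up[of "level x" x] by simp

lemma up_edge: "i < level x \<Longrightarrow> E (up i x) (up (Suc i) x)"
  using parent_edge[of "up i x"] level_up[of i x] level_eq_0_iff[of "up i x"] by simp

lemma up_inj: "up i x = up j x \<Longrightarrow> i \<le> level x \<Longrightarrow> j \<le> level x \<Longrightarrow> i = j"
  by (metis level_up diff_diff_cancel)

lemma walk_up: "i \<le> level x \<Longrightarrow> walk E (map (\<lambda>m. up m x) [0..<Suc i])"
proof (induction i)
  case (Suc i)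
  have "walk E (map (\<lambda>m. up m x) [0..<Suc i] @ [up (Suc i) x])"
    by (rule walk_append) (use Suc up_edge[of i x] in auto)
  then show ?case by simp
qed simp

lemma walk_up_rev: "Suc i \<le> level x \<Longrightarrow> walk E (rev (map (\<lambda>m. up m x) [0..<Suc i]))"
proof (induction i)
  case (Suc i)
  have "walk E ([up (Suc i) x] @ rev (map (\<lambda>m. up m x) [0..<Suc i]))"
    by (rule walk_append) (use Suc up_edge[of i x] sym in auto)
  then show ?case by simp
qed simp

text \<open>Acyclicity enters here. The climbs from \<open>x\<close> and \<open>y\<close> to their
  first common ancestor, closed by the edge, form a cycle unless they have fewer than three vertices
  together, and then one end is the parent of the other.\<close>

lemma edge_cases:
  assumes "E x y"
  shows "(x \<noteq> x0 \<and> parent x = y) \<or> (y \<noteq> x0 \<and> parent y = x)"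
proof (rule ccontr)
  assume contra: "\<not> ?thesis"
  define Q where "Q i \<longleftrightarrow> (\<exists>j\<le>level y. up i x = up j y)" for i
  define i where "i = (LEAST i. Q i)"
  have Q0: "Q (level x)" unfolding Q_def by (intro exI[of _ "level y"]) simp
  have Qi: "Q i" unfolding i_def using Q0 by (rule LeastI)
  have i: "i \<le> level x" unfolding i_def using Q0 by (rule Least_le)
  have min_i: "\<not> Q m" if "m < i" for m using that not_less_Least unfolding i_def by blast
  define j where "j = (LEAST j. j \<le> level y \<and> up i x = up j y)"
  have j: "j \<le> level y" "up i x = up j y"
    using LeastI_ex[OF Qi[unfolded Q_def]] by (auto simp: j_def)
  have min_j: "up i x \<noteq> up m y" if "m < j" for m
    using not_less_Least[of m "\<lambda>j. j \<le> level y \<and> up i x = up j y"] that j(1) unfolding j_def by auto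
  define xs where "xs = map (\<lambda>m. up m x) [0..<Suc i] @ rev (map (\<lambda>m. up m y) [0..<j])"
  have d1: "distinct (map (\<lambda>m. up m x) [0..<Suc i])"
    unfolding distinct_map by (rule conjI, simp, rule inj_onI, rule up_inj) (use i in auto)
  have d2: "distinct (map (\<lambda>m. up m y) [0..<j])"
    unfolding distinct_map by (rule conjI, simp, rule inj_onI, rule up_inj) (use j in auto)
  \<comment> \<open>A coincidence with \<open>m' < j\<close> would make \<open>m\<close> satisfy
    \<open>Q\<close>, so \<open>m = i\<close> by minimality of \<open>i\<close>, and then
    \<open>m'\<close> contradicts minimality of \<open>j\<close>.\<close>
  have d3: "up m x \<noteq> up m' y" if "m \<le> i" "m' < j" for m m'
    using min_i[of m] min_j[OF that(2)] that j(1) unfolding Q_def by (cases "m = i") auto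
  have "distinct xs" unfolding xs_def distinct_append
    using d1 d2 d3 by (auto simp: less_Suc_eq_le simp del: upt_Suc)
  moreover have "walk E xs"
  proof (cases j)
    case 0 then show ?thesis using walk_up[OF i] by (simp add: xs_def)
  next
    case (Suc j')
    show ?thesis unfolding xs_def
    proof (rule walk_append)
      show "walk E (map (\<lambda>m. up m x) [0..<Suc i])" by (rule walk_up[OF i])
      show "walk E (rev (map (\<lambda>m. up m y) [0..<j]))"
        unfolding Suc by (rule walk_up_rev) (use j Suc in simp)
      have "E (up (Suc j') y) (up j' y)" using up_edge[of j' y] j Suc sym by auto
      then show "E (last (map (\<lambda>m. up m x) [0..<Suc i])) (hd (rev (map (\<lambda>m. up m y) [0..<j])))"
        using j(2) by (simp add: Suc)
    qed
  qed
  moreover have "hd xs = x" by (simp add: xs_def upt_conv_Cons del: upt_Suc)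
  moreover have "last xs = y"
  proof (cases j)
    case 0 then show ?thesis using j(2) by (simp add: xs_def)
  next
    case (Suc j') then show ?thesis
      by (simp add: xs_def last_rev hd_map upt_conv_Cons del: upt_Suc)
  qed
  ultimately have "length xs < 3" using acyclic[of xs] sym[OF assms] by simp
  then have "i + j < 2" by (simp add: xs_def)
  then consider "i = 0" "j = 0" | "i = 1" "j = 0" | "i = 0" "j = 1" by linarith
  then show False
  proof cases
    case 1 then show False using j(2) assms irrefl by simp
  next
    case 2 then show False using j(2) contra assms irrefl by (cases "x = x0") auto
  next
    case 3 then show False using j(2) contra assms irrefl by (cases "y = x0") auto
  qed
qed

text \<open>The root is continued upwards by a virtual ray, so that every vertex has an
  infinite line of ancestors: the integer coordinate is the height above the root.\<close>

definition anc :: "'a \<Rightarrow> nat \<Rightarrow> 'a \<times> int" where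
  "anc x i = (up i x, int i - int (level x))"

lemma inj_anc: "inj (anc x)"
  by (rule injI) (simp add: anc_def)

lemma anc_diff: "anc x i = anc y j \<Longrightarrow> int i - int (level x) = int j - int (level y)"
  by (simp add: anc_def)

lemma anc_Suc: "anc x i = anc y j \<Longrightarrow> anc x (Suc i) = anc y (Suc j)"
  by (simp add: anc_def)

lemma anc_add: "anc x i = anc y j \<Longrightarrow> anc x (i + m) = anc y (j + m)"
  by (induction m) (auto intro: anc_Suc)

lemma anc_parent: "x \<noteq> x0 \<Longrightarrow> anc x (Suc i) = anc (parent x) i"
  using parent_edge[of x] by (simp add: anc_def funpow_swap1)

text \<open>One more edge changes \<open>i + j\<close> by at most one. Going down lengthens the
  climb \<open>j\<close>; going up shortens it, or, if \<open>j = 0\<close>, pushes the meeting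
  point one step higher.\<close>

lemma walk_imp_anc: "(E ^^ n) x y \<Longrightarrow> \<exists>i j. anc x i = anc y j \<and> i + j \<le> n"
proof (induction n arbitrary: y)
  case 0 then show ?case by (auto intro!: exI[of _ 0])
next
  case (Suc n)
  then obtain z where z: "(E ^^ n) x z" "E z y" by (auto elim: relpowp_Suc_E)
  then obtain i j where ij: "anc x i = anc z j" "i + j \<le> n" using Suc.IH by blast
  from edge_cases[OF z(2)] show ?case
  proof
    assume z': "z \<noteq> x0 \<and> parent z = y"
    then have eq: "anc z (Suc m) = anc y m" for m using anc_parent[of z] by auto
    show ?thesis
    proof (cases j)
      case 0
      then have "anc x (Suc i) = anc y 0" using anc_Suc[OF ij(1)] eq by simp
      then show ?thesis using ij 0 by (intro exI[of _ "Suc i"] exI[of _ 0]) simp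
    next
      case (Suc j')
      then show ?thesis using ij eq by (intro exI[of _ i] exI[of _ j']) simp
    qed
  next
    assume "y \<noteq> x0 \<and> parent y = z"
    then have "anc x i = anc y (Suc j)" using ij anc_parent[of y j] by simp
    then show ?thesis using ij by (intro exI[of _ i] exI[of _ "Suc j"]) simp
  qed
qed

lemma up_walk: "i \<le> level x \<Longrightarrow> (E ^^ i) x (up i x)"
proof (induction i)
  case (Suc i)
  then have "(E ^^ i) x (up i x)" "E (up i x) (up (Suc i) x)" using up_edge[of i x] by auto
  then show ?case by (rule relpowp_Suc_I)
qed simp

text \<open>Coincidences of ancestors persist upwards by \<open>anc_add\<close>, and equality of
  heights fixes the difference of the indices, so they fill one diagonal half line. Its start gives
  a path of length \<open>i + j\<close>, and \<open>walk_imp_anc\<close> shows that no walk is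
  shorter. The root, common to all at height zero, keeps the start inside the tree.\<close>

lemma anc_meet:
  obtains i j where "graph_dist E x y = i + j" "i \<le> level x" "j \<le> level y"
    "\<And>k l. anc x k = anc y l \<longleftrightarrow> (\<exists>m. k = i + m \<and> l = j + m)"
proof -
  define i where "i = (LEAST i. \<exists>j. anc x i = anc y j)"
  have ex: "\<exists>j. anc x (level x) = anc y j"
    by (intro exI[of _ "level y"]) (simp add: anc_def)
  obtain j where j: "anc x i = anc y j"
    using LeastI[of "\<lambda>i. \<exists>j. anc x i = anc y j", OF ex] by (auto simp: i_def)
  have i_le: "i \<le> k" if "anc x k = anc y l" for k l
    unfolding i_def by (rule Least_le) (use that in blast)
  have i: "i \<le> level x" using ex i_le by blast
  have j_le: "j \<le> level y" using anc_diff[OF j] i by linarith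
  have iff: "anc x k = anc y l \<longleftrightarrow> (\<exists>m. k = i + m \<and> l = j + m)" for k l
  proof
    assume kl: "anc x k = anc y l"
    have "i \<le> k" using kl by (rule i_le)
    moreover have "int l - int j = int k - int i" using anc_diff[OF kl] anc_diff[OF j] by linarith
    ultimately show "\<exists>m. k = i + m \<and> l = j + m" by (intro exI[of _ "k - i"]) linarith
  qed (use anc_add[OF j] in blast)
  have "(E ^^ i) x (up i x)" using i by (rule up_walk)
  moreover have "(E ^^ j) (up i x) y"
    using relpowp_sym[OF up_walk[OF j_le]] j by (simp add: anc_def)
  ultimately have "(E ^^ (i + j)) x y" by (auto simp: relpowp_add)
  then have "graph_dist E x y \<le> i + j" by (rule dist_le)
  moreover have "i + j \<le> graph_dist E x y"
    using walk_imp_anc[OF dist_walk[of x y]] iff by fastforce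
  ultimately show ?thesis using that i j_le iff by (meson le_antisym)
qed

text \<open>A tree is bipartite. The kernel belonging to \<open>c\<^sub>-\<close> thus factors into
  unimodular functions of \<open>x\<close> and of \<open>y\<close>, and Schur multiplication by it
  costs no more than the modulus of the constant.\<close>

lemma minus_one_power_dist: "(-1::complex) ^ graph_dist E x y = (-1) ^ level x * (-1) ^ level y"
proof -
  obtain i j where d: "graph_dist E x y = i + j"
    and iff: "\<And>k l. anc x k = anc y l \<longleftrightarrow> (\<exists>m. k = i + m \<and> l = j + m)"
    by (rule anc_meet[of x y]) blast
  have "anc x i = anc y j" using iff by auto
  then have "int i - int (level x) = int j - int (level y)" by (rule anc_diff)
  then have "int (i + j) = int (level x + level y) + 2 * (int j - int (level y))" by simp
  then have "even (int (i + j)) \<longleftrightarrow> even (int (level x + level y))"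
    by (metis dvd_add_left_iff dvd_triv_left)
  then have "even (i + j) \<longleftrightarrow> even (level x + level y)" by (simp only: even_of_nat)
  then show ?thesis by (simp add: d uminus_power_if flip: power_add)
qed

end

section \<open>Embedding words into the tree\<close>

locale infinite_rooted_tree = rooted_tree +
  assumes infinite_degree: "infinite {y. E x y}"
begin

lemma children: "\<exists>c :: nat \<Rightarrow> 'a. inj c \<and> (\<forall>n. c n \<noteq> x0 \<and> parent (c n) = x)"
proof -
  have "{y. E x y} \<subseteq> insert (parent x) {y. y \<noteq> x0 \<and> parent y = x}"
    by (auto dest: edge_cases)
  then have "infinite {y. y \<noteq> x0 \<and> parent y = x}"
    using infinite_degree[of x] by (meson finite_insert finite_subset)
  then obtain c :: "nat \<Rightarrow> 'a" where "inj c" "range c \<subseteq> {y. y \<noteq> x0 \<and> parent y = x}"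
    by (metis infinite_countable_subset)
  then show ?thesis by (intro exI[of _ c]) auto
qed

definition child :: "'a \<Rightarrow> nat \<Rightarrow> 'a" where
  "child x = (SOME c. inj c \<and> (\<forall>n. c n \<noteq> x0 \<and> parent (c n) = x))"

lemma child: "inj (child x)" "child x n \<noteq> x0" "parent (child x n) = x"
  using someI_ex[OF children[of x]] unfolding child_def by auto

text \<open>Each step away from the root adds a letter in front, so \<open>drop\<close> climbs and
  common suffixes are common ancestors. Letters range over all of \<open>nat\<close>, so one
  embedding serves every \<open>q\<close>.\<close>

fun emb :: "nat list \<Rightarrow> 'a" where
  "emb [] = x0"
| "emb (c # w) = child (emb w) c"

lemma level_emb [simp]: "level (emb w) = length w"
  by (induction w) (use parent_edge[OF child(2)] child(3) in auto)

lemma up_emb: "up i (emb w) = emb (drop i w)"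
proof (induction i arbitrary: w)
  case (Suc i)
  then show ?case by (cases w) (auto simp: funpow_swap1 child(3), metis Suc.IH drop_Nil emb.simps(1))
qed simp

lemma inj_emb: "inj emb"
proof (rule injI)
  fix v w assume "emb v = emb w"
  then show "v = w"
  proof (induction v arbitrary: w)
    case Nil then show ?case using level_emb[of w] by (metis level_emb length_0_conv)
  next
    case (Cons c v)
    then obtain d w' where w: "w = d # w'"
      by (metis child(2) emb.simps emb.cases)
    have "emb v = emb w'" using Cons.prems w child(3) by (metis emb.simps(2))
    then show ?case using Cons w child(1)[of "emb v"] by (auto dest: injD)
  qed
qed

text \<open>The common suffix of length \<open>p\<close> gives a common ancestor; a lower meeting
  point would make the words agree on one more letter. If one word is exhausted, \<open>neq\<close>
  is vacuous and the meeting point is that word itself.\<close>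

lemma dist_emb:
  assumes p: "p \<le> length v" "p \<le> length w"
    and eq: "drop (length v - p) v = drop (length w - p) w"
    and neq: "p < length v \<Longrightarrow> p < length w \<Longrightarrow> drop (length v - Suc p) v \<noteq> drop (length w - Suc p) w"
  shows "graph_dist E (emb v) (emb w) = (length v - p) + (length w - p)"
proof -
  obtain i j where d: "graph_dist E (emb v) (emb w) = i + j" and le: "i \<le> length v" "j \<le> length w"
    and iff: "\<And>k l. anc (emb v) k = anc (emb w) l \<longleftrightarrow> (\<exists>m. k = i + m \<and> l = j + m)"
    by (rule anc_meet[of "emb v" "emb w"]) simp
  have "anc (emb v) (length v - p) = anc (emb w) (length w - p)"
    using p eq by (simp add: anc_def up_emb)
  then obtain m where m: "length v - p = i + m" "length w - p = j + m" using iff by auto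
  have "m = 0"
  proof (rule ccontr)
    assume "m \<noteq> 0"
    then have lt: "p < length v" "p < length w"
      and "length v - Suc p = i + (m - 1)" "length w - Suc p = j + (m - 1)" using m by auto
    then have "anc (emb v) (length v - Suc p) = anc (emb w) (length w - Suc p)" using iff by blast
    then have "emb (drop (length v - Suc p) v) = emb (drop (length w - Suc p) w)"
      by (simp add: anc_def up_emb)
    then show False using neq[OF lt] inj_emb by (auto dest: injD)
  qed
  with m d show ?thesis by simp
qed

end

subsection \<open>Schur multipliers of Gram type\<close>

text \<open>Schur multiplication by a Gram kernel is a sum over \<open>z\<close> of copies of
  \<open>a\<close> with \<open>g\<close> weighted by \<open>p _ z\<close> and \<open>f\<close> by
  \<open>q _ z\<close>. Cauchy-Schwarz over \<open>z\<close> recombines the weights into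
  \<open>A\<close> and \<open>B\<close>.\<close>

lemma op_le_gram:
  assumes "finite F" "finite Z" "0 \<le> A" "0 \<le> B" "0 \<le> C" and a: "op_le F a C"
    and p: "\<And>x. x \<in> F \<Longrightarrow> l2n Z (p x) \<le> A" and q: "\<And>y. y \<in> F \<Longrightarrow> l2n Z (q y) \<le> B"
  shows "op_le F (\<lambda>x y. (\<Sum>z\<in>Z. p x z * q y z) * a x y) (A * B * C)"
proof (rule op_leI[OF assms(1)])
  fix g f :: "'a \<Rightarrow> complex" assume gf: "l2n F g = 1" "l2n F f = 1"
  let ?g = "\<lambda>z x. g x * p x z" and ?f = "\<lambda>z y. f y * q y z"
  have weight: "(\<Sum>z\<in>Z. (l2n F (\<lambda>x. g x * p x z))\<^sup>2) \<le> A\<^sup>2"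
    if "l2n F g = 1" "\<And>x. x \<in> F \<Longrightarrow> l2n Z (p x) \<le> A" "0 \<le> A" for A and g :: "'a \<Rightarrow> complex" and p
  proof -
    have "(\<Sum>z\<in>Z. (l2n F (\<lambda>x. g x * p x z))\<^sup>2) = (\<Sum>z\<in>Z. \<Sum>x\<in>F. (cmod (g x))\<^sup>2 * (cmod (p x z))\<^sup>2)"
      by (simp add: l2n_power2 norm_mult power_mult_distrib)
    also have "\<dots> = (\<Sum>x\<in>F. (cmod (g x))\<^sup>2 * (l2n Z (p x))\<^sup>2)"
      by (subst sum.swap) (simp add: l2n_power2 sum_distrib_left)
    also have "\<dots> \<le> (\<Sum>x\<in>F. (cmod (g x))\<^sup>2 * A\<^sup>2)"
      using that by (intro sum_mono mult_left_mono power_mono) auto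
    also have "\<dots> = A\<^sup>2" using that(1) l2n_power2[of F g] by (simp flip: sum_distrib_right)
    finally show ?thesis .
  qed
  have "bform F (\<lambda>x y. (\<Sum>z\<in>Z. p x z * q y z) * a x y) g f = (\<Sum>x\<in>F. \<Sum>y\<in>F. \<Sum>z\<in>Z. ?g z x * a x y * ?f z y)"
    unfolding bform_def by (simp add: sum_distrib_left sum_distrib_right mult_ac)
  also have "\<dots> = (\<Sum>z\<in>Z. bform F a (?g z) (?f z))"
    unfolding bform_def by (simp only: sum.swap[of _ Z] sum.swap[of _ Z F])
  finally have "cmod (bform F (\<lambda>x y. (\<Sum>z\<in>Z. p x z * q y z) * a x y) g f) \<le> (\<Sum>z\<in>Z. cmod (bform F a (?g z) (?f z)))"
    by (simp add: norm_sum)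
  also have "\<dots> \<le> (\<Sum>z\<in>Z. C * (l2n F (?g z) * l2n F (?f z)))"
    using op_leD[OF a] by (intro sum_mono) (simp add: mult.assoc)
  also have "\<dots> = C * (\<Sum>z\<in>Z. l2n F (?g z) * l2n F (?f z))" by (simp add: sum_distrib_left)
  also have "\<dots> \<le> C * (sqrt (\<Sum>z\<in>Z. (l2n F (?g z))\<^sup>2) * sqrt (\<Sum>z\<in>Z. (l2n F (?f z))\<^sup>2))"
    by (intro mult_left_mono sum_mult_le_sqrt assms) simp_all
  also have "\<dots> \<le> C * (A * B)"
  proof (intro mult_left_mono mult_mono assms)
    show "sqrt (\<Sum>z\<in>Z. (l2n F (?g z))\<^sup>2) \<le> A"
      using real_sqrt_le_mono[OF weight[OF gf(1) p \<open>0 \<le> A\<close>]] \<open>0 \<le> A\<close> by simp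
    show "sqrt (\<Sum>z\<in>Z. (l2n F (?f z))\<^sup>2) \<le> B"
      using real_sqrt_le_mono[OF weight[OF gf(2) q \<open>0 \<le> B\<close>]] \<open>0 \<le> B\<close> by simp
  qed (simp add: sum_nonneg)
  finally show "cmod (bform F (\<lambda>x y. (\<Sum>z\<in>Z. p x z * q y z) * a x y) g f) \<le> A * B * C"
    by (simp add: mult_ac)
qed

lemma op_le_add:
  assumes "op_le F a A" "op_le F b B" shows "op_le F (\<lambda>x y. a x y + b x y) (A + B)"
  unfolding op_le_def
proof (intro allI)
  fix g f
  have "bform F (\<lambda>x y. a x y + b x y) g f = bform F a g f + bform F b g f"
    by (simp add: bform_def distrib_left distrib_right sum.distrib)
  then have "cmod (bform F (\<lambda>x y. a x y + b x y) g f) \<le> A * l2n F g * l2n F f + B * l2n F g * l2n F f"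
    using op_leD[OF assms(1)] op_leD[OF assms(2)] by (metis add_mono norm_triangle_ineq order_trans)
  then show "cmod (bform F (\<lambda>x y. a x y + b x y) g f) \<le> (A + B) * l2n F g * l2n F f"
    by (simp add: distrib_right)
qed

lemma op_le_unimodular:
  assumes "op_le F a A" "\<And>x. cmod (s x) = 1" "\<And>x. cmod (t x) = 1"
  shows "op_le F (\<lambda>x y. c * s x * t y * a x y) (cmod c * A)"
  unfolding op_le_def
proof (intro allI)
  fix g f
  have "bform F (\<lambda>x y. c * s x * t y * a x y) g f = c * bform F a (\<lambda>x. s x * g x) (\<lambda>y. t y * f y)"
    unfolding bform_def by (simp add: sum_distrib_left mult_ac)
  moreover have "l2n F (\<lambda>x. s x * g x) = l2n F g" "l2n F (\<lambda>x. t x * f x) = l2n F f"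
    by (rule l2n_cong, simp add: norm_mult assms)+
  ultimately show "cmod (bform F (\<lambda>x y. c * s x * t y * a x y) g f) \<le> cmod c * A * l2n F g * l2n F f"
    using op_leD[OF assms(1), of "\<lambda>x. s x * g x" "\<lambda>y. t y * f y"]
    by (simp add: norm_mult mult_left_mono mult.assoc)
qed

subsection \<open>Nuclear representations\<close>

lemma l2n_shift_le:
  assumes "l2_summable u" shows "l2n {..<N} (\<lambda>m. u (m + e)) \<le> l2_norm_seq u"
proof -
  have "(\<Sum>m<N. (cmod (u (m + e)))\<^sup>2) = (\<Sum>m\<in>{e..<N + e}. (cmod (u m))\<^sup>2)"
    by (rule sum.reindex_bij_witness[of _ "\<lambda>m. m - e" "\<lambda>m. m + e"]) auto
  also have "\<dots> \<le> (\<Sum>m. (cmod (u m))\<^sup>2)"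
    using assms unfolding l2_summable_def by (intro sum_le_suminf) auto
  finally show ?thesis
    unfolding l2n_def L2_set_def l2_norm_seq_def by simp
qed

lemma l2n_le_l2_norm_seq: "l2_summable u \<Longrightarrow> l2n {..<N} u \<le> l2_norm_seq u"
  using l2n_shift_le[of u N 0] by simp

lemma l2_norm_seq_nonneg [simp]: "0 \<le> l2_norm_seq u" if "l2_summable u"
  using l2n_le_l2_norm_seq[OF that, of 0] by (simp add: l2n_def)

lemma nuclear_repsD:
  assumes "(u, v) \<in> nuclear_reps h"
  shows "l2_summable (u k)" "l2_summable (v k)"
    "summable (\<lambda>k. l2_norm_seq (u k) * l2_norm_seq (v k))" "(\<lambda>k. u k i * v k j) sums h i j"
  using assms by (auto simp: nuclear_reps_def)

text \<open>By Cauchy-Schwarz a rank one term contributes at most the product of its norms to any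
  shifted diagonal. For a Hankel matrix of differences these diagonals telescope, which yields
  limits of \<open>\<phi>\<close> along a parity class.\<close>

lemma nuclear_diagonal_summable:
  assumes rep: "(u, v) \<in> nuclear_reps h"
  shows "summable (\<lambda>m. h (m + e) m)"
proof -
  note rep = nuclear_repsD[OF rep]
  have "summable (\<lambda>m. cmod (h (m + e) m))"
  proof (rule summableI_nonneg_bounded)
    fix N
    have summ: "summable (\<lambda>k. cmod (u k (m + e) * v k m))" for m
    proof (rule summable_comparison_test'[OF rep(3)])
      fix k
      have "cmod (u k (m + e)) \<le> l2n {..<Suc m} (\<lambda>m. u k (m + e))" "cmod (v k m) \<le> l2n {..<Suc m} (v k)"
        unfolding l2n_def by (rule member_le_L2_set[of _ _ "\<lambda>m. cmod (u k (m + e))"], auto,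
          rule member_le_L2_set[of _ _ "\<lambda>m. cmod (v k m)"], auto)
      then show "norm (cmod (u k (m + e) * v k m)) \<le> l2_norm_seq (u k) * l2_norm_seq (v k)"
        using l2n_shift_le[OF rep(1)[of k], of "Suc m" e] l2n_le_l2_norm_seq[OF rep(2)[of k], of "Suc m"]
        by (simp add: norm_mult) (intro mult_mono, auto intro: order_trans simp: rep)
    qed
    have "(\<Sum>m<N. cmod (h (m + e) m)) \<le> (\<Sum>m<N. \<Sum>k. cmod (u k (m + e) * v k m))"
    proof (rule sum_mono)
      fix m show "cmod (h (m + e) m) \<le> (\<Sum>k. cmod (u k (m + e) * v k m))"
        using summable_norm[OF summ[of m]] sums_unique[OF rep(4)[of "m + e" m]] by simp
    qed
    also have "\<dots> = (\<Sum>k. \<Sum>m<N. cmod (u k (m + e) * v k m))"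
      by (rule suminf_sum[symmetric]) (rule summ)
    also have "\<dots> \<le> (\<Sum>k. l2_norm_seq (u k) * l2_norm_seq (v k))"
    proof (rule suminf_le)
      fix k
      have "(\<Sum>m<N. cmod (u k (m + e) * v k m)) \<le> l2n {..<N} (\<lambda>m. u k (m + e)) * l2n {..<N} (v k)"
        using L2_set_mult_ineq[of "\<lambda>m. cmod (u k (m + e))" "\<lambda>m. cmod (v k m)" "{..<N}"]
        by (simp add: l2n_def norm_mult)
      also have "\<dots> \<le> l2_norm_seq (u k) * l2_norm_seq (v k)"
        by (intro mult_mono l2n_shift_le l2n_le_l2_norm_seq) (simp_all add: rep)
      finally show "(\<Sum>m<N. cmod (u k (m + e) * v k m)) \<le> l2_norm_seq (u k) * l2_norm_seq (v k)" .
    qed (auto intro: summable_sum summ rep)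
    finally show "(\<Sum>m<N. cmod (h (m + e) m)) \<le> (\<Sum>k. l2_norm_seq (u k) * l2_norm_seq (v k))" .
  qed simp
  then show ?thesis by (rule summable_norm_cancel)
qed

section \<open>The constants as limits along even and odd indices\<close>

lemma tendsto_even_odd:
  fixes X :: "nat \<Rightarrow> complex"
  assumes "(\<lambda>n. X (2 * n)) \<longlonglongrightarrow> l" "(\<lambda>n. X (2 * n + 1)) \<longlonglongrightarrow> l"
  shows "X \<longlonglongrightarrow> l"
proof (rule LIMSEQ_I)
  fix r :: real assume "r > 0"
  obtain N1 where N1: "\<And>n. n \<ge> N1 \<Longrightarrow> norm (X (2 * n) - l) < r"
    using LIMSEQ_D[OF assms(1) \<open>r > 0\<close>] by blast
  obtain N2 where N2: "\<And>n. n \<ge> N2 \<Longrightarrow> norm (X (2 * n + 1) - l) < r"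
    using LIMSEQ_D[OF assms(2) \<open>r > 0\<close>] by blast
  have "norm (X n - l) < r" if "n \<ge> 2 * (N1 + N2)" for n
  proof (cases "even n")
    case True with N1[of "n div 2"] that show ?thesis by auto
  next
    case False
    then have "n = 2 * (n div 2) + 1" by presburger
    with N2[of "n div 2"] that show ?thesis by auto
  qed
  then show "\<exists>no. \<forall>n\<ge>no. norm (X n - l) < r" by blast
qed

lemma decomposition_exists:
  fixes \<phi> :: "nat \<Rightarrow> complex"
  assumes "trace_class (\<lambda>i j. \<phi> (i + j) - \<phi> (i + j + 2))"
  shows "\<exists>cp cm \<psi>. (\<forall>n. \<phi> n = cp + cm * (-1) ^ n + \<psi> n) \<and> \<psi> \<longlonglongrightarrow> 0"
proof -
  have lim: "\<exists>L. (\<lambda>n. \<phi> (2 * n + e)) \<longlonglongrightarrow> L" for e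
  proof -
    obtain u v where "(u, v) \<in> nuclear_reps (\<lambda>i j. \<phi> (i + j) - \<phi> (i + j + 2))"
      using assms by (auto simp: trace_class_def)
    from nuclear_diagonal_summable[OF this, of e]
    have "(\<lambda>n. \<Sum>m<n. \<phi> (m + e + m) - \<phi> (m + e + m + 2)) \<longlonglongrightarrow> (\<Sum>m. \<phi> (m + e + m) - \<phi> (m + e + m + 2))"
      by (rule summable_LIMSEQ)
    moreover have "(\<Sum>m<n. \<phi> (m + e + m) - \<phi> (m + e + m + 2)) = \<phi> e - \<phi> (2 * n + e)" for n
      by (induction n) (auto simp: algebra_simps mult_2 numeral_2_eq_2)
    ultimately have "(\<lambda>n. \<phi> e - \<phi> (2 * n + e)) \<longlonglongrightarrow> (\<Sum>m. \<phi> (m + e + m) - \<phi> (m + e + m + 2))"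
      by simp
    from tendsto_diff[OF tendsto_const[of "\<phi> e"] this] show ?thesis by auto
  qed
  obtain L0 where L0: "(\<lambda>n. \<phi> (2 * n)) \<longlonglongrightarrow> L0" using lim[of 0] by auto
  obtain L1 where L1: "(\<lambda>n. \<phi> (2 * n + 1)) \<longlonglongrightarrow> L1" using lim[of 1] by auto
  \<comment> \<open>Chosen so that \<open>cp + cm = L0\<close> and
    \<open>cp - cm = L1\<close>.\<close>
  define cp cm where "cp = (L0 + L1) / 2" and "cm = (L0 - L1) / 2"
  define \<psi> where "\<psi> n = \<phi> n - (cp + cm * (-1) ^ n)" for n
  have "\<psi> \<longlonglongrightarrow> 0"
  proof (rule tendsto_even_odd)
    have "(\<lambda>n. \<phi> (2 * n) - L0) \<longlonglongrightarrow> 0" using L0 by (simp add: LIM_zero)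
    then show "(\<lambda>n. \<psi> (2 * n)) \<longlonglongrightarrow> 0"
      by (simp add: \<psi>_def cp_def cm_def field_simps)
    have "(\<lambda>n. \<phi> (2 * n + 1) - L1) \<longlonglongrightarrow> 0" using L1 by (simp add: LIM_zero)
    then show "(\<lambda>n. \<psi> (2 * n + 1)) \<longlonglongrightarrow> 0"
      by (simp add: \<psi>_def cp_def cm_def field_simps)
  qed
  then show ?thesis by (intro exI[of _ cp] exI[of _ cm] exI[of _ \<psi>]) (simp add: \<psi>_def)
qed

text \<open>These two limits determine the constants, which gives uniqueness; they are also the data
  that the lower bound can detect.\<close>

lemma decomposition_limits:
  fixes \<phi> :: "nat \<Rightarrow> complex"
  assumes "\<forall>n. \<phi> n = cp + cm * (-1) ^ n + \<psi> n" "\<psi> \<longlonglongrightarrow> 0"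
  shows "(\<lambda>n. \<phi> (2 * n)) \<longlonglongrightarrow> cp + cm" "(\<lambda>n. \<phi> (2 * n + 1)) \<longlonglongrightarrow> cp - cm"
proof -
  have "(\<lambda>n. \<psi> (2 * n)) \<longlonglongrightarrow> 0"
    by (rule LIMSEQ_subseq_LIMSEQ[OF assms(2), unfolded comp_def]) (auto simp: strict_mono_def)
  from tendsto_add[OF tendsto_const[of "cp + cm"] this]
  show "(\<lambda>n. \<phi> (2 * n)) \<longlonglongrightarrow> cp + cm" by (simp add: assms(1)[rule_format])
  have "(\<lambda>n. \<psi> (2 * n + 1)) \<longlonglongrightarrow> 0"
    by (rule LIMSEQ_subseq_LIMSEQ[OF assms(2), unfolded comp_def]) (auto simp: strict_mono_def)
  from tendsto_add[OF tendsto_const[of "cp - cm"] this]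
  show "(\<lambda>n. \<phi> (2 * n + 1)) \<longlonglongrightarrow> cp - cm" by (simp add: assms(1)[rule_format])
qed

lemma decomposition_unique:
  fixes \<phi> :: "nat \<Rightarrow> complex"
  assumes "\<forall>n. \<phi> n = cp + cm * (-1) ^ n + \<psi> n" "\<psi> \<longlonglongrightarrow> 0"
    and "\<forall>n. \<phi> n = cp' + cm' * (-1) ^ n + \<psi>' n" "\<psi>' \<longlonglongrightarrow> 0"
  shows "cp = cp' \<and> cm = cm' \<and> \<psi> = \<psi>'"
proof -
  note l = decomposition_limits[OF assms(1,2)] and l' = decomposition_limits[OF assms(3,4)]
  have "cp + cm = cp' + cm'" using l(1) l'(1) by (rule LIMSEQ_unique)
  moreover have "cp - cm = cp' - cm'" using l(2) l'(2) by (rule LIMSEQ_unique)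
  ultimately have "((cp + cm) + (cp - cm)) / 2 = ((cp' + cm') + (cp' - cm')) / 2"
    "((cp + cm) - (cp - cm)) / 2 = ((cp' + cm') - (cp' - cm')) / 2" by presburger+
  then have "cp = cp'" "cm = cm'" by simp_all
  with assms(1,3) have "\<psi> n = \<psi>' n" for n by (metis add_left_cancel)
  with \<open>cp = cp'\<close> \<open>cm = cm'\<close> show ?thesis by auto
qed

subsection \<open>The upper bound\<close>

context rooted_tree
begin

text \<open>Written as a double sum over all pairs of ancestors rather than along the diagonal,
  since for \<open>h i j = u i * v j\<close> this is visibly a Gram kernel. The cutoff
  \<open>N\<close> keeps the vectors finite.\<close>

definition meet_sum :: "(nat \<Rightarrow> nat \<Rightarrow> complex) \<Rightarrow> nat \<Rightarrow> 'a \<Rightarrow> 'a \<Rightarrow> complex" where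
  "meet_sum h N x y = (\<Sum>i<N. \<Sum>j<N. if anc x i = anc y j then h i j else 0)"

lemma meet_sum_eq:
  assumes iff: "\<And>k l. anc x k = anc y l \<longleftrightarrow> (\<exists>m. k = i + m \<and> l = j + m)"
  shows "meet_sum h N x y = (\<Sum>m<N - max i j. h (i + m) (j + m))"
proof -
  have "meet_sum h N x y = (\<Sum>p\<in>{..<N} \<times> {..<N}. if anc x (fst p) = anc y (snd p) then h (fst p) (snd p) else 0)"
    unfolding meet_sum_def by (simp add: sum.cartesian_product case_prod_beta)
  also have "\<dots> = (\<Sum>p\<in>{p \<in> {..<N} \<times> {..<N}. anc x (fst p) = anc y (snd p)}. h (fst p) (snd p))"
    by (rule sum.inter_filter[symmetric]) simp
  also have "\<dots> = (\<Sum>m<N - max i j. h (i + m) (j + m))"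
    by (rule sum.reindex_bij_witness[of _ "\<lambda>m. (i + m, j + m)" "\<lambda>p. fst p - i"]) (auto simp: iff)
  finally show ?thesis .
qed

text \<open>Here \<open>c\<close> is the larger of the two indices at which the ancestors meet.
  Truncated subtraction also covers \<open>N < c\<close>, where the sum is empty.\<close>

lemma meet_sum_telescope:
  assumes "\<And>i j. h i j = \<phi> (i + j) - \<phi> (i + j + 2)"
  shows "\<exists>c. \<forall>N. meet_sum h N x y = \<phi> (graph_dist E x y) - \<phi> (graph_dist E x y + 2 * (N - c))"
proof -
  obtain i j where d: "graph_dist E x y = i + j"
    and iff: "\<And>k l. anc x k = anc y l \<longleftrightarrow> (\<exists>m. k = i + m \<and> l = j + m)"
    by (rule anc_meet[of x y]) blast
  have "h (i + m) (j + m) = \<phi> (i + j + 2 * m) - \<phi> (i + j + 2 * Suc m)" for m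
    by (simp add: assms algebra_simps mult_2 mult_2_right)
  then have "(\<Sum>m<n. h (i + m) (j + m)) = \<phi> (i + j) - \<phi> (i + j + 2 * n)" for n
    using sum_lessThan_telescope'[of "\<lambda>m. \<phi> (i + j + 2 * m)" n] by simp
  then have "meet_sum h N x y = \<phi> (i + j) - \<phi> (i + j + 2 * (N - max i j))" for N
    by (simp only: meet_sum_eq[OF iff])
  then show ?thesis unfolding d by blast
qed

text \<open>\<open>p u x\<close> lays the first \<open>N\<close> entries of \<open>u\<close> along
  the line of ancestors of \<open>x\<close>; injectivity of \<open>anc x\<close> bounds its norm by
  that of \<open>u\<close>. Pairing \<open>p u x\<close> with \<open>p v y\<close> picks out exactly
  the common ancestors.\<close>

lemma op_le_meet_sum_rank_one:
  assumes "finite F" "op_le F a C" "0 \<le> C" "l2_summable u" "l2_summable v"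
  shows "op_le F (\<lambda>x y. meet_sum (\<lambda>i j. u i * v j) N x y * a x y) (l2_norm_seq u * l2_norm_seq v * C)"
proof -
  define Z where "Z = (\<Union>x\<in>F. anc x ` {..<N})"
  define p where "p u x z = (\<Sum>i<N. if anc x i = z then u i else 0)" for u :: "nat \<Rightarrow> complex" and x z
  have Z: "finite Z" using assms by (simp add: Z_def)
  have p_anc: "p u x (anc x i) = u i" if "i < N" for u x i
    using that by (simp add: p_def inj_eq[OF inj_anc])
  have p_out: "p u x z = 0" if "z \<notin> anc x ` {..<N}" for u x z
    unfolding p_def by (rule sum.neutral) (use that in auto)
  have p_le: "l2n Z (p u x) \<le> l2_norm_seq u" if x: "x \<in> F" and u: "l2_summable u" for u x
  proof -
    have "(\<Sum>z\<in>Z. (cmod (p u x z))\<^sup>2) = (\<Sum>z\<in>anc x ` {..<N}. (cmod (p u x z))\<^sup>2)"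
      by (rule sum.mono_neutral_right[OF Z])
        (use x in \<open>auto simp: Z_def p_out\<close>)
    also have "\<dots> = (\<Sum>i<N. (cmod (u i))\<^sup>2)"
      by (subst sum.reindex) (auto intro: inj_on_subset[OF inj_anc] simp: p_anc)
    finally have "l2n Z (p u x) = l2n {..<N} u" by (simp add: l2n_def L2_set_def)
    then show ?thesis using l2n_le_l2_norm_seq[OF u] by simp
  qed
  have "meet_sum (\<lambda>i j. u i * v j) N x y = (\<Sum>z\<in>Z. p u x z * p v y z)" if x: "x \<in> F" for x y
  proof -
    have "(\<Sum>z\<in>Z. p u x z * p v y z) = (\<Sum>z\<in>anc x ` {..<N}. p u x z * p v y z)"
      by (rule sum.mono_neutral_right[OF Z])
        (use x in \<open>auto simp: Z_def p_out\<close>)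
    also have "\<dots> = (\<Sum>i<N. u i * p v y (anc x i))"
      by (subst sum.reindex) (auto intro: inj_on_subset[OF inj_anc] simp: p_anc)
    also have "\<dots> = meet_sum (\<lambda>i j. u i * v j) N x y"
      unfolding p_def meet_sum_def by (simp add: sum_distrib_left if_distrib eq_commute cong: if_cong)
    finally show ?thesis ..
  qed
  then have "bform F (\<lambda>x y. meet_sum (\<lambda>i j. u i * v j) N x y * a x y) g f
      = bform F (\<lambda>x y. (\<Sum>z\<in>Z. p u x z * p v y z) * a x y) g f" for g f
    by (intro bform_cong) simp
  moreover have "op_le F (\<lambda>x y. (\<Sum>z\<in>Z. p u x z * p v y z) * a x y) (l2_norm_seq u * l2_norm_seq v * C)"
    by (rule op_le_gram[OF assms(1) Z]) (use assms p_le in auto)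
  ultimately show ?thesis unfolding op_le_def by simp
qed

text \<open>For fixed \<open>N\<close> the series over the rank one terms converges entrywise. The
  resulting bound is independent of \<open>N\<close>, so \<open>N\<close> may tend to infinity
  afterwards.\<close>

lemma op_le_meet_sum:
  assumes F: "finite F" and a: "op_le F a C" "0 \<le> C" and rep: "(u, v) \<in> nuclear_reps h"
  shows "op_le F (\<lambda>x y. meet_sum h N x y * a x y) ((\<Sum>k. l2_norm_seq (u k) * l2_norm_seq (v k)) * C)"
  unfolding op_le_def
proof (intro allI)
  fix g f
  note rep = nuclear_repsD[OF rep]
  let ?s = "\<lambda>k x y. meet_sum (\<lambda>i j. u k i * v k j) N x y * a x y"
  have "(\<lambda>k. if anc x i = anc y j then u k i * v k j else 0) sums (if anc x i = anc y j then h i j else 0)" for x y i j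
    using rep(4)[of i j] by auto
  then have "(\<lambda>k. meet_sum (\<lambda>i j. u k i * v k j) N x y) sums meet_sum h N x y" for x y
    unfolding meet_sum_def by (intro sums_sum)
  then have sums: "(\<lambda>k. bform F (?s k) g f) sums bform F (\<lambda>x y. meet_sum h N x y * a x y) g f"
    unfolding bform_def by (intro sums_sum sums_mult sums_mult2)
  have le: "cmod (bform F (?s k) g f) \<le> l2_norm_seq (u k) * l2_norm_seq (v k) * (C * l2n F g * l2n F f)" for k
    using op_leD[OF op_le_meet_sum_rank_one[OF F a rep(1,2)[of k]]] by (simp add: mult.assoc)
  have summ: "summable (\<lambda>k. l2_norm_seq (u k) * l2_norm_seq (v k) * (C * l2n F g * l2n F f))"
    by (rule summable_mult2[OF rep(3)])
  have "cmod (bform F (\<lambda>x y. meet_sum h N x y * a x y) g f) \<le> (\<Sum>k. l2_norm_seq (u k) * l2_norm_seq (v k) * (C * l2n F g * l2n F f))"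
    unfolding sums_unique[OF sums] using le summ by (rule norm_suminf_le)
  also have "\<dots> = (\<Sum>k. l2_norm_seq (u k) * l2_norm_seq (v k)) * (C * l2n F g * l2n F f)"
    by (rule suminf_mult2[OF rep(3), symmetric])
  finally show "cmod (bform F (\<lambda>x y. meet_sum h N x y * a x y) g f)
      \<le> (\<Sum>k. l2_norm_seq (u k) * l2_norm_seq (v k)) * C * l2n F g * l2n F f"
    by (simp add: mult.assoc)
qed

lemma op_le_radial:
  assumes F: "finite F" and a: "op_le F a C" "0 \<le> C"
    and \<phi>: "\<forall>n. \<phi> n = cp + cm * (-1) ^ n + \<psi> n" "\<psi> \<longlonglongrightarrow> 0"
    and rep: "(u, v) \<in> nuclear_reps (\<lambda>i j. \<phi> (i + j) - \<phi> (i + j + 2))"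
  shows "op_le F (\<lambda>x y. \<phi> (graph_dist E x y) * a x y)
    ((cmod cp + cmod cm + (\<Sum>k. l2_norm_seq (u k) * l2_norm_seq (v k))) * C)"
proof -
  let ?h = "\<lambda>i j. \<phi> (i + j) - \<phi> (i + j + 2)" and ?T = "\<Sum>k. l2_norm_seq (u k) * l2_norm_seq (v k)"
  \<comment> \<open>The constant and the alternating part have period two and cancel in
    \<open>h\<close>. The telescoping can therefore be run with \<open>\<psi>\<close>, whose
    remainder term tends to zero.\<close>
  have h: "?h i j = \<psi> (i + j) - \<psi> (i + j + 2)" for i j
    unfolding \<phi>(1)[rule_format] by simp
  have lim: "(\<lambda>N. meet_sum ?h N x y) \<longlonglongrightarrow> \<psi> (graph_dist E x y)" for x y
  proof -
    let ?d = "graph_dist E x y"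
    obtain c where c: "\<And>N. meet_sum ?h N x y = \<psi> ?d - \<psi> (?d + 2 * (N - c))"
      using meet_sum_telescope[of ?h \<psi> x y, OF h] by blast
    have "filterlim (\<lambda>N. ?d + 2 * (N - c)) at_top sequentially"
      unfolding filterlim_at_top eventually_sequentially
    proof
      fix Z show "\<exists>N. \<forall>n\<ge>N. Z \<le> ?d + 2 * (n - c)" by (intro exI[of _ "Z + c"]) auto
    qed
    then have "(\<lambda>N. \<psi> (?d + 2 * (N - c))) \<longlonglongrightarrow> 0" by (rule filterlim_compose[OF \<phi>(2)])
    from tendsto_diff[OF tendsto_const this] show ?thesis unfolding c by simp
  qed
  have \<psi>: "op_le F (\<lambda>x y. \<psi> (graph_dist E x y) * a x y) (?T * C)"
    unfolding op_le_def
  proof (intro allI)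
    fix g f
    have "(\<lambda>N. bform F (\<lambda>x y. meet_sum ?h N x y * a x y) g f) \<longlonglongrightarrow> bform F (\<lambda>x y. \<psi> (graph_dist E x y) * a x y) g f"
      unfolding bform_def by (intro tendsto_intros lim)
    then have "(\<lambda>N. cmod (bform F (\<lambda>x y. meet_sum ?h N x y * a x y) g f)) \<longlonglongrightarrow> cmod (bform F (\<lambda>x y. \<psi> (graph_dist E x y) * a x y) g f)"
      by (rule tendsto_norm)
    then show "cmod (bform F (\<lambda>x y. \<psi> (graph_dist E x y) * a x y) g f) \<le> ?T * C * l2n F g * l2n F f"
      by (rule LIMSEQ_le_const2) (use op_leD[OF op_le_meet_sum[OF F a rep]] in blast)
  qed
  have p: "op_le F (\<lambda>x y. cp * (\<lambda>x. 1) x * (\<lambda>y. 1) y * a x y) (cmod cp * C)"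
    by (rule op_le_unimodular[OF a(1)]) auto
  have m: "op_le F (\<lambda>x y. cm * (\<lambda>x. (-1) ^ level x) x * (\<lambda>y. (-1) ^ level y) y * a x y) (cmod cm * C)"
    by (rule op_le_unimodular[OF a(1)]) (auto simp: norm_power)
  have "(\<lambda>x y. (cp * 1 * 1 * a x y + cm * (-1) ^ level x * (-1) ^ level y * a x y) + \<psi> (graph_dist E x y) * a x y)
      = (\<lambda>x y. \<phi> (graph_dist E x y) * a x y)"
    unfolding \<phi>(1)[rule_format] minus_one_power_dist by (simp add: algebra_simps fun_eq_iff)
  with op_le_add[OF op_le_add[OF p m] \<psi>] show ?thesis by (simp add: distrib_right)
qed

end

subsection \<open>Duality for finite matrices\<close>

text \<open>Complex matrices are regarded as a real vector space. Only an inequality is demanded for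
  scaling, since the reverse one follows by using \<open>1 / t\<close>.\<close>

definition sublinear :: "((nat \<Rightarrow> nat \<Rightarrow> complex) \<Rightarrow> real) \<Rightarrow> bool" where
  "sublinear p \<longleftrightarrow> (\<forall>x y. p (\<lambda>i j. x i j + y i j) \<le> p x + p y) \<and>
     (\<forall>t x. t > 0 \<longrightarrow> p (\<lambda>i j. complex_of_real t * x i j) \<le> t * p x)"

definition neg_mat :: "(nat \<Rightarrow> nat \<Rightarrow> complex) \<Rightarrow> nat \<Rightarrow> nat \<Rightarrow> complex" where
  "neg_mat x = (\<lambda>i j. - x i j)"

lemma sublinear_add: "sublinear p \<Longrightarrow> p (\<lambda>i j. x i j + y i j) \<le> p x + p y"
  by (simp add: sublinear_def)

lemma sublinear_scale:
  assumes "sublinear p" "t > 0"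
  shows "p (\<lambda>i j. complex_of_real t * x i j) = t * p x"
proof (rule antisym)
  show "p (\<lambda>i j. complex_of_real t * x i j) \<le> t * p x" using assms by (simp add: sublinear_def)
  have "p (\<lambda>i j. complex_of_real (1 / t) * (complex_of_real t * x i j)) \<le> 1 / t * p (\<lambda>i j. complex_of_real t * x i j)"
    using assms unfolding sublinear_def by (metis zero_less_divide_1_iff)
  moreover have "(\<lambda>i j. complex_of_real (1 / t) * (complex_of_real t * x i j)) = x"
    using assms by (simp add: fun_eq_iff)
  ultimately show "t * p x \<le> p (\<lambda>i j. complex_of_real t * x i j)" using assms by (simp add: field_simps)
qed

lemma sublinear_zero: assumes "sublinear p" shows "p (\<lambda>i j. 0) = 0"
  using sublinear_scale[OF assms, of 2 "\<lambda>i j. 0"] by simp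

lemma sublinear_neg: "sublinear p \<Longrightarrow> - p (neg_mat x) \<le> p x"
  using sublinear_add[of p x "neg_mat x"] sublinear_zero[of p] by (simp add: neg_mat_def)

text \<open>The functional \<open>x \<mapsto> inf\<^sub>t (p (x + t A) - t p A)\<close> is the largest sublinear
  functional below \<open>p\<close> that is linear along \<open>A\<close>.\<close>

lemma sublinear_linearize:
  assumes p: "sublinear p"
  shows "\<exists>p'. sublinear p' \<and> (\<forall>x. p' x \<le> p x) \<and> p' (neg_mat A) \<le> - p A"
proof -
  define q where "q t x = p (\<lambda>i j. x i j + complex_of_real t * A i j) - t * p A" for t x
  define p' where "p' x = (INF t\<in>{0..}. q t x)" for x
  have pA: "p (\<lambda>i j. complex_of_real t * A i j) = t * p A" if "t \<ge> 0" for t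
    using sublinear_scale[OF p, of t A] sublinear_zero[OF p] that by (cases "t = 0") auto
  have lower: "- p (neg_mat x) \<le> q t x" if "t \<ge> 0" for t x
    using sublinear_add[OF p, of "\<lambda>i j. x i j + complex_of_real t * A i j" "neg_mat x"] pA[OF that]
    by (simp add: q_def neg_mat_def)
  have bdd: "bdd_below ((\<lambda>t. q t x) ` {0..})" for x
    by (rule bdd_belowI2[of _ "- p (neg_mat x)"]) (use lower in auto)
  have le_q: "p' x \<le> q t x" if "t \<ge> 0" for t x
    unfolding p'_def by (rule cINF_lower[OF bdd]) (use that in auto)
  have greatest: "c \<le> p' x" if "\<And>t. t \<ge> 0 \<Longrightarrow> c \<le> q t x" for c x
    unfolding p'_def by (rule cINF_greatest) (use that in auto)
  have "sublinear p'"
    unfolding sublinear_def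
  proof (intro conjI allI impI)
    fix x y
    have *: "p' (\<lambda>i j. x i j + y i j) \<le> q s x + q t y" if "s \<ge> 0" "t \<ge> 0" for s t
    proof -
      have "(\<lambda>i j. x i j + y i j + complex_of_real (s + t) * A i j)
        = (\<lambda>i j. (x i j + complex_of_real s * A i j) + (y i j + complex_of_real t * A i j))"
        by (simp add: fun_eq_iff algebra_simps)
      then have "q (s + t) (\<lambda>i j. x i j + y i j) \<le> q s x + q t y"
        using sublinear_add[OF p, of "\<lambda>i j. x i j + complex_of_real s * A i j" "\<lambda>i j. y i j + complex_of_real t * A i j"]
        unfolding q_def distrib_right[of s t] by simp
      with le_q[of "s + t"] that show ?thesis by (meson add_nonneg_nonneg order_trans)
    qed
    have "p' (\<lambda>i j. x i j + y i j) - q s x \<le> p' y" if "s \<ge> 0" for s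
      by (rule greatest) (use *[OF that] in \<open>simp add: algebra_simps\<close>)
    then have "p' (\<lambda>i j. x i j + y i j) - p' y \<le> p' x"
      by (intro greatest) (simp add: algebra_simps)
    then show "p' (\<lambda>i j. x i j + y i j) \<le> p' x + p' y" by simp
  next
    fix t :: real and x assume t: "t > 0"
    have "p' (\<lambda>i j. complex_of_real t * x i j) / t \<le> p' x"
    proof (rule greatest)
      fix s :: real assume s: "s \<ge> 0"
      have "(\<lambda>i j. complex_of_real t * x i j + complex_of_real (t * s) * A i j)
        = (\<lambda>i j. complex_of_real t * (x i j + complex_of_real s * A i j))"
        by (simp add: fun_eq_iff algebra_simps)
      then have "q (t * s) (\<lambda>i j. complex_of_real t * x i j) = t * q s x"
        unfolding q_def by (simp only: sublinear_scale[OF p t] right_diff_distrib mult.assoc)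
      with le_q[of "t * s" "\<lambda>i j. complex_of_real t * x i j"] s t
      show "p' (\<lambda>i j. complex_of_real t * x i j) / t \<le> q s x" by (simp add: divide_le_eq mult.commute)
    qed
    then show "p' (\<lambda>i j. complex_of_real t * x i j) \<le> t * p' x"
      using t by (simp add: divide_le_eq mult.commute)
  qed
  moreover have "p' x \<le> p x" for x using le_q[of 0 x] by (simp add: q_def)
  moreover have "p' (neg_mat A) \<le> - p A"
    using le_q[of 1 "neg_mat A"] sublinear_zero[OF p] by (simp add: q_def neg_mat_def)
  ultimately show ?thesis by blast
qed

text \<open>Linearity along \<open>B\<close>, encoded as \<open>p (neg_mat B) \<le> - p B\<close>,
  is inherited by every smaller sublinear functional, so the matrices can be treated one at a
  time.\<close>

lemma sublinear_linearize_list: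
  assumes "sublinear p"
  shows "\<exists>p'. sublinear p' \<and> (\<forall>x. p' x \<le> p x) \<and> (\<forall>B\<in>set Bs. p' (neg_mat B) \<le> - p' B)"
proof (induction Bs)
  case Nil then show ?case using assms by auto
next
  case (Cons B Bs)
  then obtain p1 where p1: "sublinear p1" "\<And>x. p1 x \<le> p x" "\<And>B. B \<in> set Bs \<Longrightarrow> p1 (neg_mat B) \<le> - p1 B"
    by auto
  obtain p2 where p2: "sublinear p2" "\<And>x. p2 x \<le> p1 x" "p2 (neg_mat B) \<le> - p1 B"
    using sublinear_linearize[OF p1(1), of B] by auto
  have "p2 x \<le> p x" for x using p1(2) p2(2) order_trans by blast
  moreover have "p2 (neg_mat C) \<le> - p2 C" if "C \<in> set (B # Bs)" for C
    using that p1(3)[of C] p2(2)[of C] p2(2)[of "neg_mat C"] p2(3) by auto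
  ultimately show ?case using p2(1) by blast
qed

lemma sublinear_shift:
  assumes p: "sublinear p" and B: "p (neg_mat B) \<le> - p B"
  shows "p (\<lambda>i j. x i j + complex_of_real t * B i j) = p x + t * p B"
proof -
  have neg: "p (neg_mat B) = - p B" using B sublinear_neg[OF p, of B] by linarith
  have scale: "p (\<lambda>i j. complex_of_real t * B i j) = t * p B" for t
  proof (cases t "0 :: real" rule: linorder_cases)
    case less
    have "p (\<lambda>i j. complex_of_real (- t) * neg_mat B i j) = - t * p (neg_mat B)"
      by (rule sublinear_scale[OF p]) (use less in simp)
    then show ?thesis by (simp add: neg_mat_def neg[unfolded neg_mat_def])
  qed (use sublinear_zero[OF p] sublinear_scale[OF p] in auto)
  show ?thesis
  proof (rule antisym)
    show "p (\<lambda>i j. x i j + complex_of_real t * B i j) \<le> p x + t * p B"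
      using sublinear_add[OF p, of x "\<lambda>i j. complex_of_real t * B i j"] by (simp add: scale)
    have "p x \<le> p (\<lambda>i j. x i j + complex_of_real t * B i j) + p (\<lambda>i j. complex_of_real (- t) * B i j)"
      using sublinear_add[OF p, of "\<lambda>i j. x i j + complex_of_real t * B i j" "\<lambda>i j. complex_of_real (- t) * B i j"]
      by simp
    then show "p x + t * p B \<le> p (\<lambda>i j. x i j + complex_of_real t * B i j)"
      unfolding scale by simp
  qed
qed

lemma sublinear_sum:
  assumes p: "sublinear p" and "finite S" and "\<And>s. s \<in> S \<Longrightarrow> p (neg_mat (B s)) \<le> - p (B s)"
  shows "p (\<lambda>i j. \<Sum>s\<in>S. complex_of_real (t s) * B s i j) = (\<Sum>s\<in>S. t s * p (B s))"
  using assms(2,3)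
proof (induction S)
  case empty then show ?case using sublinear_zero[OF p] by simp
next
  case (insert s S)
  then show ?case
    using sublinear_shift[OF p, of "B s" "\<lambda>i j. \<Sum>s\<in>S. complex_of_real (t s) * B s i j" "t s"]
    by (simp add: add.commute)
qed

text \<open>Linearising along \<open>h\<close> first pins the value \<open>p h\<close>; linearising
  along a real basis of the corner then makes the functional linear there. By \<open>trunc\<close>
  nothing outside the corner matters.\<close>

lemma finite_Hahn_Banach:
  assumes p: "sublinear p"
    and trunc: "\<And>x y. (\<And>i j. i < M \<Longrightarrow> j < M \<Longrightarrow> x i j = y i j) \<Longrightarrow> p x = p y"
  shows "\<exists>T. (\<forall>x. Re (\<Sum>i<M. \<Sum>j<M. T i j * x i j) \<le> p x) \<and> p h \<le> Re (\<Sum>i<M. \<Sum>j<M. T i j * h i j)"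
proof -
  \<comment> \<open>The real basis: the matrix unit at \<open>(a, b)\<close> for
    \<open>True\<close>, and \<open>\<i>\<close> times it for \<open>False\<close>.\<close>
  define B where "B = (\<lambda>(a :: nat, b :: nat, e) i j. if i = a \<and> j = b then (if e then 1 else \<i>) else 0)"
  define S where "S = {..<M} \<times> {..<M} \<times> (UNIV :: bool set)"
  have S: "finite S" by (simp add: S_def)
  then obtain Ss where Ss: "set Ss = S" using finite_list by blast
  define cut where "cut x = (\<lambda>i j. if i < M \<and> j < M then x i j else 0)" for x :: "nat \<Rightarrow> nat \<Rightarrow> complex"
  have p_cut: "p (cut x) = p x" for x by (rule trunc) (simp add: cut_def)
  obtain p1 where p1: "sublinear p1" "\<And>x. p1 x \<le> p x" "p1 (neg_mat (cut h)) \<le> - p h"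
    using sublinear_linearize[OF p, of "cut h"] by (auto simp: p_cut)
  obtain p2 where p2: "sublinear p2" "\<And>x. p2 x \<le> p1 x" "\<And>s. s \<in> S \<Longrightarrow> p2 (neg_mat (B s)) \<le> - p2 (B s)"
    using sublinear_linearize_list[OF p1(1), of "map B Ss"] Ss by auto
  \<comment> \<open>If a functional is \<open>Re (T * z)\<close> in one entry, its values at
    \<open>1\<close> and \<open>\<i>\<close> are \<open>Re T\<close> and
    \<open>- Im T\<close>.\<close>
  define T where "T i j = Complex (p2 (B (i, j, True))) (- p2 (B (i, j, False)))" for i j
  have eq: "p2 (cut x) = Re (\<Sum>i<M. \<Sum>j<M. T i j * x i j)" for x
  proof -
    define t where "t = (\<lambda>(a, b, e). if e then Re (x a b) else Im (x a b))"
    have "cut x i j = (\<Sum>s\<in>S. complex_of_real (t s) * B s i j)" for i j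
    proof -
      have "(\<Sum>s\<in>S. complex_of_real (t s) * B s i j)
          = (\<Sum>a<M. \<Sum>b<M. \<Sum>e\<in>UNIV. complex_of_real (t (a, b, e)) * B (a, b, e) i j)"
        by (simp add: S_def sum.cartesian_product)
      also have "\<dots> = (\<Sum>a<M. \<Sum>b<M. if a = i \<and> b = j then x a b else 0)"
        by (intro sum.cong refl) (auto simp: t_def B_def UNIV_bool complex_eq_iff)
      also have "\<dots> = (\<Sum>a<M. if a = i then (\<Sum>b<M. if b = j then x a b else 0) else 0)"
        by (intro sum.cong refl) auto
      also have "\<dots> = cut x i j"
        by (simp add: cut_def)
      finally show ?thesis ..
    qed
    then have "cut x = (\<lambda>i j. \<Sum>s\<in>S. complex_of_real (t s) * B s i j)" by blast
    then have "p2 (cut x) = (\<Sum>s\<in>S. t s * p2 (B s))"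
      using sublinear_sum[OF p2(1) S p2(3)] by simp
    also have "\<dots> = (\<Sum>a<M. \<Sum>b<M. \<Sum>e\<in>UNIV. t (a, b, e) * p2 (B (a, b, e)))"
      by (simp add: S_def sum.cartesian_product)
    also have "\<dots> = Re (\<Sum>i<M. \<Sum>j<M. T i j * x i j)"
      by (simp add: T_def t_def UNIV_bool algebra_simps)
    finally show ?thesis .
  qed
  have "Re (\<Sum>i<M. \<Sum>j<M. T i j * x i j) \<le> p x" for x
    using p1(2)[of "cut x"] p2(2)[of "cut x"] eq[of x] p_cut[of x] by simp
  moreover have "p h \<le> Re (\<Sum>i<M. \<Sum>j<M. T i j * h i j)"
  proof -
    have "neg_mat (cut h) = cut (neg_mat h)" by (auto simp: cut_def neg_mat_def fun_eq_iff)
    then have "p2 (neg_mat (cut h)) = - Re (\<Sum>i<M. \<Sum>j<M. T i j * h i j)"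
      using eq[of "neg_mat h"] by (simp add: neg_mat_def sum_negf)
    then show ?thesis using p2(2)[of "neg_mat (cut h)"] p1(3) by simp
  qed
  ultimately show ?thesis by blast
qed

section \<open>Trace norm of finite sections\<close>

definition nuclear_cost :: "nat \<Rightarrow> nat \<Rightarrow> (nat \<Rightarrow> nat \<Rightarrow> complex) \<Rightarrow> (nat \<Rightarrow> nat \<Rightarrow> complex) \<Rightarrow> real" where
  "nuclear_cost M n u v = (\<Sum>k<n. l2n {..<M} (u k) * l2n {..<M} (v k))"

definition nuclear_costs :: "nat \<Rightarrow> (nat \<Rightarrow> nat \<Rightarrow> complex) \<Rightarrow> real set" where
  "nuclear_costs M x = {nuclear_cost M n u v | n u v. \<forall>i<M. \<forall>j<M. x i j = (\<Sum>k<n. u k i * v k j)}"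

text \<open>This is the trace norm of the corner of size \<open>M\<close>, as an infimum over finite
  representations of arbitrary length.\<close>

definition nuclear_gauge :: "nat \<Rightarrow> (nat \<Rightarrow> nat \<Rightarrow> complex) \<Rightarrow> real" where
  "nuclear_gauge M x = Inf (nuclear_costs M x)"

lemma nuclear_costs_nonempty: "nuclear_costs M x \<noteq> {}"
proof -
  have "x i j = (\<Sum>k<M. (if k = i then 1 else 0) * x k j)" if "i < M" for i j
    using that by (simp add: if_distrib[of "\<lambda>c. c * _"] cong: if_cong)
  then have "nuclear_cost M M (\<lambda>k i. if k = i then 1 else 0) x \<in> nuclear_costs M x"
    unfolding nuclear_costs_def by blast
  then show ?thesis by blast
qed

lemma nuclear_gauge_le: "(\<And>i j. i < M \<Longrightarrow> j < M \<Longrightarrow> x i j = (\<Sum>k<n. u k i * v k j)) \<Longrightarrow> nuclear_gauge M x \<le> nuclear_cost M n u v"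
  unfolding nuclear_gauge_def
proof (rule cInf_lower)
  show "bdd_below (nuclear_costs M x)"
    by (rule bdd_belowI[of _ 0]) (auto simp: nuclear_costs_def nuclear_cost_def intro!: sum_nonneg)
qed (auto simp: nuclear_costs_def)

lemma nuclear_gauge_less:
  assumes "nuclear_gauge M x < c"
  obtains n u v where "\<And>i j. i < M \<Longrightarrow> j < M \<Longrightarrow> x i j = (\<Sum>k<n. u k i * v k j)" "nuclear_cost M n u v < c"
  using assms cInf_lessD[OF nuclear_costs_nonempty, of M x c] unfolding nuclear_gauge_def nuclear_costs_def
  by blast

lemma sum_lessThan_append:
  fixes f g :: "nat \<Rightarrow> 'b :: comm_monoid_add"
  shows "(\<Sum>k<n + m. if k < n then f k else g (k - n)) = (\<Sum>k<n. f k) + (\<Sum>k<m. g k)"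
  by (induction m) (auto simp: add.assoc)

lemma sublinear_nuclear_gauge: "sublinear (nuclear_gauge M)"
  unfolding sublinear_def
proof (intro conjI allI impI)
  fix x y :: "nat \<Rightarrow> nat \<Rightarrow> complex"
  show "nuclear_gauge M (\<lambda>i j. x i j + y i j) \<le> nuclear_gauge M x + nuclear_gauge M y"
  proof (rule field_le_epsilon)
    fix e :: real assume "e > 0"
    obtain n u v where x: "\<And>i j. i < M \<Longrightarrow> j < M \<Longrightarrow> x i j = (\<Sum>k<n. u k i * v k j)" "nuclear_cost M n u v < nuclear_gauge M x + e / 2"
      by (rule nuclear_gauge_less[of M x "nuclear_gauge M x + e / 2"]) (use \<open>e > 0\<close> in auto)
    obtain m u' v' where y: "\<And>i j. i < M \<Longrightarrow> j < M \<Longrightarrow> y i j = (\<Sum>k<m. u' k i * v' k j)" "nuclear_cost M m u' v' < nuclear_gauge M y + e / 2"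
      by (rule nuclear_gauge_less[of M y "nuclear_gauge M y + e / 2"]) (use \<open>e > 0\<close> in auto)
    let ?u = "\<lambda>k. if k < n then u k else u' (k - n)" and ?v = "\<lambda>k. if k < n then v k else v' (k - n)"
    have "x i j + y i j = (\<Sum>k<n + m. ?u k i * ?v k j)" if "i < M" "j < M" for i j
      using sum_lessThan_append[where f = "\<lambda>k. u k i * v k j" and g = "\<lambda>k. u' k i * v' k j" and n = n and m = m] x(1) y(1) that
      by (simp add: if_distrib[of "\<lambda>f. f _"] if_distrib[of "\<lambda>f. f * _"] cong: if_cong)
    then have "nuclear_gauge M (\<lambda>i j. x i j + y i j) \<le> nuclear_cost M (n + m) ?u ?v"
      by (rule nuclear_gauge_le)
    also have "\<dots> = (\<Sum>k<n + m. if k < n then l2n {..<M} (u k) * l2n {..<M} (v k) else l2n {..<M} (u' (k - n)) * l2n {..<M} (v' (k - n)))"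
      unfolding nuclear_cost_def by (intro sum.cong) auto
    also have "\<dots> = nuclear_cost M n u v + nuclear_cost M m u' v'"
      unfolding nuclear_cost_def by (rule sum_lessThan_append)
    finally show "nuclear_gauge M (\<lambda>i j. x i j + y i j) \<le> nuclear_gauge M x + nuclear_gauge M y + e"
      using x(2) y(2) by linarith
  qed
next
  fix t :: real and x :: "nat \<Rightarrow> nat \<Rightarrow> complex" assume t: "t > 0"
  have "nuclear_gauge M (\<lambda>i j. complex_of_real t * x i j) / t \<le> c" if c: "nuclear_gauge M x < c" for c
  proof -
    obtain n u v where x: "\<And>i j. i < M \<Longrightarrow> j < M \<Longrightarrow> x i j = (\<Sum>k<n. u k i * v k j)" "nuclear_cost M n u v < c"
      by (rule nuclear_gauge_less[OF c]) blast
    have "nuclear_gauge M (\<lambda>i j. complex_of_real t * x i j) \<le> nuclear_cost M n (\<lambda>k i. complex_of_real t * u k i) v"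
      by (rule nuclear_gauge_le) (simp add: x(1) sum_distrib_left mult.assoc)
    also have "\<dots> = t * nuclear_cost M n u v"
      using t by (simp add: nuclear_cost_def l2n_scale sum_distrib_left mult.assoc)
    also have "\<dots> \<le> t * c" using x(2) t by simp
    finally show ?thesis using t by (simp add: divide_le_eq mult.commute)
  qed
  then have "nuclear_gauge M (\<lambda>i j. complex_of_real t * x i j) / t \<le> nuclear_gauge M x"
    by (rule dense_ge)
  then show "nuclear_gauge M (\<lambda>i j. complex_of_real t * x i j) \<le> t * nuclear_gauge M x"
    using t by (simp add: divide_le_eq mult.commute)
qed

text \<open>The Hahn-Banach functional below the gauge is a contraction, as one sees on rank one
  matrices: their gauge is at most the product of the two norms.\<close>

lemma finite_duality:
  "\<exists>T. op_le {..<M} T 1 \<and> nuclear_gauge M h \<le> cmod (\<Sum>i<M. \<Sum>j<M. T i j * h i j)"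
proof -
  obtain T where T: "\<And>x. Re (\<Sum>i<M. \<Sum>j<M. T i j * x i j) \<le> nuclear_gauge M x"
    "nuclear_gauge M h \<le> Re (\<Sum>i<M. \<Sum>j<M. T i j * h i j)"
  proof -
    have cong: "nuclear_gauge M x = nuclear_gauge M y" if "\<And>i j. i < M \<Longrightarrow> j < M \<Longrightarrow> x i j = y i j" for x y
      unfolding nuclear_gauge_def nuclear_costs_def using that by (simp cong: conj_cong)
    show ?thesis using finite_Hahn_Banach[OF sublinear_nuclear_gauge cong, of M h] that by blast
  qed
  have "op_le {..<M} T 1"
    unfolding op_le_def
  proof (intro allI)
    fix g f
    define z where "z = bform {..<M} T g f"
    \<comment> \<open>The phase \<open>w\<close> turns the real part controlled by the gauge into
      the modulus of the form.\<close>
    define w where "w = (if z = 0 then 1 else cnj z / cmod z)"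
    have w: "cmod w = 1" "w * z = cmod z"
      by (auto simp: w_def norm_divide complex_norm_square[symmetric] power2_eq_square mult.commute)
    have "(\<Sum>i<M. \<Sum>j<M. T i j * (w * g i * f j)) = w * z"
      unfolding z_def bform_def by (simp add: sum_distrib_left mult_ac)
    then have "cmod z = Re (\<Sum>i<M. \<Sum>j<M. T i j * (w * g i * f j))" by (simp add: w)
    also have "\<dots> \<le> nuclear_gauge M (\<lambda>i j. w * g i * f j)" by (rule T)
    also have "\<dots> \<le> nuclear_cost M 1 (\<lambda>k i. w * g i) (\<lambda>k. f)"
      by (rule nuclear_gauge_le) simp
    also have "\<dots> = 1 * l2n {..<M} g * l2n {..<M} f"
      by (simp add: nuclear_cost_def l2n_scale w)
    finally show "cmod (bform {..<M} T g f) \<le> 1 * l2n {..<M} g * l2n {..<M} f" by (simp add: z_def)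
  qed
  moreover have "nuclear_gauge M h \<le> cmod (\<Sum>i<M. \<Sum>j<M. T i j * h i j)"
    using T(2) complex_Re_le_cmod order_trans by blast
  ultimately show ?thesis by blast
qed

subsection \<open>Contractions and the dual norm\<close>

definition contraction :: "('i \<Rightarrow> 'i \<Rightarrow> complex) \<Rightarrow> bool" where
  "contraction T \<longleftrightarrow> (\<forall>F. finite F \<longrightarrow> op_le F T 1)"

lemma contractionD: "contraction T \<Longrightarrow> finite F \<Longrightarrow> cmod (bform F T g f) \<le> l2n F g * l2n F f"
  using op_leD[of F T 1 g f] by (simp add: contraction_def)

lemma contraction_restrict:
  assumes "finite I" "op_le I T 1"
  shows "contraction (\<lambda>i j. if i \<in> I \<and> j \<in> I then T i j else 0)"
  unfolding contraction_def op_le_def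
proof (intro allI impI)
  fix F :: "'a set" and g f :: "'a \<Rightarrow> complex" assume F: "finite F"
  let ?c = "\<lambda>g i. if i \<in> F then g i else (0 :: complex)"
  have l2: "l2n I (?c g) \<le> l2n F g" for g
  proof -
    have "(\<Sum>i\<in>I. (cmod (?c g i))\<^sup>2) = (\<Sum>i\<in>I \<inter> F. (cmod (g i))\<^sup>2)"
      using assms(1) by (simp add: sum.inter_restrict if_distrib[of "\<lambda>c. (cmod c)\<^sup>2"] cong: if_cong)
    also have "\<dots> \<le> (\<Sum>i\<in>F. (cmod (g i))\<^sup>2)" using F by (intro sum_mono2) auto
    finally show ?thesis by (simp add: l2n_def L2_set_def)
  qed
  have "bform F (\<lambda>i j. if i \<in> I \<and> j \<in> I then T i j else 0) g f
      = (\<Sum>i\<in>F \<inter> I. \<Sum>j\<in>F \<inter> I. g i * T i j * f j)"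
    unfolding bform_def
    by (rule sum.mono_neutral_cong_right[OF F], auto, rule sum.mono_neutral_cong_right[OF F], auto)
  also have "\<dots> = bform I T (?c g) (?c f)"
    unfolding bform_def
    by (rule sum.mono_neutral_cong_left[OF assms(1)], auto, rule sum.mono_neutral_cong_left[OF assms(1)], auto)
  finally have "cmod (bform F (\<lambda>i j. if i \<in> I \<and> j \<in> I then T i j else 0) g f) \<le> 1 * l2n I (?c g) * l2n I (?c f)"
    using op_leD[OF assms(2)] by simp
  also have "\<dots> \<le> 1 * l2n F g * l2n F f" by (intro mult_mono l2) auto
  finally show "cmod (bform F (\<lambda>i j. if i \<in> I \<and> j \<in> I then T i j else 0) g f) \<le> 1 * l2n F g * l2n F f" .
qed

lemma contraction_transpose:
  assumes "contraction T" shows "contraction (\<lambda>i j. T j i)"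
  unfolding contraction_def op_le_def
proof (intro allI impI)
  fix F :: "'a set" and g f :: "'a \<Rightarrow> complex" assume F: "finite F"
  have "bform F (\<lambda>i j. T j i) g f = bform F T f g"
    unfolding bform_def by (subst sum.swap) (simp add: mult_ac)
  then show "cmod (bform F (\<lambda>i j. T j i) g f) \<le> 1 * l2n F g * l2n F f"
    using contractionD[OF assms F, of f g] by (simp add: mult.commute)
qed

text \<open>The two column sets cut \<open>f\<close> into orthogonal pieces, so Cauchy-Schwarz in
  the plane bounds the norm of the row by that of \<open>(c, s)\<close>.\<close>

lemma contraction_combine:
  assumes T: "contraction T1" "contraction T2" and cs: "(cmod c)\<^sup>2 + (cmod s)\<^sup>2 \<le> 1" and disj: "J1 \<inter> J2 = {}"
  shows "contraction (\<lambda>i j. (if j \<in> J1 then c * T1 i j else 0) + (if j \<in> J2 then s * T2 i j else 0))"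
  unfolding contraction_def op_le_def
proof (intro allI impI)
  fix F :: "'a set" and g f :: "'a \<Rightarrow> complex" assume F: "finite F"
  define f1 f2 where "f1 j = (if j \<in> J1 then f j else 0)" and "f2 j = (if j \<in> J2 then f j else 0)" for j
  have "bform F (\<lambda>i j. (if j \<in> J1 then c * T1 i j else 0) + (if j \<in> J2 then s * T2 i j else 0)) g f
     = c * bform F T1 g f1 + s * bform F T2 g f2"
    unfolding bform_def sum_distrib_left sum.distrib[symmetric]
    by (intro sum.cong refl) (auto simp: f1_def f2_def algebra_simps)
  then have "cmod (bform F (\<lambda>i j. (if j \<in> J1 then c * T1 i j else 0) + (if j \<in> J2 then s * T2 i j else 0)) g f)
      \<le> cmod c * cmod (bform F T1 g f1) + cmod s * cmod (bform F T2 g f2)"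
    by (metis norm_mult norm_triangle_ineq)
  also have "\<dots> \<le> cmod c * (l2n F g * l2n F f1) + cmod s * (l2n F g * l2n F f2)"
    by (intro add_mono mult_left_mono contractionD T F) auto
  also have "\<dots> = l2n F g * (cmod c * l2n F f1 + cmod s * l2n F f2)" by (simp add: algebra_simps)
  also have "\<dots> \<le> l2n F g * l2n F f"
  proof (intro mult_left_mono)
    have "cmod c * l2n F f1 + cmod s * l2n F f2 \<le> sqrt ((cmod c)\<^sup>2 + (cmod s)\<^sup>2) * sqrt ((l2n F f1)\<^sup>2 + (l2n F f2)\<^sup>2)"
      using sum_mult_le_sqrt[of "UNIV :: bool set" "\<lambda>b. if b then cmod c else cmod s" "\<lambda>b. if b then l2n F f1 else l2n F f2"]
      by (simp add: UNIV_bool add.commute)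
    also have "\<dots> \<le> 1 * sqrt ((l2n F f1)\<^sup>2 + (l2n F f2)\<^sup>2)"
      using cs by (intro mult_right_mono) auto
    also have "\<dots> \<le> l2n F f"
    proof -
      have "(l2n F f1)\<^sup>2 + (l2n F f2)\<^sup>2 \<le> (l2n F f)\<^sup>2"
        unfolding l2n_power2 sum.distrib[symmetric] using disj
        by (intro sum_mono) (auto simp: f1_def f2_def)
      then show ?thesis by (simp add: real_le_lsqrt)
    qed
    finally show "cmod c * l2n F f1 + cmod s * l2n F f2 \<le> l2n F f" .
  qed simp
  finally show "cmod (bform F (\<lambda>i j. (if j \<in> J1 then c * T1 i j else 0) + (if j \<in> J2 then s * T2 i j else 0)) g f) \<le> 1 * l2n F g * l2n F f"
    by simp
qed

lemma contraction_entry: assumes "contraction T" shows "cmod (T i j) \<le> 1"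
proof -
  let ?d = "\<lambda>i x. if x = i then 1 else (0 :: complex)"
  have "bform {i, j} T (?d i) (?d j) = T i j"
    unfolding bform_def by (cases "i = j") auto
  moreover have "l2n {i, j} (?d i) = 1" "l2n {i, j} (?d j) = 1"
    by (cases "i = j"; simp add: l2n_def L2_set_def)+
  ultimately show ?thesis using contractionD[OF assms, of "{i, j}" "?d i" "?d j"] by simp
qed

lemma contraction_zero: "contraction (\<lambda>i j. 0)"
  by (simp add: contraction_def op_le_def bform_def)

definition pairing :: "'i set \<Rightarrow> 'i set \<Rightarrow> ('i \<Rightarrow> 'i \<Rightarrow> complex) \<Rightarrow> ('i \<Rightarrow> 'i \<Rightarrow> complex) \<Rightarrow> complex" where
  "pairing R C T h = (\<Sum>i\<in>R. \<Sum>j\<in>C. T i j * h i j)"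

text \<open>The trace norm of the block \<open>R \<times> C\<close> in dual form; \<open>T\<close>
  is a contraction on the whole index type, so different blocks can be tested by one matrix.\<close>

definition dual_norm :: "'i set \<Rightarrow> 'i set \<Rightarrow> ('i \<Rightarrow> 'i \<Rightarrow> complex) \<Rightarrow> real" where
  "dual_norm R C h = Sup {cmod (pairing R C T h) | T. contraction T}"

lemma dual_norm_upper: "contraction T \<Longrightarrow> cmod (pairing R C T h) \<le> dual_norm R C h"
  unfolding dual_norm_def
proof (rule cSup_upper)
  show "bdd_above {cmod (pairing R C T h) | T. contraction T}"
  proof (rule bdd_aboveI, safe)
    fix T :: "'a \<Rightarrow> 'a \<Rightarrow> complex" assume T: "contraction T"
    have "cmod (T i j * h i j) \<le> cmod (h i j)" for i j
      using mult_right_mono[OF contraction_entry[OF T, of i j], of "cmod (h i j)"] by (simp add: norm_mult)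
    then show "cmod (pairing R C T h) \<le> (\<Sum>i\<in>R. \<Sum>j\<in>C. cmod (h i j))"
      unfolding pairing_def by (intro order_trans[OF norm_sum] sum_mono) auto
  qed
qed blast

lemma dual_norm_least:
  "(\<And>T. contraction T \<Longrightarrow> cmod (pairing R C T h) \<le> K) \<Longrightarrow> dual_norm R C h \<le> K"
  unfolding dual_norm_def by (rule cSup_least) (use contraction_zero in blast)+

lemma dual_norm_nonneg: "0 \<le> dual_norm R C h"
  using dual_norm_upper[OF contraction_zero, of R C h] by (simp add: pairing_def)

lemma dual_norm_transpose: "dual_norm R C h = dual_norm C R (\<lambda>i j. h j i)"
proof -
  have eq: "pairing R C T h = pairing C R (\<lambda>i j. T j i) (\<lambda>i j. h j i)" for R C T and h :: "'a \<Rightarrow> 'a \<Rightarrow> complex"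
    unfolding pairing_def by (rule sum.swap)
  have le: "dual_norm R C h \<le> dual_norm C R (\<lambda>i j. h j i)" for R C and h :: "'a \<Rightarrow> 'a \<Rightarrow> complex"
    by (rule dual_norm_least) (metis eq contraction_transpose dual_norm_upper)
  show ?thesis using le[of R C h] le[of C R "\<lambda>i j. h j i"] by simp
qed

lemma phase_exists: "\<exists>w. cmod w = 1 \<and> w * z = complex_of_real (cmod z)"
  by (rule exI[of _ "if z = 0 then 1 else cnj z / cmod z"])
    (auto simp: norm_divide complex_norm_square[symmetric] power2_eq_square mult.commute)

text \<open>Both norms are tested at once by a row of two contractions weighted by \<open>cos\<close> and \<open>sin\<close>.\<close>

lemma dual_norm_pythagoras:
  assumes fin: "finite C1" "finite C2" and disj: "C1 \<inter> C2 = {}"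
  shows "(dual_norm R C1 h)\<^sup>2 + (dual_norm R C2 h)\<^sup>2 \<le> (dual_norm R (C1 \<union> C2) h)\<^sup>2"
proof -
  define D where "D = dual_norm R (C1 \<union> C2) h"
  have D: "0 \<le> D" by (simp add: D_def dual_norm_nonneg)
  have *: "(cmod (pairing R C1 T1 h))\<^sup>2 + (cmod (pairing R C2 T2 h))\<^sup>2 \<le> D\<^sup>2"
    if T: "contraction T1" "contraction T2" for T1 T2
  proof -
    define x y where "x = cmod (pairing R C1 T1 h)" and "y = cmod (pairing R C2 T2 h)"
    define r where "r = sqrt (x\<^sup>2 + y\<^sup>2)"
    have r: "r\<^sup>2 = x\<^sup>2 + y\<^sup>2" by (simp add: r_def)
    show ?thesis
    proof (cases "r = 0")
      case True then show ?thesis using r D by (simp add: x_def y_def)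
    next
      case False
      then have r0: "r > 0" by (simp add: r_def less_le)
      obtain w1 w2 where w: "cmod w1 = 1" "w1 * pairing R C1 T1 h = x" "cmod w2 = 1" "w2 * pairing R C2 T2 h = y"
        unfolding x_def y_def using phase_exists by metis
      \<comment> \<open>Cosine and sine of the angle of \<open>(x, y)\<close>, times phases: then
        the combined pairing equals \<open>r\<close>.\<close>
      define c s where "c = complex_of_real (x / r) * w1" and "s = complex_of_real (y / r) * w2"
      let ?T = "\<lambda>i j. (if j \<in> C1 then c * T1 i j else 0) + (if j \<in> C2 then s * T2 i j else 0)"
      have "(cmod c)\<^sup>2 + (cmod s)\<^sup>2 = (x\<^sup>2 + y\<^sup>2) / r\<^sup>2"
        using w by (simp add: c_def s_def norm_mult norm_divide power_mult_distrib power_divide add_divide_distrib[symmetric])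
      also have "\<dots> = 1" unfolding r[symmetric] using r0 by simp
      finally have cT: "contraction ?T" by (intro contraction_combine T disj) simp
      have "pairing R (C1 \<union> C2) ?T h = c * pairing R C1 T1 h + s * pairing R C2 T2 h"
      proof -
        have "(\<Sum>j\<in>C1 \<union> C2. ?T i j * h i j) = c * (\<Sum>j\<in>C1. T1 i j * h i j) + s * (\<Sum>j\<in>C2. T2 i j * h i j)" for i
        proof -
          have "(\<Sum>j\<in>C1. ?T i j * h i j) = (\<Sum>j\<in>C1. c * (T1 i j * h i j))"
            using disj by (intro sum.cong) auto
          moreover have "(\<Sum>j\<in>C2. ?T i j * h i j) = (\<Sum>j\<in>C2. s * (T2 i j * h i j))"
            using disj by (intro sum.cong) auto
          ultimately show ?thesis by (simp only: sum.union_disjoint[OF fin disj] sum_distrib_left)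
        qed
        then show ?thesis unfolding pairing_def by (simp only: sum.distrib sum_distrib_left)
      qed
      also have "\<dots> = complex_of_real (x / r * x + y / r * y)"
        unfolding c_def s_def mult.assoc w by simp
      also have "x / r * x + y / r * y = r"
        using r r0 by (simp add: field_simps power2_eq_square)
      finally have "r \<le> D" using dual_norm_upper[OF cT, of R "C1 \<union> C2" h] r0 by (simp add: D_def)
      then show ?thesis using r r0 power_mono[of r D 2] by (simp add: x_def y_def)
    qed
  qed
  \<comment> \<open>The two suprema are taken one after the other: over \<open>T1\<close> with
    \<open>T2\<close> fixed, then over \<open>T2\<close>.\<close>
  have 1: "(dual_norm R C1 h)\<^sup>2 \<le> D\<^sup>2 - (cmod (pairing R C2 T2 h))\<^sup>2" if T2: "contraction T2" for T2
  proof -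
    have nn: "0 \<le> D\<^sup>2 - (cmod (pairing R C2 T2 h))\<^sup>2"
      using *[OF contraction_zero T2] by (simp add: pairing_def)
    have "dual_norm R C1 h \<le> sqrt (D\<^sup>2 - (cmod (pairing R C2 T2 h))\<^sup>2)"
      by (rule dual_norm_least, rule real_le_rsqrt) (use *[OF _ T2] in \<open>simp add: algebra_simps\<close>)
    from power_mono[OF this dual_norm_nonneg, of 2] nn show ?thesis by simp
  qed
  have nn: "0 \<le> D\<^sup>2 - (dual_norm R C1 h)\<^sup>2"
    using 1[OF contraction_zero] by (simp add: pairing_def)
  have "dual_norm R C2 h \<le> sqrt (D\<^sup>2 - (dual_norm R C1 h)\<^sup>2)"
    by (rule dual_norm_least, rule real_le_rsqrt) (use 1 in \<open>simp add: algebra_simps\<close>)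
  from power_mono[OF this dual_norm_nonneg, of 2] nn show ?thesis by (simp add: D_def)
qed

text \<open>Outside the smaller corner lies an L-shape, split into a block of columns and a block of
  rows. Pythagoras for columns and, by transposition, for rows bounds each of them by the square
  root, whence the factor 2.\<close>

lemma dual_norm_increment:
  fixes h :: "nat \<Rightarrow> nat \<Rightarrow> complex"
  assumes nm: "n \<le> m" and T: "contraction T"
  defines "a \<equiv> \<lambda>k. dual_norm {..<k} {..<k} h"
  shows "cmod (pairing {..<m} {..<m} T (\<lambda>i j. if i < n \<and> j < n then 0 else h i j)) \<le> 2 * sqrt ((a m)\<^sup>2 - (a n)\<^sup>2)"
    and "a n \<le> a m"
proof -
  have split: "{..<n} \<union> {n..<m} = {..<m}" using nm by auto
  have disj: "{..<n} \<inter> {n..<m} = {}" by auto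
  have p1: "(a n)\<^sup>2 + (dual_norm {..<n} {n..<m} h)\<^sup>2 \<le> (dual_norm {..<n} {..<m} h)\<^sup>2"
    using dual_norm_pythagoras[OF _ _ disj, of "{..<n}" h] by (simp add: split a_def)
  have p2: "(dual_norm {..<n} {..<m} h)\<^sup>2 + (dual_norm {n..<m} {..<m} h)\<^sup>2 \<le> (a m)\<^sup>2"
    using dual_norm_pythagoras[OF _ _ disj, of "{..<m}" "\<lambda>i j. h j i"]
    by (simp add: split a_def dual_norm_transpose[of "{..<m}" _ "\<lambda>i j. h j i"])
  have nn: "0 \<le> (dual_norm {..<n} {n..<m} h)\<^sup>2" "0 \<le> (dual_norm {n..<m} {..<m} h)\<^sup>2" by simp_all
  show "a n \<le> a m"
    by (rule power2_le_imp_le) (use p1 p2 nn in linarith, simp add: a_def dual_norm_nonneg)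
  have b: "dual_norm {..<n} {n..<m} h \<le> sqrt ((a m)\<^sup>2 - (a n)\<^sup>2)" "dual_norm {n..<m} {..<m} h \<le> sqrt ((a m)\<^sup>2 - (a n)\<^sup>2)"
    by (rule real_le_rsqrt, use p1 p2 nn in linarith)+
  have "pairing {..<m} {..<m} T (\<lambda>i j. if i < n \<and> j < n then 0 else h i j)
      = pairing {..<n} {n..<m} T h + pairing {n..<m} {..<m} T h"
  proof -
    have "pairing {..<m} {..<m} T (\<lambda>i j. if i < n \<and> j < n then 0 else h i j)
       = (\<Sum>i<n. \<Sum>j<m. T i j * (if i < n \<and> j < n then 0 else h i j)) + (\<Sum>i\<in>{n..<m}. \<Sum>j<m. T i j * (if i < n \<and> j < n then 0 else h i j))"
      unfolding pairing_def split[symmetric] by (rule sum.union_disjoint) auto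
    moreover have "(\<Sum>j<m. T i j * (if i < n \<and> j < n then 0 else h i j)) = (\<Sum>j\<in>{n..<m}. T i j * h i j)" if "i < n" for i
      by (rule sum.mono_neutral_cong_right) (use that in auto)
    ultimately show ?thesis unfolding pairing_def by simp
  qed
  then have "cmod (pairing {..<m} {..<m} T (\<lambda>i j. if i < n \<and> j < n then 0 else h i j))
     \<le> dual_norm {..<n} {n..<m} h + dual_norm {n..<m} {..<m} h"
    using dual_norm_upper[OF T] by (metis add_mono norm_triangle_ineq order_trans)
  then show "cmod (pairing {..<m} {..<m} T (\<lambda>i j. if i < n \<and> j < n then 0 else h i j)) \<le> 2 * sqrt ((a m)\<^sup>2 - (a n)\<^sup>2)"
    using b by linarith
qed

lemma nuclear_gauge_le_dual:
  assumes "\<And>T. contraction T \<Longrightarrow> cmod (pairing {..<M} {..<M} T h) \<le> K"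
  shows "nuclear_gauge M h \<le> K"
proof -
  obtain T where T: "op_le {..<M} T 1" "nuclear_gauge M h \<le> cmod (\<Sum>i<M. \<Sum>j<M. T i j * h i j)"
    using finite_duality by blast
  have "pairing {..<M} {..<M} (\<lambda>i j. if i \<in> {..<M} \<and> j \<in> {..<M} then T i j else 0) h = (\<Sum>i<M. \<Sum>j<M. T i j * h i j)"
    unfolding pairing_def by (intro sum.cong) auto
  then show ?thesis using assms[OF contraction_restrict[OF _ T(1)]] T(2) by simp
qed

subsection \<open>Assembling nuclear representations\<close>

text \<open>Blocks of varying length \<open>n b\<close> are padded with zero vectors to a family
  over pairs and enumerated by \<open>prod_decode\<close>. Domination by the costs gives absolute
  summability, so the reordering does not change the entries.\<close>

lemma nuclear_reps_merge:
  fixes U V :: "nat \<Rightarrow> nat \<Rightarrow> nat \<Rightarrow> complex"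
  assumes l2: "\<And>b l. l2_summable (U b l)" "\<And>b l. l2_summable (V b l)"
    and d: "\<And>b i j. d b i j = (\<Sum>l<n b. U b l i * V b l j)"
    and c: "\<And>b. (\<Sum>l<n b. l2_norm_seq (U b l) * l2_norm_seq (V b l)) \<le> c b" "summable c"
    and h: "\<And>i j. (\<lambda>b. d b i j) sums h i j"
  shows "\<exists>(u, v) \<in> nuclear_reps h. (\<Sum>k. l2_norm_seq (u k) * l2_norm_seq (v k)) \<le> suminf c"
proof -
  define U' where "U' = (\<lambda>(b, l). if l < n b then U b l else (\<lambda>i. 0))"
  define V' where "V' = (\<lambda>(b, l). if l < n b then V b l else (\<lambda>i. 0))"
  define f where "f = (\<lambda>p :: nat \<times> nat. l2_norm_seq (U' p) * l2_norm_seq (V' p))"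
  define cost where "cost b = (\<Sum>l<n b. l2_norm_seq (U b l) * l2_norm_seq (V b l))" for b
  have l2': "l2_summable (U' p)" "l2_summable (V' p)" for p
    using l2 by (auto simp: U'_def V'_def l2_summable_def split: prod.split)
  have f_nonneg: "0 \<le> f p" for p using l2' by (simp add: f_def)
  have cost_nonneg: "0 \<le> cost b" for b unfolding cost_def by (intro sum_nonneg) (simp add: l2)
  have cost: "summable cost" "suminf cost \<le> suminf c"
  proof -
    show "summable cost"
      by (rule summable_comparison_test'[OF c(2), of 0]) (use c(1) cost_nonneg in \<open>auto simp: cost_def\<close>)
    then show "suminf cost \<le> suminf c"
      by (intro suminf_le c) (use c(1) in \<open>simp add: cost_def\<close>)
  qed
  have f_inner: "((\<lambda>l. f (b, l)) has_sum cost b) UNIV" for b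
    by (rule has_sum_finite_neutralI[of "{..<n b}"])
      (auto simp: f_def U'_def V'_def cost_def l2_norm_seq_def)
  have cost_has_sum: "(cost has_sum suminf cost) UNIV"
    using summable_sums[OF cost(1)] cost_nonneg by (rule sums_nonneg_imp_has_sum)
  have f_summable: "f summable_on UNIV \<times> UNIV"
    by (rule summable_on_SigmaI[OF f_inner]) (use cost_has_sum f_nonneg in \<open>auto simp: summable_on_def\<close>)
  have f_sum: "(f has_sum suminf cost) UNIV"
    using has_sum_SigmaI[OF f_inner cost_has_sum f_summable] by simp
  define u v where "u k = U' (prod_decode k)" and "v k = V' (prod_decode k)" for k
  have "((\<lambda>k. f (prod_decode k)) has_sum suminf cost) UNIV"
    using f_sum has_sum_reindex_bij_betw[OF bij_prod_decode, of f "suminf cost"] by simp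
  then have uv_sums: "(\<lambda>k. l2_norm_seq (u k) * l2_norm_seq (v k)) sums suminf cost"
    unfolding f_def u_def v_def by (rule has_sum_imp_sums)
  have "(\<lambda>k. u k i * v k j) sums h i j" for i j
  proof -
    define g where "g = (\<lambda>p. U' p i * V' p j)"
    have entry: "cmod (w i) \<le> l2_norm_seq w" if "l2_summable w" for w i
      using l2n_le_l2_norm_seq[OF that, of "Suc i"] member_le_L2_set[of "{..<Suc i}" i "\<lambda>i. cmod (w i)"]
      by (simp add: l2n_def)
    have "(\<lambda>p. norm (g p)) summable_on UNIV"
    proof (rule Infinite_Sum.abs_summable_on_comparison_test')
      show "f summable_on UNIV" using f_summable by simp
      fix p show "norm (g p) \<le> f p"
        unfolding g_def f_def norm_mult by (intro mult_mono entry l2') (simp_all add: l2')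
    qed
    then have g_summable: "g summable_on UNIV" by (rule abs_summable_summable)
    then obtain S where S: "(g has_sum S) UNIV" by (auto simp: summable_on_def)
    have "((\<lambda>l. g (b, l)) has_sum d b i j) UNIV" for b
      by (rule has_sum_finite_neutralI[of "{..<n b}"]) (auto simp: g_def U'_def V'_def d)
    then have "((\<lambda>b. d b i j) has_sum S) UNIV"
      using has_sum_SigmaD[where f = g and S = S and A = UNIV and B = "\<lambda>_. UNIV"] S by simp
    then have "S = h i j" using h has_sum_imp_sums sums_unique2 by blast
    moreover have "((\<lambda>k. g (prod_decode k)) has_sum S) UNIV"
      using S has_sum_reindex_bij_betw[OF bij_prod_decode, of g S] by simp
    ultimately show ?thesis unfolding g_def u_def v_def using has_sum_imp_sums by blast
  qed
  then have "(u, v) \<in> nuclear_reps h"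
    unfolding nuclear_reps_def using uv_sums l2' by (auto simp: u_def v_def sums_iff)
  moreover have "(\<Sum>k. l2_norm_seq (u k) * l2_norm_seq (v k)) \<le> suminf c"
    using uv_sums cost(2) by (simp add: sums_iff)
  ultimately show ?thesis by auto
qed

lemma l2_cut:
  fixes u :: "nat \<Rightarrow> complex" and M :: nat
  defines "w \<equiv> \<lambda>i. if i < M then u i else 0"
  shows "l2_summable w" "l2_norm_seq w = l2n {..<M} u"
proof -
  have "(\<lambda>i. (cmod (w i))\<^sup>2) sums (\<Sum>i<M. (cmod (w i))\<^sup>2)"
    by (rule sums_finite) (auto simp: w_def)
  then have s: "(\<lambda>i. (cmod (w i))\<^sup>2) sums (\<Sum>i<M. (cmod (u i))\<^sup>2)" by (simp add: w_def)
  then show "l2_summable w" by (simp add: l2_summable_def sums_iff)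
  show "l2_norm_seq w = l2n {..<M} u"
    using s by (simp add: l2_norm_seq_def sums_iff l2n_def L2_set_def)
qed

text \<open>By \<open>dual_norm_pythagoras\<close> the finite sections form a Cauchy sequence in the trace norm, so
  the representations of the successive differences can be concatenated.\<close>

lemma nuclear_reps_of_dual_bound:
  fixes h :: "nat \<Rightarrow> nat \<Rightarrow> complex"
  assumes K: "\<And>M T. contraction T \<Longrightarrow> cmod (pairing {..<M} {..<M} T h) \<le> K" and "\<epsilon> > 0"
  shows "\<exists>(u, v) \<in> nuclear_reps h. (\<Sum>k. l2_norm_seq (u k) * l2_norm_seq (v k)) \<le> K + \<epsilon>"
proof -
  define a where "a k = dual_norm {..<k} {..<k} h" for k
  have a0: "0 \<le> a k" for k by (simp add: a_def dual_norm_nonneg)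
  have aK: "a k \<le> K" for k unfolding a_def by (rule dual_norm_least) (rule K)
  have mono: "incseq a"
    unfolding a_def by (rule monoI) (rule dual_norm_increment(2)[OF _ contraction_zero])
  obtain L where L: "a \<longlonglongrightarrow> L" "\<And>k. a k \<le> L"
    using incseq_convergent[OF mono, of K] aK by blast
  \<comment> \<open>The costs \<open>3 * \<delta> k\<close> add up to \<open>\<epsilon> / 2\<close>,
    the other half going to block 0. The estimate below gives \<open>2 * \<delta> k\<close>; the
    surplus makes it strict, as choosing a representation requires.\<close>
  define \<delta> where "\<delta> k = \<epsilon> / 6 * (1 / 2) ^ Suc k" for k
  have \<delta>: "\<delta> k > 0" for k using \<open>\<epsilon> > 0\<close> by (simp add: \<delta>_def)
  have "\<exists>N. \<forall>n\<ge>N. L\<^sup>2 - (a n)\<^sup>2 < (\<delta> k)\<^sup>2" for k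
  proof -
    have "(\<lambda>n. L\<^sup>2 - (a n)\<^sup>2) \<longlonglongrightarrow> L\<^sup>2 - L\<^sup>2" by (intro tendsto_intros L)
    then have "eventually (\<lambda>n. L\<^sup>2 - (a n)\<^sup>2 < (\<delta> k)\<^sup>2) sequentially"
      by (rule order_tendstoD) (use \<delta>[of k] in simp)
    then show ?thesis by (simp add: eventually_sequentially)
  qed
  then obtain N where N: "\<And>k n. n \<ge> N k \<Longrightarrow> L\<^sup>2 - (a n)\<^sup>2 < (\<delta> k)\<^sup>2" by metis
  \<comment> \<open>A strictly increasing sequence of corner sizes with
    \<open>N k \<le> r k\<close>.\<close>
  define r where "r k = (\<Sum>i\<le>k. Suc (N i))" for k
  have r_Suc: "r k < r (Suc k)" for k by (simp add: r_def)
  have r_mono: "r k \<le> r l" if "k \<le> l" for k l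
    by (rule lift_Suc_mono_le[of r, OF _ that]) (rule less_imp_le[OF r_Suc])
  have r_ge: "k < r k" for k by (induction k) (use r_Suc le_less_trans in \<open>auto simp: r_def\<close>)
  have r_N: "N k \<le> r k" for k unfolding r_def by (cases k) auto
  \<comment> \<open>The preceding corner size, with \<open>s 0 = 0\<close>, so that block 0 is the
    entire first corner and block \<open>Suc k\<close> an L-shape.\<close>
  define s where "s b = (case b of 0 \<Rightarrow> 0 | Suc k \<Rightarrow> r k)" for b
  have s_le: "s b \<le> r b" for b using r_Suc by (auto simp: s_def less_imp_le split: nat.split)
  define d where "d b i j = (if i < r b \<and> j < r b then if i < s b \<and> j < s b then 0 else h i j else 0)" for b i j
  define c where "c b = (case b of 0 \<Rightarrow> K + \<epsilon> / 2 | Suc k \<Rightarrow> 3 * \<delta> k)" for b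
  have c_sums: "c sums (K + \<epsilon>)"
  proof -
    have "(\<lambda>k. \<epsilon> / 4 * (1 / 2) ^ k) sums (\<epsilon> / 4 * (1 / (1 - 1 / 2)))"
      by (intro sums_mult geometric_sums) simp
    then have "(\<lambda>k. c (Suc k)) sums (\<epsilon> / 2)" by (simp add: c_def \<delta>_def)
    then have "c sums (\<epsilon> / 2 + c 0)" by (rule sums_Suc)
    then show ?thesis by (simp add: c_def add.commute)
  qed
  have gauge: "nuclear_gauge (r b) (d b) < c b" for b
  proof (cases b)
    case 0
    have "pairing {..<r 0} {..<r 0} T (d 0) = pairing {..<r 0} {..<r 0} T h" for T
      unfolding pairing_def by (intro sum.cong) (auto simp: d_def s_def)
    then have "nuclear_gauge (r 0) (d 0) \<le> K" by (intro nuclear_gauge_le_dual) (simp add: K)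
    then show ?thesis using \<open>\<epsilon> > 0\<close> by (simp add: 0 c_def)
  next
    case (Suc k)
    have "nuclear_gauge (r b) (d b) \<le> 2 * sqrt ((a (r b))\<^sup>2 - (a (s b))\<^sup>2)"
    proof (rule nuclear_gauge_le_dual)
      fix T :: "nat \<Rightarrow> nat \<Rightarrow> complex" assume T: "contraction T"
      have "pairing {..<r b} {..<r b} T (d b) = pairing {..<r b} {..<r b} T (\<lambda>i j. if i < s b \<and> j < s b then 0 else h i j)"
        unfolding pairing_def by (intro sum.cong) (auto simp: d_def)
      then show "cmod (pairing {..<r b} {..<r b} T (d b)) \<le> 2 * sqrt ((a (r b))\<^sup>2 - (a (s b))\<^sup>2)"
        using dual_norm_increment(1)[OF s_le T, of b h] by (simp add: a_def)
    qed
    also have "\<dots> \<le> 2 * sqrt (L\<^sup>2 - (a (r k))\<^sup>2)"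
      using L(2)[of "r b"] a0[of "r b"] by (simp add: Suc s_def power_mono)
    also have "\<dots> \<le> 2 * \<delta> k"
      using N[OF r_N, of k] \<delta>[of k] by (simp add: real_le_lsqrt less_imp_le)
    also have "\<dots> < 3 * \<delta> k" using \<delta>[of k] by simp
    finally show ?thesis by (simp add: Suc c_def)
  qed
  have "\<exists>n u v. (\<forall>i<r b. \<forall>j<r b. d b i j = (\<Sum>k<n. u k i * v k j)) \<and> nuclear_cost (r b) n u v < c b" for b
    by (rule nuclear_gauge_less[OF gauge[of b]]) blast
  then obtain n u v where rep: "\<And>b i j. i < r b \<Longrightarrow> j < r b \<Longrightarrow> d b i j = (\<Sum>k<n b. u b k i * v b k j)"
    and cost: "\<And>b. nuclear_cost (r b) (n b) (u b) (v b) < c b" by metis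
  define U V where "U b k i = (if i < r b then u b k i else 0)" and "V b k i = (if i < r b then v b k i else 0)"
    for b k i
  have "\<exists>(u, v) \<in> nuclear_reps h. (\<Sum>k. l2_norm_seq (u k) * l2_norm_seq (v k)) \<le> suminf c"
  proof (rule nuclear_reps_merge)
    show "l2_summable (U b l)" "l2_summable (V b l)" for b l
      unfolding U_def V_def by (rule l2_cut)+
    show "d b i j = (\<Sum>l<n b. U b l i * V b l j)" for b i j
    proof (cases "i < r b \<and> j < r b")
      case True then show ?thesis using rep by (simp add: U_def V_def)
    next
      case False then have "d b i j = 0" "\<And>l. U b l i * V b l j = 0" by (auto simp: d_def U_def V_def)
      then show ?thesis by (simp only: sum.neutral_const)
    qed
    show "(\<Sum>l<n b. l2_norm_seq (U b l) * l2_norm_seq (V b l)) \<le> c b" for b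
      using cost[of b] unfolding U_def V_def l2_cut(2) nuclear_cost_def by simp
    show "summable c" using c_sums by (simp add: sums_iff)
    show "(\<lambda>b. d b i j) sums h i j" for i j
    proof -
      \<comment> \<open>Each entry lies in exactly one block: the first corner that contains
        it.\<close>
      define b0 where "b0 = (LEAST b. i < r b \<and> j < r b)"
      have "i < r (max i j) \<and> j < r (max i j)" using r_ge[of "max i j"] by auto
      then have b0: "i < r b0 \<and> j < r b0" unfolding b0_def by (rule LeastI)
      have least: "\<not> (i < r b \<and> j < r b)" if "b < b0" for b
        using not_less_Least that unfolding b0_def by blast
      have "d b i j = (if b = b0 then h i j else 0)" for b
      proof (cases b b0 rule: linorder_cases)
        case less then show ?thesis using least[of b] by (auto simp: d_def)
      next
        case equal
        have "\<not> (i < s b0 \<and> j < s b0)" using least by (cases b0) (auto simp: s_def)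
        then show ?thesis using b0 equal by (auto simp: d_def)
      next
        case greater
        then obtain k where k: "b = Suc k" "b0 \<le> k" by (cases b) auto
        have "i < s b \<and> j < s b" using b0 r_mono[OF k(2)] by (simp add: s_def k(1))
        then show ?thesis using greater by (auto simp: d_def)
      qed
      then show ?thesis using sums_single[of b0 "\<lambda>_. h i j"] by simp
    qed
  qed
  then show ?thesis using c_sums by (simp add: sums_iff)
qed

lemma trace_norm_le_of_dual_bound:
  fixes h :: "nat \<Rightarrow> nat \<Rightarrow> complex"
  assumes K: "\<And>M T. contraction T \<Longrightarrow> cmod (pairing {..<M} {..<M} T h) \<le> K"
  shows "trace_class h" "trace_norm h \<le> K"
proof -
  show "trace_class h"
    using nuclear_reps_of_dual_bound[of h K 1] K unfolding trace_class_def by auto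
  let ?S = "(\<lambda>(u, v). \<Sum>k. l2_norm_seq (u k) * l2_norm_seq (v k)) ` nuclear_reps h"
  have bdd: "bdd_below ?S"
  proof (rule bdd_belowI[of _ 0], safe)
    fix u v assume "(u, v) \<in> nuclear_reps h"
    then show "0 \<le> (\<Sum>k. l2_norm_seq (u k) * l2_norm_seq (v k))"
      by (intro suminf_nonneg) (auto simp: nuclear_reps_def)
  qed
  show "trace_norm h \<le> K"
  proof (rule field_le_epsilon)
    fix e :: real assume "e > 0"
    then obtain u v where uv: "(u, v) \<in> nuclear_reps h" "(\<Sum>k. l2_norm_seq (u k) * l2_norm_seq (v k)) \<le> K + e"
      using nuclear_reps_of_dual_bound[of h K e] K by blast
    have "trace_norm h \<le> (\<Sum>k. l2_norm_seq (u k) * l2_norm_seq (v k))"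
      unfolding trace_norm_def by (rule cInf_lower[OF _ bdd]) (use uv(1) in force)
    with uv(2) show "trace_norm h \<le> K + e" by simp
  qed
qed

subsection \<open>Schur multipliers are uniformly bounded on the unit ball\<close>

lemma contraction_iff: "contraction a \<longleftrightarrow> bounded_matrix a \<and> matrix_norm a \<le> 1"
  using bounded_matrixI[of 1 a] unfolding contraction_def by (auto intro: op_le_mono[OF bounded_matrixD])

lemma op_le_scale: assumes "op_le F a A" shows "op_le F (\<lambda>x y. c * a x y) (cmod c * A)"
  using op_le_unimodular[OF assms, of "\<lambda>_. 1" "\<lambda>_. 1" c] by simp

lemma op_le_tendsto:
  assumes lim: "\<And>x y. (\<lambda>m. a m x y) \<longlonglongrightarrow> b x y" and le: "\<And>m. m \<ge> N \<Longrightarrow> op_le F (a m) C"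
  shows "op_le F b C"
  unfolding op_le_def
proof (intro allI)
  fix g f
  have "(\<lambda>m. cmod (bform F (a m) g f)) \<longlonglongrightarrow> cmod (bform F b g f)"
    unfolding bform_def by (intro tendsto_intros lim)
  then show "cmod (bform F b g f) \<le> C * l2n F g * l2n F f"
    by (rule LIMSEQ_le_const2) (use op_leD[OF le] in blast)
qed

text \<open>A gliding hump: the partial sums of \<open>\<Sum> \<plusminus>3\<^sup>-\<^sup>n a\<^sub>n\<close>, with signs chosen
  greedily, are sent to large matrices, while the tail is too small to compensate.\<close>

lemma schur_multiplier_uniformly_bounded:
  assumes "schur_multiplier \<psi>"
  shows "\<exists>C\<ge>0. \<forall>a F. contraction a \<longrightarrow> finite F \<longrightarrow> op_le F (\<lambda>x y. \<psi> x y * a x y) C"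
proof (rule ccontr)
  assume contra: "\<not> ?thesis"
  define L where "L = (\<lambda>(F, g, f) a. bform F (\<lambda>x y. \<psi> x y * a x y) g f)"
  \<comment> \<open>The norm of the functional \<open>L q\<close> on contractions, finite because
    \<open>q\<close> lives on a finite set.\<close>
  define \<Lambda> where "\<Lambda> q = Sup {cmod (L q a) | a. contraction a}" for q
  define unit where "unit = (\<lambda>(F :: 'a set, g, f). finite F \<and> l2n F g = 1 \<and> l2n F f = 1)"
  have upper: "cmod (L q a) \<le> \<Lambda> q" if "contraction a" for q a
    unfolding \<Lambda>_def
  proof (rule cSup_upper)
    obtain F g f where q: "q = (F, g, f)" by (cases q)
    show "bdd_above {cmod (L q a) | a. contraction a}"
    proof (rule bdd_aboveI, safe)
      fix a :: "'a \<Rightarrow> 'a \<Rightarrow> complex" assume a: "contraction a"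
      have "cmod (g x * (\<psi> x y * a x y) * f y) \<le> cmod (g x) * cmod (\<psi> x y) * cmod (f y)" for x y
        using mult_left_mono[OF contraction_entry[OF a, of x y], of "cmod (g x) * cmod (\<psi> x y) * cmod (f y)"]
        by (simp add: norm_mult mult_ac)
      then show "cmod (L q a) \<le> (\<Sum>x\<in>F. \<Sum>y\<in>F. cmod (g x) * cmod (\<psi> x y) * cmod (f y))"
        unfolding L_def q prod.case bform_def by (intro order_trans[OF norm_sum] sum_mono) auto
    qed
  qed (use that in blast)
  have L_scale: "L q (\<lambda>x y. c * a x y) = c * L q a" for q a c
    unfolding L_def by (auto simp: bform_def sum_distrib_left mult_ac split: prod.split)
  have scaled: "cmod (L q b) \<le> c * \<Lambda> q" if "c > 0" "\<And>F. finite F \<Longrightarrow> op_le F b c" for q b c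
  proof -
    have "contraction (\<lambda>x y. complex_of_real (1 / c) * b x y)"
      unfolding contraction_def using op_le_scale[OF that(2), of _ "complex_of_real (1 / c)"] that(1)
      by (simp add: norm_divide)
    from upper[OF this, of q] have "cmod (L q (\<lambda>x y. complex_of_real (1 / c) * b x y)) \<le> \<Lambda> q" .
    moreover have "L q (\<lambda>x y. complex_of_real (1 / c) * b x y) = complex_of_real (1 / c) * L q b"
      by (rule L_scale)
    ultimately show ?thesis using that(1) by (simp add: norm_divide divide_le_eq mult.commute)
  qed
  have L_add: "L q (\<lambda>x y. a x y + b x y) = L q a + L q b" for q a b
    unfolding L_def by (auto simp: bform_def algebra_simps sum.distrib split: prod.split)
  have "\<exists>q a. unit q \<and> contraction a \<and> \<Lambda> q > 4 ^ n \<and> cmod (L q a) > 2 / 3 * \<Lambda> q" for n :: nat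
  proof -
    have "0 \<le> (4 :: real) ^ n" by simp
    with contra have "\<not> (\<forall>a F. contraction a \<longrightarrow> finite F \<longrightarrow> op_le F (\<lambda>x y. \<psi> x y * a x y) (4 ^ n))" by blast
    then obtain a F where aF: "contraction a" "finite F" "\<not> op_le F (\<lambda>x y. \<psi> x y * a x y) (4 ^ n)" by blast
    obtain g f where gf: "l2n F g = 1" "l2n F f = 1" "cmod (bform F (\<lambda>x y. \<psi> x y * a x y) g f) > 4 ^ n"
      using op_leI[OF aF(2), of "\<lambda>x y. \<psi> x y * a x y" "4 ^ n"] aF(3) by (auto simp: not_le[symmetric])
    let ?q = "(F, g, f)"
    have \<Lambda>: "\<Lambda> ?q > 4 ^ n" using upper[OF aF(1), of ?q] gf(3) by (simp add: L_def)
    then have "2 / 3 * \<Lambda> ?q < \<Lambda> ?q" using less_trans[OF zero_less_power[of "4 :: real" n]] by simp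
    then have "2 / 3 * \<Lambda> ?q < Sup {cmod (L ?q a) | a. contraction a}" by (simp only: \<Lambda>_def[of ?q])
    then obtain r where "r \<in> {cmod (L ?q a) | a. contraction a}" "2 / 3 * \<Lambda> ?q < r"
      using less_cSupD[of "{cmod (L ?q a) | a. contraction a}" "2 / 3 * \<Lambda> ?q"] aF(1) by blast
    then show ?thesis using \<Lambda> gf aF(2) unfolding unit_def by blast
  qed
  then obtain q a where qa: "\<forall>n. unit (q n) \<and> contraction (a n) \<and> \<Lambda> (q n) > 4 ^ n \<and> cmod (L (q n) (a n)) > 2 / 3 * \<Lambda> (q n)"
    by metis
  then have q: "\<And>n. unit (q n)" and a: "\<And>n. contraction (a n)"
    and big: "\<And>n. \<Lambda> (q n) > 4 ^ n" and hump: "\<And>n. cmod (L (q n) (a n)) > 2 / 3 * \<Lambda> (q n)" by blast+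
  define step where "step n e S = (\<lambda>x y. S x y + e * (1 / 3) ^ n * a n x y)" for n and e :: complex and S
  define S where "S = rec_nat (\<lambda>x y. 0) (\<lambda>n S. if cmod (L (q n) (step n 1 S)) \<ge> (1 / 3) ^ n * cmod (L (q n) (a n))
       then step n 1 S else step n (-1) S)"
  have S0: "S 0 = (\<lambda>x y. 0)" by (simp add: S_def)
  have S_Suc: "S (Suc n) = (if cmod (L (q n) (step n 1 (S n))) \<ge> (1 / 3) ^ n * cmod (L (q n) (a n))
       then step n 1 (S n) else step n (-1) (S n))" for n by (simp add: S_def)
  have S_step: "\<exists>e. cmod e = 1 \<and> S (Suc n) = step n e (S n)" for n
    unfolding S_Suc by (auto intro: exI[of _ 1] exI[of _ "-1"])
  have S_large: "cmod (L (q n) (S (Suc n))) \<ge> (1 / 3) ^ n * cmod (L (q n) (a n))" for n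
  proof -
    let ?l = "L (q n)" and ?t = "(1 / 3) ^ n * L (q n) (a n)"
    have L_step: "?l (step n e (S n)) = ?l (S n) + e * ?t" for e
      unfolding step_def L_add L_scale by simp
    \<comment> \<open>The two candidates for the next partial sum differ by twice the hump, so at
      least one of them has a value no smaller than the hump.\<close>
    have "2 * cmod ?t = cmod ((?l (S n) + ?t) - (?l (S n) - ?t))"
      by (simp add: norm_mult flip: mult_2)
    also have "\<dots> \<le> cmod (?l (S n) + ?t) + cmod (?l (S n) - ?t)" by (rule norm_triangle_ineq4)
    finally have "2 * cmod ?t \<le> cmod (?l (S n) + ?t) + cmod (?l (S n) - ?t)" .
    moreover have "cmod ?t = (1 / 3) ^ n * cmod (L (q n) (a n))" by (simp add: norm_mult norm_power norm_divide)
    ultimately show ?thesis using L_step[of 1] L_step[of "-1"] unfolding S_Suc by auto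
  qed
  have D: "op_le F (\<lambda>x y. S (Suc n) x y - S n x y) ((1 / 3) ^ n)" if "finite F" for F n
  proof -
    obtain e where e: "cmod e = 1" "S (Suc n) = step n e (S n)" using S_step by blast
    have "op_le F (a n) 1" using a that by (simp add: contraction_def)
    from op_le_scale[OF this, of "e * (1 / 3) ^ n"] show ?thesis
      by (simp add: e step_def norm_mult norm_power norm_divide)
  qed
  have diff: "op_le F (\<lambda>x y. S m x y - S n x y) (3 / 2 * (1 / 3) ^ n)" if "finite F" "n \<le> m" for F n m
  proof -
    have "op_le F (\<lambda>x y. S m x y - S n x y) (3 / 2 * ((1 / 3) ^ n - (1 / 3) ^ m))"
      using that(2)
    proof (induction m rule: dec_induct)
      case base then show ?case by (simp add: op_le_def bform_def)
    next
      case (step m)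
      have "3 / 2 * (a - b) + b = 3 / 2 * (a - 1 / 3 * b)" for a b :: real by (simp add: field_simps)
      then have eq: "3 / 2 * ((1 / 3) ^ n - (1 / 3) ^ m) + (1 / 3) ^ m = 3 / 2 * ((1 / 3 :: real) ^ n - (1 / 3) ^ Suc m)"
        unfolding power_Suc .
      from op_le_add[OF step.IH D[OF that(1), of m], unfolded eq] show ?case by simp
    qed
    then show ?thesis by (rule op_le_mono) simp
  qed
  have "\<exists>A. (\<lambda>n. S n x y) \<longlonglongrightarrow> A" for x y
  proof -
    have "cmod (S (Suc n) x y - S n x y) \<le> (1 / 3) ^ n" for n
    proof -
      obtain e where e: "cmod e = 1" "S (Suc n) = step n e (S n)" using S_step by blast
      show ?thesis using contraction_entry[OF a, of n x y] mult_left_mono[of "cmod (a n x y)" 1 "(1 / 3) ^ n"]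
        by (simp add: e step_def norm_mult norm_power norm_divide)
    qed
    then have "summable (\<lambda>n. S (Suc n) x y - S n x y)"
      by (intro summable_comparison_test'[OF summable_geometric[of "1 / 3 :: real"], of 0]) auto
    then have "convergent (\<lambda>n. S n x y)"
      by (simp add: summable_iff_convergent sum_lessThan_telescope[of "\<lambda>n. S n x y"] S0)
    then show ?thesis by (simp add: convergent_def)
  qed
  then obtain A where A: "\<And>x y. (\<lambda>n. S n x y) \<longlonglongrightarrow> A x y" by metis
  have tail: "op_le F (\<lambda>x y. A x y - S n x y) (3 / 2 * (1 / 3) ^ n)" if "finite F" for F n
    by (rule op_le_tendsto[of "\<lambda>m x y. S m x y - S n x y" _ n]) (intro tendsto_intros A, rule diff[OF that])
  have "bounded_matrix A"
    using bounded_matrixI[of "3 / 2" A] tail[of _ 0] by (simp add: S0)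
  then have "bounded_matrix (\<lambda>x y. \<psi> x y * A x y)" using assms by (simp add: schur_multiplier_def)
  then obtain Q where Q: "\<And>F. finite F \<Longrightarrow> op_le F (\<lambda>x y. \<psi> x y * A x y) Q"
    using bounded_matrixD by blast
  \<comment> \<open>In units of \<open>(1 / 3) ^ n * \<Lambda> (q n)\<close> the hump is at least
    \<open>2 / 3\<close> and the tail at most \<open>1 / 2\<close>, leaving \<open>1 / 6\<close>.
    Since \<open>\<Lambda> (q n)\<close> exceeds \<open>4 ^ n\<close>, this grows like
    \<open>(4 / 3) ^ n\<close>.\<close>
  have bound: "(4 / 3) ^ n / 6 \<le> Q" for n :: nat
  proof -
    have pos: "\<Lambda> (q n) > 0" using big[of n] less_trans[OF zero_less_power[of "4 :: real" n]] by simp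
    have "cmod (L (q n) (\<lambda>x y. A x y - S (Suc n) x y)) \<le> 3 / 2 * (1 / 3) ^ Suc n * \<Lambda> (q n)"
      by (rule scaled[OF _ tail]) auto
    moreover have "L (q n) A = L (q n) (S (Suc n)) + L (q n) (\<lambda>x y. A x y - S (Suc n) x y)"
      unfolding L_add[symmetric] by simp
    then have "cmod (L (q n) (S (Suc n))) \<le> cmod (L (q n) A) + cmod (L (q n) (\<lambda>x y. A x y - S (Suc n) x y))"
      by (metis add_diff_cancel_right' norm_triangle_ineq4)
    moreover have "(1 / 3) ^ n * (2 / 3 * \<Lambda> (q n)) \<le> cmod (L (q n) (S (Suc n)))"
      by (rule order_trans[OF _ S_large]) (use hump[of n] in \<open>simp add: mult_left_mono\<close>)
    moreover have "cmod (L (q n) A) \<le> Q"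
    proof -
      obtain F g f where n: "q n = (F, g, f)" by (cases "q n")
      then have "finite F" "l2n F g = 1" "l2n F f = 1" using q[of n] by (auto simp: unit_def)
      with op_leD[OF Q, of F g f] show ?thesis by (simp add: n L_def)
    qed
    moreover have "3 / 2 * (1 / 3) ^ Suc n * \<Lambda> (q n) = 1 / 2 * ((1 / 3) ^ n * \<Lambda> (q n))"
      "(1 / 3) ^ n * (2 / 3 * \<Lambda> (q n)) = 2 / 3 * ((1 / 3) ^ n * \<Lambda> (q n))" by simp_all
    ultimately have "(1 / 3) ^ n * \<Lambda> (q n) / 6 \<le> Q" by linarith
    moreover have "(1 / 3) ^ n * 4 ^ n / 6 \<le> (1 / 3) ^ n * \<Lambda> (q n) / 6"
      using big[of n] by (intro divide_right_mono mult_left_mono) auto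
    moreover have "(1 / 3 :: real) ^ n * 4 ^ n = (4 / 3) ^ n" by (simp flip: power_mult_distrib)
    ultimately show ?thesis by simp
  qed
  obtain n :: nat where "6 * Q < (4 / 3) ^ n" using real_arch_pow[of "4 / 3" "6 * Q"] by auto
  with bound[of n] show False by simp
qed

subsection \<open>Test matrices on words\<close>

definition words :: "nat \<Rightarrow> nat \<Rightarrow> nat list set" where
  "words q n = {w. set w \<subseteq> {..<q} \<and> length w = n}"

lemma finite_words [simp]: "finite (words q n)"
  unfolding words_def by (rule finite_lists_length_eq) simp

lemma card_words: "card (words q n) = q ^ n"
  unfolding words_def using card_lists_length_eq[of "{..<q}" n] by simp

lemma length_words: "w \<in> words q n \<Longrightarrow> length w = n"
  by (simp add: words_def)

lemma drop_words: "w \<in> words q n \<Longrightarrow> p \<le> n \<Longrightarrow> drop (n - p) w \<in> words q p"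
  using set_drop_subset[of "n - p" w] by (auto simp: words_def)

lemma sum_words_Suc: "(\<Sum>s\<in>words q (Suc p). F s) = (\<Sum>t\<in>words q p. \<Sum>c<q. F (c # t))"
proof -
  have "(\<Sum>s\<in>words q (Suc p). F s) = (\<Sum>(t, c)\<in>words q p \<times> {..<q}. F (c # t))"
    by (rule sum.reindex_bij_witness[of _ "\<lambda>(t, c). c # t" "\<lambda>s. (tl s, hd s)"])
      (auto simp: words_def length_Suc_conv)
  then show ?thesis by (simp add: sum.cartesian_product)
qed

lemma card_words_suffix:
  assumes "s \<in> words q p" "p \<le> n"
  shows "card {y \<in> words q n. drop (n - p) y = s} = q ^ (n - p)"
proof -
  have "bij_betw (\<lambda>w. w @ s) (words q (n - p)) {y \<in> words q n. drop (n - p) y = s}"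
  proof (rule bij_betw_byWitness[of _ "take (n - p)"])
    show "\<forall>y\<in>{y \<in> words q n. drop (n - p) y = s}. take (n - p) y @ s = y"
      using append_take_drop_id[of "n - p"] by blast
  qed (use assms in \<open>auto simp: words_def dest: in_set_takeD\<close>)
  from bij_betw_same_card[OF this] show ?thesis by (simp add: card_words)
qed

definition agree :: "nat \<Rightarrow> 'c list \<Rightarrow> 'c list \<Rightarrow> bool" where
  "agree p x y \<longleftrightarrow> p \<le> length x \<and> p \<le> length y \<and> drop (length x - p) x = drop (length y - p) y"

text \<open>The word \<open>x\<close> is free, and it fixes the last \<open>p\<close> letters of
  \<open>y\<close>.\<close>

lemma card_agree:
  assumes "p \<le> k" "p \<le> l"
  shows "(\<Sum>x\<in>words q k. \<Sum>y\<in>words q l. if agree p x y then 1 else 0 :: real) = real q ^ (k + l - p)"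
proof -
  have "(\<Sum>y\<in>words q l. if agree p x y then 1 else 0 :: real) = real q ^ (l - p)" if x: "x \<in> words q k" for x
  proof -
    have "(\<Sum>y\<in>words q l. if agree p x y then 1 else 0 :: real) = real (card {y \<in> words q l. agree p x y})"
      by (simp add: sum.If_cases Int_def)
    also have "{y \<in> words q l. agree p x y} = {y \<in> words q l. drop (l - p) y = drop (k - p) x}"
      using assms x by (auto simp: agree_def length_words)
    finally show ?thesis using card_words_suffix[OF drop_words[OF x assms(1)] assms(2)] by simp
  qed
  then have "(\<Sum>x\<in>words q k. \<Sum>y\<in>words q l. if agree p x y then 1 else 0 :: real) = real q ^ k * real q ^ (l - p)"
    by (simp add: card_words)
  then show ?thesis using assms by (simp flip: power_add)
qed

locale word_kernel =
  fixes q :: nat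
  assumes q: "q > 0"
begin

definition \<rho> :: real where "\<rho> = 1 / sqrt (real q)"

lemma \<rho>2: "real q * \<rho>\<^sup>2 = 1" and \<rho>_pos: "\<rho> > 0"
  using q by (simp_all add: \<rho>_def power_divide)

text \<open>For fixed \<open>k = length x\<close> the function \<open>suffix_vec s\<close> is the normalized indicator of the words of length \<open>k\<close>
  ending in \<open>s\<close>; \<open>wavelet s\<close> is its component orthogonal to the vector of the suffix of \<open>s\<close> shorter by one.\<close>

definition suffix_vec :: "nat list \<Rightarrow> nat list \<Rightarrow> real" where
  "suffix_vec s x = (if length s \<le> length x \<and> drop (length x - length s) x = s then \<rho> ^ (length x - length s) else 0)"

definition wavelet :: "nat list \<Rightarrow> nat list \<Rightarrow> real" where
  "wavelet s x = (if length s \<le> length x then suffix_vec s x - (if s = [] then 0 else \<rho> * suffix_vec (tl s) x) else 0)"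

text \<open>On one level this is the projection onto the functions of the last \<open>p\<close>
  letters; between two levels it is the partial isometry matching their ranges.\<close>

definition suffix_kernel :: "nat \<Rightarrow> nat list \<Rightarrow> nat list \<Rightarrow> real" where
  "suffix_kernel p x y = (if agree p x y then \<rho> ^ (length x - p) * \<rho> ^ (length y - p) else 0)"

text \<open>Just one letter \<open>c\<close> precedes the suffix in \<open>x\<close>, so the sum has
  at most one nonzero term, and the factor \<open>\<rho>\<close> adjusts its normalization.\<close>

lemma suffix_vec_average:
  assumes x: "x \<in> words q k" and t: "length t < k"
  shows "\<rho> * (\<Sum>c<q. suffix_vec (c # t) x) = suffix_vec t x"
proof -
  define c0 where "c0 = x ! (k - Suc (length t))"
  have len: "length x = k" using x by (rule length_words)
  have "c0 \<in> set x" unfolding c0_def using t len by (intro nth_mem) simp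
  then have "c0 < q" using x by (auto simp: words_def)
  have "drop (k - Suc (length t)) x = c0 # drop (k - length t) x"
    using Cons_nth_drop_Suc[of "k - Suc (length t)" x] Suc_diff_Suc[OF t] t len by (simp add: c0_def)
  then have "suffix_vec (c # t) x = (if c = c0 then if drop (k - length t) x = t then \<rho> ^ (k - Suc (length t)) else 0 else 0)" for c
    unfolding suffix_vec_def using t len by auto
  then have "(\<Sum>c<q. suffix_vec (c # t) x) = (if drop (k - length t) x = t then \<rho> ^ (k - Suc (length t)) else 0)"
    using \<open>c0 < q\<close> by simp
  moreover have "\<rho> * \<rho> ^ (k - Suc (length t)) = \<rho> ^ (k - length t)"
    using t by (metis Suc_diff_Suc power_Suc)
  ultimately show ?thesis using t by (simp add: suffix_vec_def len)
qed

lemma sum_suffix_vec: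
  assumes "x \<in> words q k" "y \<in> words q l" "p \<le> k" "p \<le> l"
  shows "(\<Sum>s\<in>words q p. suffix_vec s x * suffix_vec s y) = suffix_kernel p x y"
proof -
  have len: "length x = k" "length y = l" using assms by (auto simp: length_words)
  have "(\<Sum>s\<in>words q p. suffix_vec s x * suffix_vec s y)
      = (\<Sum>s\<in>words q p. if s = drop (k - p) x then suffix_kernel p x y else 0)"
    by (intro sum.cong refl) (use assms(3,4) len in \<open>auto simp: suffix_vec_def suffix_kernel_def agree_def length_words\<close>)
  then show ?thesis using drop_words[OF assms(1,3)] by simp
qed

text \<open>Words of length \<open>p\<close> are grouped by their tails \<open>t\<close>. By
  \<open>suffix_vec_average\<close> and \<open>q \<rho>\<^sup>2 = 1\<close> the cross terms leave
  minus one copy of the kernel of \<open>t\<close>, that is, the projection one depth lower.\<close>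

lemma sum_wavelet:
  assumes x: "x \<in> words q k" and y: "y \<in> words q l" and p: "p \<le> k" "p \<le> l"
  shows "(\<Sum>s\<in>words q p. wavelet s x * wavelet s y)
    = suffix_kernel p x y - (if p = 0 then 0 else suffix_kernel (p - 1) x y)"
proof (cases p)
  case 0
  have "(\<Sum>s\<in>words q 0. wavelet s x * wavelet s y) = (\<Sum>s\<in>words q 0. suffix_vec s x * suffix_vec s y)"
    by (intro sum.cong) (auto simp: wavelet_def words_def)
  then show ?thesis using sum_suffix_vec[OF x y, of 0] 0 by simp
next
  case (Suc m)
  have len: "length x = k" "length y = l" using x y by (auto simp: length_words)
  have inner: "(\<Sum>c<q. wavelet (c # t) x * wavelet (c # t) y)
      = (\<Sum>c<q. suffix_vec (c # t) x * suffix_vec (c # t) y) - suffix_vec t x * suffix_vec t y"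
    if t: "t \<in> words q m" for t
  proof -
    let ?x = "\<lambda>c. suffix_vec (c # t) x" and ?y = "\<lambda>c. suffix_vec (c # t) y"
    let ?X = "suffix_vec t x" and ?Y = "suffix_vec t y"
    have lt: "length t = m" using t by (rule length_words)
    have X: "\<rho> * (\<Sum>c<q. ?x c) = ?X" and Y: "\<rho> * (\<Sum>c<q. ?y c) = ?Y"
      using suffix_vec_average[OF x, of t] suffix_vec_average[OF y, of t] p Suc lt by auto
    have "(\<Sum>c<q. wavelet (c # t) x * wavelet (c # t) y) = (\<Sum>c<q. (?x c - \<rho> * ?X) * (?y c - \<rho> * ?Y))"
      using p Suc lt len by (intro sum.cong refl) (auto simp: wavelet_def)
    also have "\<dots> = (\<Sum>c<q. ?x c * ?y c - (\<rho> * ?x c) * ?Y - (\<rho> * ?y c) * ?X + \<rho>\<^sup>2 * (?X * ?Y))"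
      by (intro sum.cong refl) (simp add: algebra_simps power2_eq_square)
    also have "\<dots> = (\<Sum>c<q. ?x c * ?y c) - (\<rho> * (\<Sum>c<q. ?x c)) * ?Y - (\<rho> * (\<Sum>c<q. ?y c)) * ?X + (real q * \<rho>\<^sup>2) * (?X * ?Y)"
      by (simp add: sum.distrib sum_subtractf sum_distrib_left sum_distrib_right)
    also have "\<dots> = (\<Sum>c<q. ?x c * ?y c) - ?X * ?Y" unfolding X Y \<rho>2 by simp
    finally show ?thesis .
  qed
  have "(\<Sum>s\<in>words q p. wavelet s x * wavelet s y) = (\<Sum>t\<in>words q m. \<Sum>c<q. wavelet (c # t) x * wavelet (c # t) y)"
    unfolding Suc by (rule sum_words_Suc)
  also have "\<dots> = (\<Sum>t\<in>words q m. \<Sum>c<q. suffix_vec (c # t) x * suffix_vec (c # t) y) - (\<Sum>t\<in>words q m. suffix_vec t x * suffix_vec t y)"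
    by (simp add: inner sum_subtractf)
  also have "\<dots> = suffix_kernel p x y - suffix_kernel m x y"
    using p Suc sum_words_Suc[of "\<lambda>s. suffix_vec s x * suffix_vec s y" q m] by (simp add: sum_suffix_vec[OF x y])
  finally show ?thesis by (simp add: Suc)
qed

lemma wavelet_longer: "length x < length s \<Longrightarrow> wavelet s x = 0"
  by (simp add: wavelet_def)

text \<open>A Parseval frame rather than a basis: for a fixed tail shorter than the words of the
  level, the wavelets of the \<open>q\<close> prolongations sum to zero. The differences of
  projections telescope to full depth \<open>k\<close>, where agreement is equality.\<close>

lemma sum_all_wavelets:
  assumes x: "x \<in> words q k" and y: "y \<in> words q k" and "k < N"
  shows "(\<Sum>p<N. \<Sum>s\<in>words q p. wavelet s x * wavelet s y) = (if x = y then 1 else 0)"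
proof -
  have "(\<Sum>p<N. \<Sum>s\<in>words q p. wavelet s x * wavelet s y) = (\<Sum>p\<le>k. \<Sum>s\<in>words q p. wavelet s x * wavelet s y)"
    by (rule sum.mono_neutral_right)
      (use assms in \<open>auto simp: length_words wavelet_longer intro!: sum.neutral\<close>)
  also have "\<dots> = (\<Sum>p\<le>k. suffix_kernel p x y - (if p = 0 then 0 else suffix_kernel (p - 1) x y))"
    by (intro sum.cong refl sum_wavelet[OF x y]) auto
  also have "\<dots> = suffix_kernel k x y"
    by (induction k) auto
  also have "\<dots> = (if x = y then 1 else 0)"
    using x y by (auto simp: suffix_kernel_def agree_def length_words)
  finally show ?thesis .
qed

end

lemma agree_max: "\<exists>p\<le>length x. p \<le> length y \<and> agree p x y \<and> \<not> agree (Suc p) x y"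
proof -
  define p where "p = (LEAST p. \<not> agree (Suc p) x y)"
  have "\<not> agree (Suc (length x)) x y" by (simp add: agree_def)
  then have "\<not> agree (Suc p) x y" unfolding p_def by (rule LeastI)
  moreover have "agree p x y"
    using not_less_Least[of "p - 1" "\<lambda>p. \<not> agree (Suc p) x y"] unfolding p_def[symmetric]
    by (cases p) (auto simp: agree_def)
  ultimately show ?thesis by (auto simp: agree_def)
qed

context word_kernel
begin

definition all_words :: "nat \<Rightarrow> nat list set" where
  "all_words N = (\<Union>k<N. words q k)"

definition index :: "nat \<Rightarrow> (nat \<times> nat list) set" where
  "index N = (SIGMA p:{..<N}. words q p)"

definition wavelet_coeff :: "(nat list \<Rightarrow> complex) \<Rightarrow> nat \<Rightarrow> nat list \<Rightarrow> complex" where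
  "wavelet_coeff g k s = (\<Sum>x\<in>words q k. g x * complex_of_real (wavelet s x))"

text \<open>Acts by \<open>Z p\<close>, between the levels \<open>k\<close> and \<open>l\<close>, on the span of the wavelets of the words of length \<open>p\<close>.\<close>

definition test_matrix :: "nat \<Rightarrow> (nat \<Rightarrow> nat \<Rightarrow> nat \<Rightarrow> complex) \<Rightarrow> nat list \<Rightarrow> nat list \<Rightarrow> complex" where
  "test_matrix N Z x y = (\<Sum>i\<in>index N. Z (fst i) (length x) (length y) * complex_of_real (wavelet (snd i) x * wavelet (snd i) y))"

lemma finite_index [simp]: "finite (index N)"
  unfolding index_def using finite_words by auto

lemma finite_all_words [simp]: "finite (all_words N)"
  unfolding all_words_def using finite_words by auto

lemma sum_index: "(\<Sum>i\<in>index N. F (fst i) (snd i)) = (\<Sum>p<N. \<Sum>s\<in>words q p. F p s)"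
  unfolding index_def by (simp add: sum.Sigma case_prod_beta)

lemma sum_all_words: "(\<Sum>x\<in>all_words N. F x) = (\<Sum>k<N. \<Sum>x\<in>words q k. F x)"
  unfolding all_words_def by (rule sum.UNION_disjoint) (use finite_words in \<open>auto dest!: length_words\<close>)

lemma parseval:
  assumes "k < N"
  shows "(\<Sum>i\<in>index N. (cmod (wavelet_coeff g k (snd i)))\<^sup>2) = (\<Sum>x\<in>words q k. (cmod (g x))\<^sup>2)"
proof -
  let ?W = "words q k" and ?w = "\<lambda>i x. wavelet (snd i) x"
  have "complex_of_real (\<Sum>i\<in>index N. (cmod (wavelet_coeff g k (snd i)))\<^sup>2)
      = (\<Sum>i\<in>index N. wavelet_coeff g k (snd i) * cnj (wavelet_coeff g k (snd i)))"
    by (simp only: of_real_sum complex_norm_square)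
  also have "\<dots> = (\<Sum>i\<in>index N. \<Sum>x\<in>?W. \<Sum>y\<in>?W. g x * cnj (g y) * complex_of_real (?w i x * ?w i y))"
    unfolding wavelet_coeff_def cnj_sum sum_product by (intro sum.cong refl) (simp add: mult_ac)
  also have "\<dots> = (\<Sum>x\<in>?W. \<Sum>y\<in>?W. \<Sum>i\<in>index N. g x * cnj (g y) * complex_of_real (?w i x * ?w i y))"
    by (subst sum.swap, intro sum.cong refl, rule sum.swap)
  also have "\<dots> = (\<Sum>x\<in>?W. \<Sum>y\<in>?W. g x * cnj (g y) * complex_of_real (if x = y then 1 else 0))"
  proof (intro sum.cong refl)
    fix x y assume xy: "x \<in> ?W" "y \<in> ?W"
    have "(\<Sum>i\<in>index N. ?w i x * ?w i y) = (if x = y then 1 else 0)"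
      using sum_all_wavelets[OF xy assms] sum_index[of "\<lambda>p s. wavelet s x * wavelet s y" N] by simp
    then show "(\<Sum>i\<in>index N. g x * cnj (g y) * complex_of_real (?w i x * ?w i y)) = g x * cnj (g y) * complex_of_real (if x = y then 1 else 0)"
      by (simp only: sum_distrib_left[symmetric] of_real_sum[symmetric])
  qed
  also have "\<dots> = (\<Sum>x\<in>?W. \<Sum>y\<in>?W. if x = y then g x * cnj (g y) else 0)"
    by (intro sum.cong refl) auto
  also have "\<dots> = (\<Sum>x\<in>?W. g x * cnj (g x))" by simp
  also have "\<dots> = complex_of_real (\<Sum>x\<in>?W. (cmod (g x))\<^sup>2)"
    by (simp only: of_real_sum complex_norm_square)
  finally show ?thesis by (simp only: of_real_eq_iff)
qed

lemma bform_test_matrix: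
  "bform (all_words N) (test_matrix N Z) g f
    = (\<Sum>i\<in>index N. bform {..<N} (Z (fst i)) (\<lambda>k. wavelet_coeff g k (snd i)) (\<lambda>l. wavelet_coeff f l (snd i)))"
proof -
  let ?t = "\<lambda>i k l x y. (g x * complex_of_real (wavelet (snd i) x)) * Z (fst i) k l * (f y * complex_of_real (wavelet (snd i) y))"
  have "bform (all_words N) (test_matrix N Z) g f
      = (\<Sum>k<N. \<Sum>x\<in>words q k. \<Sum>l<N. \<Sum>y\<in>words q l. \<Sum>i\<in>index N. ?t i k l x y)"
    unfolding bform_def sum_all_words test_matrix_def
    by (intro sum.cong refl) (simp add: length_words sum_distrib_left sum_distrib_right mult_ac)
  also have "\<dots> = (\<Sum>k<N. \<Sum>x\<in>words q k. \<Sum>l<N. \<Sum>i\<in>index N. \<Sum>y\<in>words q l. ?t i k l x y)"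
    by (intro sum.cong refl, rule sum.swap)
  also have "\<dots> = (\<Sum>k<N. \<Sum>x\<in>words q k. \<Sum>i\<in>index N. \<Sum>l<N. \<Sum>y\<in>words q l. ?t i k l x y)"
    by (intro sum.cong refl, rule sum.swap)
  also have "\<dots> = (\<Sum>k<N. \<Sum>i\<in>index N. \<Sum>x\<in>words q k. \<Sum>l<N. \<Sum>y\<in>words q l. ?t i k l x y)"
    by (intro sum.cong refl, rule sum.swap)
  also have "\<dots> = (\<Sum>i\<in>index N. \<Sum>k<N. \<Sum>x\<in>words q k. \<Sum>l<N. \<Sum>y\<in>words q l. ?t i k l x y)"
    by (rule sum.swap)
  also have "\<dots> = (\<Sum>i\<in>index N. \<Sum>k<N. \<Sum>l<N. \<Sum>x\<in>words q k. \<Sum>y\<in>words q l. ?t i k l x y)"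
    by (intro sum.cong refl, rule sum.swap)
  also have "\<dots> = (\<Sum>i\<in>index N. bform {..<N} (Z (fst i)) (\<lambda>k. wavelet_coeff g k (snd i)) (\<lambda>l. wavelet_coeff f l (snd i)))"
  proof -
    have "(\<Sum>x\<in>words q k. \<Sum>y\<in>words q l. ?t i k l x y)
        = wavelet_coeff g k (snd i) * Z (fst i) k l * wavelet_coeff f l (snd i)" for i k l
      unfolding wavelet_coeff_def sum_distrib_right sum_distrib_left by (rule sum.swap)
    then show ?thesis by (simp only: bform_def)
  qed
  finally show ?thesis .
qed

text \<open>In wavelet coefficients the form decouples into one form of \<open>Z p\<close> per
  wavelet. Cauchy-Schwarz over the wavelets and Parseval on each level put the vectors back
  together.\<close>

lemma op_le_test_matrix:
  assumes Z: "\<And>p. p < N \<Longrightarrow> op_le {..<N} (Z p) 1"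
  shows "op_le (all_words N) (test_matrix N Z) 1"
proof (rule op_leI)
  fix g f assume gf: "l2n (all_words N) g = 1" "l2n (all_words N) f = 1"
  let ?c = "\<lambda>g i. l2n {..<N} (\<lambda>k. wavelet_coeff g k (snd i))"
  have norm: "(\<Sum>i\<in>index N. (?c g i)\<^sup>2) = (l2n (all_words N) g)\<^sup>2" for g
  proof -
    have "(\<Sum>i\<in>index N. (?c g i)\<^sup>2) = (\<Sum>k<N. \<Sum>i\<in>index N. (cmod (wavelet_coeff g k (snd i)))\<^sup>2)"
      unfolding l2n_power2 by (rule sum.swap)
    also have "\<dots> = (\<Sum>k<N. \<Sum>x\<in>words q k. (cmod (g x))\<^sup>2)" by (intro sum.cong refl parseval) simp
    finally show ?thesis unfolding l2n_power2 sum_all_words .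
  qed
  have "cmod (bform (all_words N) (test_matrix N Z) g f)
      \<le> (\<Sum>i\<in>index N. cmod (bform {..<N} (Z (fst i)) (\<lambda>k. wavelet_coeff g k (snd i)) (\<lambda>l. wavelet_coeff f l (snd i))))"
    unfolding bform_test_matrix by (rule norm_sum)
  also have "\<dots> \<le> (\<Sum>i\<in>index N. ?c g i * ?c f i)"
  proof (rule sum_mono)
    fix i assume "i \<in> index N"
    then have "op_le {..<N} (Z (fst i)) 1" by (intro Z) (auto simp: index_def)
    from op_leD[OF this] show "cmod (bform {..<N} (Z (fst i)) (\<lambda>k. wavelet_coeff g k (snd i)) (\<lambda>l. wavelet_coeff f l (snd i))) \<le> ?c g i * ?c f i"
      by simp
  qed
  also have "\<dots> \<le> sqrt (\<Sum>i\<in>index N. (?c g i)\<^sup>2) * sqrt (\<Sum>i\<in>index N. (?c f i)\<^sup>2)"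
    by (rule sum_mult_le_sqrt) simp_all
  also have "\<dots> = 1" unfolding norm gf by simp
  finally show "cmod (bform (all_words N) (test_matrix N Z) g f) \<le> 1" .
qed simp

lemma test_matrix_eq:
  assumes x: "x \<in> words q k" and y: "y \<in> words q l" and N: "k < N" "l < N"
  shows "test_matrix N Z x y = (\<Sum>p\<le>min k l. Z p k l * complex_of_real (suffix_kernel p x y - (if p = 0 then 0 else suffix_kernel (p - 1) x y)))"
proof -
  have "test_matrix N Z x y = (\<Sum>p<N. \<Sum>s\<in>words q p. Z p k l * complex_of_real (wavelet s x * wavelet s y))"
    unfolding test_matrix_def length_words[OF x] length_words[OF y]
    by (rule sum_index[of "\<lambda>p s. Z p k l * complex_of_real (wavelet s x * wavelet s y)"])
  also have "\<dots> = (\<Sum>p<N. Z p k l * complex_of_real (\<Sum>s\<in>words q p. wavelet s x * wavelet s y))"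
    by (simp add: sum_distrib_left)
  also have "\<dots> = (\<Sum>p\<le>min k l. Z p k l * complex_of_real (\<Sum>s\<in>words q p. wavelet s x * wavelet s y))"
  proof (rule sum.mono_neutral_right)
    show "\<forall>p\<in>{..<N} - {..min k l}. Z p k l * complex_of_real (\<Sum>s\<in>words q p. wavelet s x * wavelet s y) = 0"
    proof
      fix p assume p: "p \<in> {..<N} - {..min k l}"
      have "wavelet s x * wavelet s y = 0" if "s \<in> words q p" for s
        using p wavelet_longer[of x s] wavelet_longer[of y s] that x y by (auto simp: length_words)
      then have "(\<Sum>s\<in>words q p. wavelet s x * wavelet s y) = 0" by (rule sum.neutral[rule_format])
      then show "Z p k l * complex_of_real (\<Sum>s\<in>words q p. wavelet s x * wavelet s y) = 0" by simp
    qed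
  qed (use N in auto)
  also have "\<dots> = (\<Sum>p\<le>min k l. Z p k l * complex_of_real (suffix_kernel p x y - (if p = 0 then 0 else suffix_kernel (p - 1) x y)))"
    by (intro sum.cong refl arg_cong2[where f = times] arg_cong[where f = complex_of_real] sum_wavelet[OF x y]) auto
  finally show ?thesis .
qed

section \<open>Asymptotics for a large number of letters\<close>

text \<open>As \<open>q \<rightarrow> \<infinity>\<close>, almost all pairs of words that agree on the last \<open>p\<close> letters agree on no more than these.\<close>

definition suffix_mean :: "(nat list \<Rightarrow> nat list \<Rightarrow> complex) \<Rightarrow> nat \<Rightarrow> nat \<Rightarrow> nat \<Rightarrow> complex" where
  "suffix_mean D k l p = (\<Sum>x\<in>words q k. \<Sum>y\<in>words q l. complex_of_real (\<rho> ^ k) * (complex_of_real (suffix_kernel p x y) * D x y) * complex_of_real (\<rho> ^ l))"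

lemma suffix_mean_approx:
  assumes D: "\<And>x y p. agree p x y \<Longrightarrow> \<not> agree (Suc p) x y \<Longrightarrow> D x y = \<phi> (length x + length y - 2 * p)"
    and B: "\<And>n. n \<le> k + l \<Longrightarrow> cmod (\<phi> n) \<le> B" and p: "p \<le> k" "p \<le> l"
  shows "cmod (suffix_mean D k l p - \<phi> (k + l - 2 * p)) \<le> 2 * B / real q"
proof -
  let ?n = "k + l - p" and ?c = "\<phi> (k + l - 2 * p)"
  \<comment> \<open>The exceptional pairs, which agree on one letter too many. They are a share
    \<open>1 / q\<close> of the pairs counted by \<open>card_agree\<close>, and there are none if
    \<open>p\<close> is \<open>k\<close> or \<open>l\<close>; each causes an error of at most
    \<open>2 B\<close>.\<close>
  define cnt :: real where "cnt = (\<Sum>x\<in>words q k. \<Sum>y\<in>words q l. if agree (Suc p) x y then 1 else 0)"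
  have B0: "0 \<le> B" using B[of 0] norm_ge_zero order_trans by blast
  have \<rho>2': "\<rho>\<^sup>2 = 1 / real q" using \<rho>2 q by (simp add: field_simps)
  have pow: "\<rho> ^ k * (\<rho> ^ (k - p) * \<rho> ^ (l - p)) * \<rho> ^ l = 1 / real q ^ ?n"
  proof -
    have "\<rho> ^ k * (\<rho> ^ (k - p) * \<rho> ^ (l - p)) * \<rho> ^ l = \<rho> ^ (2 * ?n)"
      unfolding power_add[symmetric] by (rule arg_cong[where f = "\<lambda>m. \<rho> ^ m"]) (use p in linarith)
    then show ?thesis by (simp add: power_mult \<rho>2' power_divide)
  qed
  have DB: "cmod (D x y) \<le> B" if "x \<in> words q k" "y \<in> words q l" for x y
  proof -
    obtain r where "agree r x y" "\<not> agree (Suc r) x y" using agree_max[of x y] by blast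
    then show ?thesis using that D B by (simp add: length_words)
  qed
  have entry: "complex_of_real (\<rho> ^ k) * (complex_of_real (suffix_kernel p x y) * D x y) * complex_of_real (\<rho> ^ l)
      = (if agree p x y then D x y / of_nat q ^ ?n else 0)" if xy: "x \<in> words q k" "y \<in> words q l" for x y
  proof -
    have "complex_of_real (\<rho> ^ k) * complex_of_real (\<rho> ^ (k - p) * \<rho> ^ (l - p)) * complex_of_real (\<rho> ^ l) = 1 / of_nat q ^ ?n"
      using arg_cong[OF pow, of complex_of_real] by simp
    then show ?thesis using xy by (simp add: suffix_kernel_def length_words mult_ac)
  qed
  have one: "(\<Sum>x\<in>words q k. \<Sum>y\<in>words q l. if agree p x y then ?c / of_nat q ^ ?n else 0) = ?c"
  proof -
    have "(\<Sum>x\<in>words q k. \<Sum>y\<in>words q l. if agree p x y then ?c / of_nat q ^ ?n else 0)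
        = ?c / of_nat q ^ ?n * complex_of_real (\<Sum>x\<in>words q k. \<Sum>y\<in>words q l. if agree p x y then 1 else 0)"
      by (simp add: sum_distrib_left if_distrib[of complex_of_real] if_distrib[of "\<lambda>z. _ * z"] cong: if_cong)
    also have "\<dots> = ?c" using q by (simp add: card_agree[OF p])
    finally show ?thesis .
  qed
  let ?d = "\<lambda>x y. (if agree p x y then D x y / of_nat q ^ ?n else 0) - (if agree p x y then ?c / of_nat q ^ ?n else 0)"
  have diff: "cmod (?d x y) \<le> (if agree (Suc p) x y then 1 else 0) * (2 * B / real q ^ ?n)"
    if xy: "x \<in> words q k" "y \<in> words q l" for x y
  proof (cases "agree p x y \<and> agree (Suc p) x y")
    case True
    have "cmod (D x y - ?c) \<le> cmod (D x y) + cmod ?c" by (rule norm_triangle_ineq4)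
    also have "\<dots> \<le> 2 * B" using DB[OF xy] B[of "k + l - 2 * p"] by simp
    finally have "cmod (D x y - ?c) / real q ^ ?n \<le> 2 * B / real q ^ ?n"
      by (rule divide_right_mono) simp
    moreover have "cmod (D x y / of_nat q ^ ?n - ?c / of_nat q ^ ?n) = cmod (D x y - ?c) / real q ^ ?n"
      by (simp only: diff_divide_distrib[symmetric] norm_divide norm_power norm_of_nat)
    ultimately show ?thesis using True by (simp only: if_True mult_1)
  next
    case False
    have "?d x y = 0"
    proof (cases "agree p x y")
      case True
      then have "D x y = ?c" using D[of p x y] False xy by (simp add: length_words)
      then show ?thesis by simp
    qed simp
    then show ?thesis using B0 by simp
  qed
  have "suffix_mean D k l p = (\<Sum>x\<in>words q k. \<Sum>y\<in>words q l. if agree p x y then D x y / of_nat q ^ ?n else 0)"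
    unfolding suffix_mean_def by (rule sum.cong[OF refl], rule sum.cong[OF refl], rule entry)
  then have eq: "suffix_mean D k l p - ?c = (\<Sum>x\<in>words q k. \<Sum>y\<in>words q l. ?d x y)"
    by (simp only: sum_subtractf one)
  have "cmod (suffix_mean D k l p - ?c) \<le> (\<Sum>x\<in>words q k. \<Sum>y\<in>words q l. (if agree (Suc p) x y then 1 else 0) * (2 * B / real q ^ ?n))"
    unfolding eq by (rule order_trans[OF norm_sum], rule sum_mono, rule order_trans[OF norm_sum], rule sum_mono, rule diff)
  also have "\<dots> = cnt * (2 * B / real q ^ ?n)"
    unfolding cnt_def sum_distrib_right ..
  also have "\<dots> \<le> 2 * B / real q"
  proof (cases "p < k \<and> p < l")
    case True
    then obtain m where m: "?n = Suc m" "k + l - Suc p = m" by (cases ?n) auto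
    have "cnt = real q ^ m"
      using card_agree[of "Suc p" k l q] True unfolding m(2) cnt_def by simp
    then show ?thesis using q unfolding m(1) by simp
  next
    case False
    then have "cnt = 0"
      unfolding cnt_def by (auto simp: agree_def length_words intro!: sum.neutral)
    then show ?thesis using B0 by simp
  qed
  finally show ?thesis .
qed

end

context word_kernel
begin

text \<open>A unit vector on each level; over \<open>N\<close> levels its squared norm is
  \<open>N\<close>, which turns the sum over the levels into a mean.\<close>

definition radial :: "nat list \<Rightarrow> complex" where
  "radial x = complex_of_real (\<rho> ^ length x)"

lemma l2n_radial: "l2n (all_words N) radial = sqrt (real N)"
proof -
  have "(\<Sum>x\<in>words q k. (cmod (radial x))\<^sup>2) = 1" for k
  proof -
    have "(\<Sum>x\<in>words q k. (cmod (radial x))\<^sup>2) = (\<Sum>x\<in>words q k. (\<rho>\<^sup>2) ^ k)"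
      using \<rho>_pos by (intro sum.cong refl) (simp add: radial_def length_words norm_power power_mult[symmetric] mult.commute)
    also have "\<dots> = (real q * \<rho>\<^sup>2) ^ k" by (simp add: card_words power_mult_distrib)
    finally show ?thesis by (simp add: \<rho>2)
  qed
  then have "(\<Sum>x\<in>all_words N. (cmod (radial x))\<^sup>2) = real N" by (simp add: sum_all_words)
  then show ?thesis by (simp add: l2n_def L2_set_def)
qed

lemma bform_radial:
  "bform (all_words N) (\<lambda>x y. D x y * test_matrix N Z x y) radial radial
    = (\<Sum>k<N. \<Sum>l<N. \<Sum>p\<le>min k l. Z p k l * (suffix_mean D k l p - (if p = 0 then 0 else suffix_mean D k l (p - 1))))"
proof -
  let ?F = "\<lambda>x y. radial x * (D x y * test_matrix N Z x y) * radial y"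
  have "(\<Sum>x\<in>words q k. \<Sum>y\<in>words q l. ?F x y)
      = (\<Sum>p\<le>min k l. Z p k l * (suffix_mean D k l p - (if p = 0 then 0 else suffix_mean D k l (p - 1))))"
    if kl: "k < N" "l < N" for k l
  proof -
    let ?t = "\<lambda>p x y. complex_of_real (\<rho> ^ k) * (complex_of_real (suffix_kernel p x y) * D x y) * complex_of_real (\<rho> ^ l)"
    let ?u = "\<lambda>p x y. ?t p x y - (if p = 0 then 0 else ?t (p - 1) x y)"
    have "(\<Sum>x\<in>words q k. \<Sum>y\<in>words q l. ?F x y) = (\<Sum>x\<in>words q k. \<Sum>y\<in>words q l. \<Sum>p\<le>min k l. Z p k l * ?u p x y)"
    proof (rule sum.cong[OF refl], rule sum.cong[OF refl])
      fix x y assume xy: "x \<in> words q k" "y \<in> words q l"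
      have "?F x y = (\<Sum>p\<le>min k l. complex_of_real (\<rho> ^ k) * (D x y * (Z p k l * complex_of_real (suffix_kernel p x y - (if p = 0 then 0 else suffix_kernel (p - 1) x y)))) * complex_of_real (\<rho> ^ l))"
        unfolding test_matrix_eq[OF xy kl] radial_def length_words[OF xy(1)] length_words[OF xy(2)]
        by (simp only: sum_distrib_left sum_distrib_right)
      also have "\<dots> = (\<Sum>p\<le>min k l. Z p k l * ?u p x y)"
        by (rule sum.cong[OF refl]) (simp add: algebra_simps)
      finally show "?F x y = (\<Sum>p\<le>min k l. Z p k l * ?u p x y)" .
    qed
    also have "\<dots> = (\<Sum>x\<in>words q k. \<Sum>p\<le>min k l. \<Sum>y\<in>words q l. Z p k l * ?u p x y)"
      by (rule sum.cong[OF refl], rule sum.swap)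
    also have "\<dots> = (\<Sum>p\<le>min k l. \<Sum>x\<in>words q k. \<Sum>y\<in>words q l. Z p k l * ?u p x y)"
      by (rule sum.swap)
    also have "\<dots> = (\<Sum>p\<le>min k l. Z p k l * (suffix_mean D k l p - (if p = 0 then 0 else suffix_mean D k l (p - 1))))"
    proof (rule sum.cong[OF refl])
      fix p
      show "(\<Sum>x\<in>words q k. \<Sum>y\<in>words q l. Z p k l * ?u p x y) = Z p k l * (suffix_mean D k l p - (if p = 0 then 0 else suffix_mean D k l (p - 1)))"
        unfolding sum_distrib_left[symmetric] suffix_mean_def
        by (cases "p = 0") (simp_all only: sum_subtractf if_True if_False simp_thms sum.neutral_const)
    qed
    finally show ?thesis .
  qed
  then have "(\<Sum>k<N. \<Sum>l<N. \<Sum>x\<in>words q k. \<Sum>y\<in>words q l. ?F x y)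
    = (\<Sum>k<N. \<Sum>l<N. \<Sum>p\<le>min k l. Z p k l * (suffix_mean D k l p - (if p = 0 then 0 else suffix_mean D k l (p - 1))))"
    by simp
  moreover have "bform (all_words N) (\<lambda>x y. D x y * test_matrix N Z x y) radial radial = (\<Sum>k<N. \<Sum>l<N. \<Sum>x\<in>words q k. \<Sum>y\<in>words q l. ?F x y)"
    unfolding bform_def sum_all_words by (rule sum.cong[OF refl], rule sum.swap)
  ultimately show ?thesis by simp
qed

lemma radial_test_approx:
  assumes D: "\<And>x y p. agree p x y \<Longrightarrow> \<not> agree (Suc p) x y \<Longrightarrow> D x y = \<phi> (length x + length y - 2 * p)"
    and B: "\<And>n. n \<le> 2 * N \<Longrightarrow> cmod (\<phi> n) \<le> B"
    and Z: "\<And>p. p < N \<Longrightarrow> op_le {..<N} (Z p) 1"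
    and C: "\<And>a. op_le (all_words N) a 1 \<Longrightarrow> op_le (all_words N) (\<lambda>x y. D x y * a x y) C"
  shows "cmod (\<Sum>k<N. \<Sum>l<N. \<Sum>p\<le>min k l. Z p k l * (\<phi> (k + l - 2 * p) - (if p = 0 then 0 else \<phi> (k + l - 2 * p + 2))))
    \<le> C * N + (\<Sum>k<N. \<Sum>l<N. \<Sum>p\<le>min k l. cmod (Z p k l)) * (4 * B) / real q"
proof -
  let ?s = "\<lambda>k l p. suffix_mean D k l p - (if p = 0 then 0 else suffix_mean D k l (p - 1))"
  let ?v = "\<lambda>k l p. \<phi> (k + l - 2 * p) - (if p = 0 then 0 else \<phi> (k + l - 2 * p + 2))"
  let ?S = "\<Sum>k<N. \<Sum>l<N. \<Sum>p\<le>min k l. Z p k l * ?s k l p" and ?V = "\<Sum>k<N. \<Sum>l<N. \<Sum>p\<le>min k l. Z p k l * ?v k l p"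
  have S: "cmod ?S \<le> C * real N"
    using op_leD[OF C[OF op_le_test_matrix[OF Z]], where g = radial and f = radial] unfolding bform_radial l2n_radial
    by (simp add: mult.assoc)
  have B0: "0 \<le> B" using B[of 0] norm_ge_zero order_trans by blast
  \<comment> \<open>For \<open>p > 0\<close> two means are replaced, each with error
    \<open>2 B / q\<close>; hence the constant 4.\<close>
  have near: "cmod (?s k l p - ?v k l p) \<le> 4 * B / real q" if "k < N" "l < N" "p \<le> min k l" for k l p
  proof -
    have Bkl: "cmod (\<phi> n) \<le> B" if "n \<le> k + l" for n using that \<open>k < N\<close> \<open>l < N\<close> by (intro B) simp
    have 1: "cmod (suffix_mean D k l p - \<phi> (k + l - 2 * p)) \<le> 2 * B / real q"
      by (rule suffix_mean_approx[where D = D and \<phi> = \<phi>, OF D Bkl]) (use that in auto)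
    show ?thesis
    proof (cases "p = 0")
      case True
      have "2 * B / real q \<le> 4 * B / real q" using B0 by (intro divide_right_mono) auto
      with 1 True show ?thesis by simp
    next
      case False
      have 2: "cmod (suffix_mean D k l (p - 1) - \<phi> (k + l - 2 * (p - 1))) \<le> 2 * B / real q"
        by (rule suffix_mean_approx[where D = D and \<phi> = \<phi>, OF D Bkl]) (use that in auto)
      have "1 \<le> p" "p \<le> k" "p \<le> l" using False that by auto
      \<comment> \<open>This identity of truncated differences relies on \<open>p \<le> k\<close>
        and \<open>p \<le> l\<close>.\<close>
      then have "k + l - 2 * (p - 1) = k + l - 2 * p + 2" by linarith
      then have "?s k l p - ?v k l p = (suffix_mean D k l p - \<phi> (k + l - 2 * p)) - (suffix_mean D k l (p - 1) - \<phi> (k + l - 2 * (p - 1)))"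
        using False by simp
      then have "cmod (?s k l p - ?v k l p) \<le> cmod (suffix_mean D k l p - \<phi> (k + l - 2 * p)) + cmod (suffix_mean D k l (p - 1) - \<phi> (k + l - 2 * (p - 1)))"
        by (simp only: norm_triangle_ineq4)
      also have "\<dots> \<le> 4 * B / real q" using 1 2 by simp
      finally show ?thesis .
    qed
  qed
  have "?S - ?V = (\<Sum>k<N. \<Sum>l<N. \<Sum>p\<le>min k l. Z p k l * (?s k l p - ?v k l p))"
    by (simp only: sum_subtractf[symmetric] right_diff_distrib[symmetric])
  then have "cmod (?S - ?V) \<le> (\<Sum>k<N. \<Sum>l<N. \<Sum>p\<le>min k l. cmod (Z p k l * (?s k l p - ?v k l p)))"
    by (simp only:) (rule order_trans[OF norm_sum], rule sum_mono, rule order_trans[OF norm_sum], rule sum_mono, rule norm_sum)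
  also have "\<dots> \<le> (\<Sum>k<N. \<Sum>l<N. \<Sum>p\<le>min k l. cmod (Z p k l) * (4 * B / real q))"
    unfolding norm_mult by (rule sum_mono, rule sum_mono, rule sum_mono, rule mult_left_mono, rule near) auto
  also have "\<dots> = (\<Sum>k<N. \<Sum>l<N. \<Sum>p\<le>min k l. cmod (Z p k l)) * (4 * B) / real q"
    unfolding times_divide_eq_right[symmetric] by (simp only: sum_distrib_right)
  finally have "cmod (?S - ?V) \<le> (\<Sum>k<N. \<Sum>l<N. \<Sum>p\<le>min k l. cmod (Z p k l)) * (4 * B) / real q" .
  moreover have "cmod ?V \<le> cmod ?S + cmod (?S - ?V)"
    using norm_triangle_ineq4[of ?S "?S - ?V"] by simp
  ultimately show ?thesis using S by linarith
qed

end

text \<open>A contraction on the finite set is carried over by \<open>e\<close> and extended by zero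
  to the whole type, where the uniform bound applies.\<close>

lemma op_le_transport:
  assumes e: "inj e" and V: "finite V" and a: "op_le V a 1"
    and C: "\<And>b F. contraction b \<Longrightarrow> finite F \<Longrightarrow> op_le F (\<lambda>x y. \<psi> x y * b x y) C"
  shows "op_le V (\<lambda>x y. \<psi> (e x) (e y) * a x y) C"
proof -
  have inj: "inj_on e V" using e by (rule inj_on_subset) simp
  have l2: "l2n (e ` V) g = l2n V (\<lambda>x. g (e x))" for g
    by (simp add: l2n_def L2_set_def sum.reindex[OF inj])
  have form: "bform (e ` V) b g f = bform V (\<lambda>x y. b (e x) (e y)) (\<lambda>x. g (e x)) (\<lambda>x. f (e x))" for b g f
    by (simp add: bform_def sum.reindex[OF inj])
  define b where "b x y = a (inv e x) (inv e y)" for x y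
  have "op_le (e ` V) b 1"
    unfolding op_le_def form l2 using op_leD[OF a] by (simp add: b_def inv_f_f[OF e])
  then have "contraction (\<lambda>x y. if x \<in> e ` V \<and> y \<in> e ` V then b x y else 0)"
    by (rule contraction_restrict[rotated]) (use V in simp)
  from C[OF this, of "e ` V"] V
  have le: "op_le (e ` V) (\<lambda>x y. \<psi> x y * (if x \<in> e ` V \<and> y \<in> e ` V then b x y else 0)) C" by simp
  show ?thesis
    unfolding op_le_def
  proof (intro allI)
    fix g f
    have "bform V (\<lambda>x y. \<psi> (e x) (e y) * a x y) g f
      = bform V (\<lambda>x y. \<psi> (e x) (e y) * (if e x \<in> e ` V \<and> e y \<in> e ` V then b (e x) (e y) else 0)) g f"
      by (rule bform_cong) (simp add: b_def inv_f_f[OF e])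
    then show "cmod (bform V (\<lambda>x y. \<psi> (e x) (e y) * a x y) g f) \<le> C * l2n V g * l2n V f"
      using op_leD[OF le, of "\<lambda>x. g (inv e x)" "\<lambda>x. f (inv e x)"] unfolding form l2
      by (simp add: inv_f_f[OF e])
  qed
qed

text \<open>Neither the left side nor \<open>K\<close> depends on the number of letters, so the
  error \<open>K / q\<close> vanishes in the limit. Only \<open>\<phi> n\<close> with
  \<open>n \<le> 2 N\<close> occurs, which is why \<open>B\<close> exists for arbitrary
  \<open>\<phi>\<close>.\<close>

lemma (in infinite_rooted_tree) radial_test:
  assumes C: "\<And>a F. contraction a \<Longrightarrow> finite F \<Longrightarrow> op_le F (\<lambda>x y. \<phi> (graph_dist E x y) * a x y) C"
    and Z: "\<And>p. p < N \<Longrightarrow> op_le {..<N} (Z p) 1"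
  shows "cmod (\<Sum>k<N. \<Sum>l<N. \<Sum>p\<le>min k l. Z p k l * (\<phi> (k + l - 2 * p) - (if p = 0 then 0 else \<phi> (k + l - 2 * p + 2))))
    \<le> C * real N" (is "cmod ?V \<le> _")
proof -
  define B where "B = (\<Sum>n\<le>2 * N. cmod (\<phi> n))"
  have B: "cmod (\<phi> n) \<le> B" if "n \<le> 2 * N" for n
    unfolding B_def using member_le_sum[of n "{..2 * N}" "\<lambda>n. cmod (\<phi> n)"] that by simp
  define K where "K = (\<Sum>k<N. \<Sum>l<N. \<Sum>p\<le>min k l. cmod (Z p k l)) * (4 * B)"
  have "cmod ?V \<le> C * real N + K / real (Suc n)" for n
  proof -
    interpret word_kernel "Suc n" by unfold_locales simp
    have D: "\<phi> (graph_dist E (emb x) (emb y)) = \<phi> (length x + length y - 2 * p)"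
      if "agree p x y" "\<not> agree (Suc p) x y" for x y p
    proof -
      have "graph_dist E (emb x) (emb y) = (length x - p) + (length y - p)"
        by (rule dist_emb) (use that in \<open>auto simp: agree_def\<close>)
      moreover have "p \<le> length x" "p \<le> length y" using that by (auto simp: agree_def)
      then have "(length x - p) + (length y - p) = length x + length y - 2 * p" by linarith
      ultimately show ?thesis by simp
    qed
    show ?thesis unfolding K_def
      by (rule radial_test_approx[where D = "\<lambda>x y. \<phi> (graph_dist E (emb x) (emb y))", OF D B Z])
        (auto intro: op_le_transport[OF inj_emb finite_all_words _ C])
  qed
  moreover have "(\<lambda>n. C * real N + K / real (Suc n)) \<longlonglongrightarrow> C * real N + 0"
    by (intro tendsto_intros LIMSEQ_Suc[OF lim_const_over_n])
  ultimately show ?thesis using LIMSEQ_le_const[of _ "C * real N + 0"] by simp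
qed

subsection \<open>The lower bound\<close>

lemma sum_pairs:
  fixes F :: "nat \<Rightarrow> 'b :: comm_monoid_add"
  shows "(\<Sum>k<2 * n. F k) = (\<Sum>a<n. F (2 * a) + F (2 * a + 1))"
proof (induction n)
  case (Suc n)
  have "{..<2 * Suc n} = insert (2 * n + 1) (insert (2 * n) {..<2 * n})" by auto
  then show ?case using Suc by (simp add: add_ac)
qed simp

text \<open>The block \<open>[[A, B], [B, A]]\<close> along the antidiagonal. Its norm is the maximum of \<open>\<bar>A + B\<bar>\<close> and \<open>\<bar>A - B\<bar>\<close>,
  and it only sees \<open>\<phi>\<close> near \<open>2 n\<close>, that is, the constants \<open>c\<^sub>+\<close> and \<open>c\<^sub>-\<close>.\<close>

definition flip_matrix :: "complex \<Rightarrow> complex \<Rightarrow> nat \<Rightarrow> nat \<Rightarrow> nat \<Rightarrow> complex" where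
  "flip_matrix A B n k l = (if k div 2 + l div 2 = n - 1 then if even (k + l) then A else B else 0)"

text \<open>Levels are paired as \<open>2 a\<close> and \<open>2 a + 1\<close>, and the pair
  \<open>a\<close> meets the pair \<open>n - 1 - a\<close>; so \<open>k + l\<close> takes only the
  values \<open>2 n - 2\<close>, \<open>2 n - 1\<close> and \<open>2 n\<close>.\<close>

lemma sum_flip_matrix:
  "(\<Sum>k<2 * n. \<Sum>l<2 * n. flip_matrix A B n k l * F k l)
    = (\<Sum>a<n. (A * F (2 * a) (2 * (n - Suc a)) + B * F (2 * a) (2 * (n - Suc a) + 1))
          + (B * F (2 * a + 1) (2 * (n - Suc a)) + A * F (2 * a + 1) (2 * (n - Suc a) + 1)))"
proof -
  have inner: "(\<Sum>l<2 * n. flip_matrix A B n k l * G l)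
      = (if even k then A else B) * G (2 * (n - Suc (k div 2))) + (if even k then B else A) * G (2 * (n - Suc (k div 2)) + 1)"
    if k: "k < 2 * n" for k and G :: "nat \<Rightarrow> complex"
  proof -
    have kn: "k div 2 < n" using k by auto
    have cond: "k div 2 + b = n - 1 \<longleftrightarrow> b = n - Suc (k div 2)" for b using kn by linarith
    have flip: "flip_matrix A B n k (2 * b) = (if b = n - Suc (k div 2) then if even k then A else B else 0)"
      "flip_matrix A B n k (2 * b + 1) = (if b = n - Suc (k div 2) then if even k then B else A else 0)" for b
      unfolding flip_matrix_def cond[symmetric] by simp_all
    have "(\<Sum>l<2 * n. flip_matrix A B n k l * G l)
        = (\<Sum>b<n. if b = n - Suc (k div 2) then (if even k then A else B) * G (2 * b) + (if even k then B else A) * G (2 * b + 1) else 0)"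
      unfolding sum_pairs by (rule sum.cong[OF refl]) (simp only: flip if_distrib[of "\<lambda>c. c * _"] mult_zero_left add_0_right split: if_split, simp)
    also have "\<dots> = (if even k then A else B) * G (2 * (n - Suc (k div 2))) + (if even k then B else A) * G (2 * (n - Suc (k div 2)) + 1)"
      using kn by (simp only: sum.delta[OF finite_lessThan]) simp
    finally show ?thesis .
  qed
  let ?G = "\<lambda>k. (if even k then A else B) * F k (2 * (n - Suc (k div 2))) + (if even k then B else A) * F k (2 * (n - Suc (k div 2)) + 1)"
  have 1: "(\<Sum>k<2 * n. \<Sum>l<2 * n. flip_matrix A B n k l * F k l) = (\<Sum>k<2 * n. ?G k)"
  proof (rule sum.cong[OF refl])
    fix k assume "k \<in> {..<2 * n}"
    then show "(\<Sum>l<2 * n. flip_matrix A B n k l * F k l) = ?G k"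
      using inner[of k "F k"] by (simp only: lessThan_iff)
  qed
  have 2: "(\<Sum>k<2 * n. ?G k) = (\<Sum>a<n. ?G (2 * a) + ?G (2 * a + 1))" by (rule sum_pairs)
  have 3: "even (2 * a) = True" "even (2 * a + 1) = False" "2 * a div 2 = a" "(2 * a + 1) div 2 = a" for a :: nat
    by auto
  show ?thesis unfolding 1 2 by (simp only: 3 if_True if_False)
qed

text \<open>Sums and differences diagonalise the block, with eigenvalues \<open>A + B\<close> and
  \<open>A - B\<close>. The parallelogram law absorbs the factor \<open>1 / 2\<close>.\<close>

lemma flip_block_le:
  fixes A B x y u v :: complex
  assumes "cmod (A + B) \<le> 1" "cmod (A - B) \<le> 1"
  shows "cmod ((A * (x * u) + B * (x * v)) + (B * (y * u) + A * (y * v)))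
    \<le> sqrt ((cmod x)\<^sup>2 + (cmod y)\<^sup>2) * sqrt ((cmod u)\<^sup>2 + (cmod v)\<^sup>2)"
proof -
  have par: "(cmod (a + b))\<^sup>2 + (cmod (a - b))\<^sup>2 = 2 * ((cmod a)\<^sup>2 + (cmod b)\<^sup>2)" for a b :: complex
    unfolding cmod_power2 by (simp add: power2_eq_square algebra_simps)
  have "(A * (x * u) + B * (x * v)) + (B * (y * u) + A * (y * v))
      = ((A + B) * ((x + y) * (u + v)) + (A - B) * ((x - y) * (u - v))) / 2"
    by (simp add: field_simps)
  also have "cmod \<dots> \<le> (cmod (A + B) * (cmod (x + y) * cmod (u + v)) + cmod (A - B) * (cmod (x - y) * cmod (u - v))) / 2"
    by (simp add: norm_divide norm_mult[symmetric] divide_right_mono norm_triangle_ineq)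
  also have "\<dots> \<le> (1 * (cmod (x + y) * cmod (u + v)) + 1 * (cmod (x - y) * cmod (u - v))) / 2"
    by (intro divide_right_mono add_mono mult_right_mono assms) auto
  also have "\<dots> \<le> (sqrt ((cmod (x + y))\<^sup>2 + (cmod (x - y))\<^sup>2) * sqrt ((cmod (u + v))\<^sup>2 + (cmod (u - v))\<^sup>2)) / 2"
  proof (rule divide_right_mono)
    have "(\<Sum>b\<in>UNIV. (if b then cmod (x + y) else cmod (x - y)) * (if b then cmod (u + v) else cmod (u - v)))
        \<le> sqrt (\<Sum>b\<in>UNIV. (if b then cmod (x + y) else cmod (x - y))\<^sup>2) * sqrt (\<Sum>b\<in>UNIV. (if b then cmod (u + v) else cmod (u - v))\<^sup>2)"
      by (rule sum_mult_le_sqrt) auto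
    then show "1 * (cmod (x + y) * cmod (u + v)) + 1 * (cmod (x - y) * cmod (u - v))
        \<le> sqrt ((cmod (x + y))\<^sup>2 + (cmod (x - y))\<^sup>2) * sqrt ((cmod (u + v))\<^sup>2 + (cmod (u - v))\<^sup>2)"
      by (simp add: UNIV_bool add.commute)
  qed simp
  also have "\<dots> = sqrt ((cmod x)\<^sup>2 + (cmod y)\<^sup>2) * sqrt ((cmod u)\<^sup>2 + (cmod v)\<^sup>2)"
    unfolding par real_sqrt_mult by simp
  finally show ?thesis .
qed

lemma op_le_flip_matrix:
  assumes "cmod (A + B) \<le> 1" "cmod (A - B) \<le> 1"
  shows "op_le {..<2 * n} (flip_matrix A B n) 1"
  unfolding op_le_def
proof (intro allI)
  fix g f :: "nat \<Rightarrow> complex"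
  let ?n = "\<lambda>g a. sqrt ((cmod (g (2 * a)))\<^sup>2 + (cmod (g (2 * a + 1)))\<^sup>2)"
  have l2: "sqrt (\<Sum>a<n. (?n g a)\<^sup>2) = l2n {..<2 * n} g" for g :: "nat \<Rightarrow> complex"
    by (simp add: l2n_def L2_set_def sum_pairs)
  have eq: "bform {..<2 * n} (flip_matrix A B n) g f = (\<Sum>k<2 * n. \<Sum>l<2 * n. flip_matrix A B n k l * (g k * f l))"
    unfolding bform_def by (rule sum.cong[OF refl], rule sum.cong[OF refl]) simp
  have "cmod (bform {..<2 * n} (flip_matrix A B n) g f) \<le> (\<Sum>a<n. ?n g a * ?n f (n - Suc a))"
    unfolding eq sum_flip_matrix by (rule order_trans[OF norm_sum], rule sum_mono, rule flip_block_le[OF assms])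
  also have "\<dots> \<le> sqrt (\<Sum>a<n. (?n g a)\<^sup>2) * sqrt (\<Sum>a<n. (?n f (n - Suc a))\<^sup>2)"
    by (rule sum_mult_le_sqrt) auto
  also have "(\<Sum>a<n. (?n f (n - Suc a))\<^sup>2) = (\<Sum>a<n. (?n f a)\<^sup>2)"
    by (rule sum.nat_diff_reindex)
  finally show "cmod (bform {..<2 * n} (flip_matrix A B n) g f) \<le> 1 * l2n {..<2 * n} g * l2n {..<2 * n} f"
    unfolding l2 by simp
qed

text \<open>Moving \<open>T\<close> along the diagonal by \<open>p\<close> compensates the shift in
  \<open>h (k - p) (l - p)\<close>, so each admissible \<open>p\<close> yields the same pairing with
  \<open>H\<close>.\<close>

definition shift_matrix :: "nat \<Rightarrow> nat \<Rightarrow> (nat \<Rightarrow> nat \<Rightarrow> complex) \<Rightarrow> nat \<Rightarrow> nat \<Rightarrow> complex" where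
  "shift_matrix M p T k l = (if k \<in> {p..<p + M} \<and> l \<in> {p..<p + M} then T (k - p) (l - p) else 0)"

lemma sum_shift:
  fixes p M N :: nat
  assumes "p + M \<le> N"
  shows "(\<Sum>k<N. if k \<in> {p..<p + M} then F k else 0) = (\<Sum>i<M. F (p + i))"
proof -
  have "(\<Sum>k<N. if k \<in> {p..<p + M} then F k else 0) = (\<Sum>k\<in>{p..<p + M}. F k)"
    by (rule sum.mono_neutral_cong_right) (use assms in auto)
  also have "\<dots> = (\<Sum>i<M. F (p + i))"
    by (rule sum.reindex_bij_witness[of _ "\<lambda>i. p + i" "\<lambda>k. k - p"]) auto
  finally show ?thesis .
qed

lemma sum_shift_matrix:
  assumes "p + M \<le> N"
  shows "(\<Sum>k<N. \<Sum>l<N. shift_matrix M p T k l * F k l) = (\<Sum>i<M. \<Sum>j<M. T i j * F (p + i) (p + j))"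
proof -
  have "(\<Sum>l<N. shift_matrix M p T k l * F k l)
      = (if k \<in> {p..<p + M} then \<Sum>l<N. if l \<in> {p..<p + M} then T (k - p) (l - p) * F k l else 0 else 0)" for k
    by (auto simp: shift_matrix_def intro!: sum.cong)
  then show ?thesis by (simp add: sum_shift[OF assms] del: atLeastLessThan_iff)
qed

lemma op_le_shift_matrix:
  assumes "p + M \<le> N" "contraction T"
  shows "op_le {..<N} (shift_matrix M p T) 1"
  unfolding op_le_def
proof (intro allI)
  fix g f :: "nat \<Rightarrow> complex"
  have l2: "l2n {..<M} (\<lambda>i. g (p + i)) \<le> l2n {..<N} g" for g :: "nat \<Rightarrow> complex"
  proof -
    have "(\<Sum>i<M. (cmod (g (p + i)))\<^sup>2) = (\<Sum>k<N. if k \<in> {p..<p + M} then (cmod (g k))\<^sup>2 else 0)"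
      by (rule sum_shift[OF assms(1), symmetric])
    also have "\<dots> \<le> (\<Sum>k<N. (cmod (g k))\<^sup>2)" by (intro sum_mono) auto
    finally show ?thesis by (simp add: l2n_def L2_set_def)
  qed
  have "bform {..<N} (shift_matrix M p T) g f = (\<Sum>k<N. \<Sum>l<N. shift_matrix M p T k l * (g k * f l))"
    unfolding bform_def by (rule sum.cong[OF refl], rule sum.cong[OF refl]) simp
  also have "\<dots> = bform {..<M} T (\<lambda>i. g (p + i)) (\<lambda>j. f (p + j))"
    unfolding sum_shift_matrix[OF assms(1)] bform_def by (rule sum.cong[OF refl], rule sum.cong[OF refl]) simp
  finally have "cmod (bform {..<N} (shift_matrix M p T) g f) \<le> l2n {..<M} (\<lambda>i. g (p + i)) * l2n {..<M} (\<lambda>j. f (p + j))"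
    using contractionD[OF assms(2), of "{..<M}"] by simp
  also have "\<dots> \<le> 1 * l2n {..<N} g * l2n {..<N} f" using mult_mono[OF l2[of g] l2[of f]] by simp
  finally show "cmod (bform {..<N} (shift_matrix M p T) g f) \<le> 1 * l2n {..<N} g * l2n {..<N} f" .
qed

context infinite_rooted_tree
begin

lemma radial_test_combined:
  assumes C: "\<And>a F. contraction a \<Longrightarrow> finite F \<Longrightarrow> op_le F (\<lambda>x y. \<phi> (graph_dist E x y) * a x y) C"
    and AB: "cmod (A + B) \<le> 1" "cmod (A - B) \<le> 1" and T: "contraction T" and n: "M \<le> 2 * n" "0 < n"
  defines "H \<equiv> \<lambda>i j. \<phi> (i + j) - \<phi> (i + j + 2)"
  shows "cmod (of_nat n * (A * \<phi> (2 * (n - 1)) + 2 * B * \<phi> (2 * (n - 1) + 1) + A * \<phi> (2 * n))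
      + of_nat (2 * n - M) * pairing {..<M} {..<M} T H) \<le> C * real (2 * n)"
proof -
  let ?N = "2 * n"
  \<comment> \<open>Depths at which the shifted \<open>T\<close> would stick out of the
    \<open>2 n\<close> levels get zero; the depths \<open>1\<close> to \<open>2 n - M\<close> remain
    and account for the factor of the pairing.\<close>
  define Z where "Z p = (if p = 0 then flip_matrix A B n else if p + M \<le> ?N then shift_matrix M p T else (\<lambda>k l. 0))" for p
  have Z: "op_le {..<?N} (Z p) 1" for p
    using op_le_flip_matrix[OF AB, of n] op_le_shift_matrix[OF _ T, of p M ?N]
    by (auto simp: Z_def op_le_def bform_def)
  let ?v = "\<lambda>k l p. Z p k l * (\<phi> (k + l - 2 * p) - (if p = 0 then 0 else \<phi> (k + l - 2 * p + 2)))"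
  let ?h = "\<lambda>k l p. shift_matrix M p T k l * H (k - p) (l - p)"
  have split: "(\<Sum>p\<le>min k l. ?v k l p) = flip_matrix A B n k l * \<phi> (k + l) + (\<Sum>p\<in>{1..?N - M}. ?h k l p)"
    if kl: "k < ?N" "l < ?N" for k l
  proof -
    have "(\<Sum>p\<le>min k l. ?v k l p) = ?v k l 0 + (\<Sum>p\<in>{1..min k l}. ?v k l p)"
      by (simp add: atMost_atLeast0 sum.atLeast_Suc_atMost del: One_nat_def, simp)
    \<comment> \<open>The range of \<open>p\<close> is made independent of \<open>k\<close> and
      \<open>l\<close>, so that the sums can be exchanged; beyond \<open>min k l\<close> the shifted
      matrix vanishes anyway.\<close>
    also have "(\<Sum>p\<in>{1..min k l}. ?v k l p) = (\<Sum>p\<in>{1..?N}. if p \<le> min k l \<and> p + M \<le> ?N then ?h k l p else 0)"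
    proof (rule sum.mono_neutral_cong_left)
      fix p assume p: "p \<in> {1..min k l}"
      then have "k + l - 2 * p = (k - p) + (l - p)" by simp
      then show "?v k l p = (if p \<le> min k l \<and> p + M \<le> ?N then ?h k l p else 0)"
        using p by (simp add: Z_def H_def)
    qed (use kl in auto)
    also have "\<dots> = (\<Sum>p\<in>{1..?N - M}. ?h k l p)"
      by (rule sum.mono_neutral_cong_right) (auto simp: shift_matrix_def)
    finally show ?thesis by (simp add: Z_def)
  qed
  have "(\<Sum>k<?N. \<Sum>l<?N. \<Sum>p\<le>min k l. ?v k l p)
      = (\<Sum>k<?N. \<Sum>l<?N. flip_matrix A B n k l * \<phi> (k + l)) + (\<Sum>k<?N. \<Sum>l<?N. \<Sum>p\<in>{1..?N - M}. ?h k l p)"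
    unfolding sum.distrib[symmetric] by (rule sum.cong[OF refl], rule sum.cong[OF refl], rule split) auto
  also have "(\<Sum>k<?N. \<Sum>l<?N. \<Sum>p\<in>{1..?N - M}. ?h k l p) = (\<Sum>k<?N. \<Sum>p\<in>{1..?N - M}. \<Sum>l<?N. ?h k l p)"
    by (rule sum.cong[OF refl], rule sum.swap)
  also have "\<dots> = (\<Sum>p\<in>{1..?N - M}. \<Sum>k<?N. \<Sum>l<?N. ?h k l p)" by (rule sum.swap)
  also have "\<dots> = (\<Sum>p\<in>{1..?N - M}. pairing {..<M} {..<M} T H)"
    by (rule sum.cong[OF refl], subst sum_shift_matrix) (use n in \<open>auto simp: pairing_def\<close>)
  also have "\<dots> = of_nat (?N - M) * pairing {..<M} {..<M} T H" by simp
  also have "(\<Sum>k<?N. \<Sum>l<?N. flip_matrix A B n k l * \<phi> (k + l)) = (\<Sum>a<n. A * \<phi> (2 * (n - 1)) + 2 * B * \<phi> (2 * (n - 1) + 1) + A * \<phi> (2 * n))"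
    unfolding sum_flip_matrix
  proof (rule sum.cong[OF refl])
    fix a assume "a \<in> {..<n}"
    then have "2 * a + 2 * (n - Suc a) = 2 * (n - 1)" "2 * a + (2 * (n - Suc a) + 1) = 2 * (n - 1) + 1"
      "2 * a + 1 + 2 * (n - Suc a) = 2 * (n - 1) + 1" "2 * a + 1 + (2 * (n - Suc a) + 1) = 2 * n" by auto
    then show "A * \<phi> (2 * a + 2 * (n - Suc a)) + B * \<phi> (2 * a + (2 * (n - Suc a) + 1)) +
        (B * \<phi> (2 * a + 1 + 2 * (n - Suc a)) + A * \<phi> (2 * a + 1 + (2 * (n - Suc a) + 1)))
      = A * \<phi> (2 * (n - 1)) + 2 * B * \<phi> (2 * (n - 1) + 1) + A * \<phi> (2 * n)"
      by (simp only:) (simp add: algebra_simps)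
  qed
  also have "\<dots> = of_nat n * (A * \<phi> (2 * (n - 1)) + 2 * B * \<phi> (2 * (n - 1) + 1) + A * \<phi> (2 * n))" by simp
  finally show ?thesis
    using radial_test[where N = ?N and Z = Z, OF C Z] by (simp only:)
qed

text \<open>Dividing by the \<open>2 n\<close> levels leaves a boundary share
  \<open>M / (2 n)\<close> that tends to zero. The limits are assumed for \<open>A * \<phi>\<close>
  and \<open>B * \<phi>\<close>, so that with \<open>A = B = 0\<close> nothing need be known about
  convergence of \<open>\<phi>\<close>.\<close>

lemma test_inequality:
  assumes C: "\<And>a F. contraction a \<Longrightarrow> finite F \<Longrightarrow> op_le F (\<lambda>x y. \<phi> (graph_dist E x y) * a x y) C"
    and AB: "cmod (A + B) \<le> 1" "cmod (A - B) \<le> 1" and T: "contraction T"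
    and lim: "(\<lambda>n. A * \<phi> (2 * n)) \<longlonglongrightarrow> A * Le" "(\<lambda>n. B * \<phi> (2 * n + 1)) \<longlonglongrightarrow> B * Lo"
  shows "cmod (A * Le + B * Lo + pairing {..<M} {..<M} T (\<lambda>i j. \<phi> (i + j) - \<phi> (i + j + 2))) \<le> C" (is "cmod (_ + _ + ?P) \<le> C")
proof -
  let ?s = "\<lambda>n. A * \<phi> (2 * (n - 1)) + 2 * (B * \<phi> (2 * (n - 1) + 1)) + A * \<phi> (2 * n)"
  let ?f = "\<lambda>n. ?s n / 2 + (1 - of_nat M / (2 * of_nat n)) * ?P"
  have le: "cmod (?f n) \<le> C" if n: "n > M" for n
  proof -
    have le: "cmod (of_nat n * ?s n + of_nat (2 * n - M) * ?P) \<le> C * real (2 * n)"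
      unfolding mult.assoc[of 2 B, symmetric] by (rule radial_test_combined[OF C AB T]) (use n in auto)
    have alg: "x * s + (2 * x - m) * P = (2 * x) * (s / 2 + (1 - m / (2 * x)) * P)" if "x \<noteq> 0" for x s m P :: complex
      using that by (simp add: field_simps)
    have "complex_of_nat (2 * n - M) = 2 * of_nat n - of_nat M" using n by (simp add: of_nat_diff)
    then have "of_nat n * ?s n + of_nat (2 * n - M) * ?P = of_nat n * ?s n + (2 * of_nat n - of_nat M) * ?P"
      by (simp only:)
    also have "\<dots> = (2 * of_nat n) * ?f n" by (rule alg) (use n in simp)
    finally have "cmod (of_nat n * ?s n + of_nat (2 * n - M) * ?P) = 2 * real n * cmod (?f n)"
      by (simp only: norm_mult norm_of_nat norm_numeral)
    with le have "2 * real n * cmod (?f n) \<le> 2 * real n * C" by (simp only: of_nat_mult of_nat_numeral mult.commute)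
    then show ?thesis using n by (simp only: mult_le_cancel_left_pos)
  qed
  have lim': "(\<lambda>n. A * \<phi> (2 * (n - 1))) \<longlonglongrightarrow> A * Le" "(\<lambda>n. B * \<phi> (2 * (n - 1) + 1)) \<longlonglongrightarrow> B * Lo"
    by (rule LIMSEQ_imp_Suc, use lim in simp)+
  have "(\<lambda>n. complex_of_nat M / 2 * (1 / of_nat n)) \<longlonglongrightarrow> of_nat M / 2 * 0"
    by (rule tendsto_mult[OF tendsto_const lim_1_over_n])
  then have m0: "(\<lambda>n. complex_of_nat M / (2 * of_nat n)) \<longlonglongrightarrow> 0" by simp
  have t1: "?s \<longlonglongrightarrow> A * Le + 2 * (B * Lo) + A * Le"
    by (rule tendsto_add[OF tendsto_add[OF lim'(1) tendsto_mult[OF tendsto_const lim'(2)]] lim(1)])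
  have t2: "(\<lambda>n. (1 - of_nat M / (2 * of_nat n)) * ?P) \<longlonglongrightarrow> (1 - 0) * ?P"
    by (rule tendsto_mult[OF tendsto_diff[OF tendsto_const m0] tendsto_const])
  have "?f \<longlonglongrightarrow> (A * Le + 2 * (B * Lo) + A * Le) / 2 + (1 - 0) * ?P"
    by (rule tendsto_add[OF tendsto_divide[OF t1 tendsto_const] t2]) simp
  moreover have "(x + 2 * y + x) / 2 + (1 - 0) * P = x + y + P" for x y P :: complex
    by (simp add: field_simps)
  ultimately have "?f \<longlonglongrightarrow> A * Le + B * Lo + ?P" by (simp only:)
  then have "(\<lambda>n. cmod (?f n)) \<longlonglongrightarrow> cmod (A * Le + B * Lo + ?P)" by (rule tendsto_norm)
  then show ?thesis by (rule LIMSEQ_le_const2) (use le in \<open>auto intro!: exI[of _ "Suc M"]\<close>)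
qed

end

section \<open>Combining the two bounds\<close>

lemma le_trace_norm:
  assumes "trace_class h" "\<And>u v. (u, v) \<in> nuclear_reps h \<Longrightarrow> c \<le> (\<Sum>k. l2_norm_seq (u k) * l2_norm_seq (v k))"
  shows "c \<le> trace_norm h"
  unfolding trace_norm_def by (rule cInf_greatest) (use assms in \<open>auto simp: trace_class_def\<close>)

lemma contraction_scale:
  assumes "contraction T" "cmod c = 1" shows "contraction (\<lambda>i j. c * T i j)"
  unfolding contraction_def
proof (intro allI impI)
  fix F :: "'a set" assume "finite F"
  then have "op_le F T 1" using assms(1) by (simp add: contraction_def)
  from op_le_scale[OF this, of c] show "op_le F (\<lambda>i j. c * T i j) 1" by (simp add: assms(2))
qed

context infinite_rooted_tree
begin

lemma radial_schur_bound:
  assumes a: "bounded_matrix a" and \<phi>: "\<forall>n. \<phi> n = cp + cm * (-1) ^ n + \<psi> n" "\<psi> \<longlonglongrightarrow> 0"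
    and rep: "(u, v) \<in> nuclear_reps (\<lambda>i j. \<phi> (i + j) - \<phi> (i + j + 2))"
  shows "bounded_matrix (\<lambda>x y. \<phi> (graph_dist E x y) * a x y) \<and>
    matrix_norm (\<lambda>x y. \<phi> (graph_dist E x y) * a x y)
      \<le> (cmod cp + cmod cm + (\<Sum>k. l2_norm_seq (u k) * l2_norm_seq (v k))) * matrix_norm a"
proof (rule bounded_matrixI)
  note uv = nuclear_repsD[OF rep]
  have "0 \<le> (\<Sum>k. l2_norm_seq (u k) * l2_norm_seq (v k))"
    by (rule suminf_nonneg[OF uv(3)]) (simp add: uv)
  then show "0 \<le> (cmod cp + cmod cm + (\<Sum>k. l2_norm_seq (u k) * l2_norm_seq (v k))) * matrix_norm a"
    using matrix_norm_nonneg[OF a] by simp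
qed (rule op_le_radial[OF _ bounded_matrixD[OF a] matrix_norm_nonneg[OF a] \<phi> rep])

lemma radial_trace_class:
  assumes "schur_multiplier (\<lambda>x y. \<phi> (graph_dist E x y))"
  shows "trace_class (\<lambda>i j. \<phi> (i + j) - \<phi> (i + j + 2))"
proof -
  obtain C where C: "\<And>a F. contraction a \<Longrightarrow> finite F \<Longrightarrow> op_le F (\<lambda>x y. \<phi> (graph_dist E x y) * a x y) C"
    using schur_multiplier_uniformly_bounded[OF assms] by blast
  show ?thesis
  proof (rule trace_norm_le_of_dual_bound(1))
    fix M :: nat and T :: "nat \<Rightarrow> nat \<Rightarrow> complex" assume "contraction T"
    \<comment> \<open>With \<open>A = B = 0\<close> only the pairing is tested: convergence of
      \<open>\<phi>\<close> along parity classes becomes known only once \<open>H\<close> is of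
      trace class.\<close>
    from test_inequality[OF C _ _ this, of 0 0 0 0 M]
    show "cmod (pairing {..<M} {..<M} T (\<lambda>i j. \<phi> (i + j) - \<phi> (i + j + 2))) \<le> C" by simp
  qed
qed

lemma radial_schur_multiplier:
  assumes "trace_class (\<lambda>i j. \<phi> (i + j) - \<phi> (i + j + 2))"
  shows "schur_multiplier (\<lambda>x y. \<phi> (graph_dist E x y))"
proof -
  obtain cp cm \<psi> where \<phi>: "\<forall>n. \<phi> n = cp + cm * (-1) ^ n + \<psi> n" "\<psi> \<longlonglongrightarrow> 0"
    using decomposition_exists[OF assms] by blast
  obtain u v where "(u, v) \<in> nuclear_reps (\<lambda>i j. \<phi> (i + j) - \<phi> (i + j + 2))"
    using assms by (auto simp: trace_class_def)
  then show ?thesis using radial_schur_bound[OF _ \<phi>] by (auto simp: schur_multiplier_def)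
qed

lemma radial_schur_norm:
  assumes tc: "trace_class (\<lambda>i j. \<phi> (i + j) - \<phi> (i + j + 2))"
    and \<phi>: "\<forall>n. \<phi> n = cp + cm * (-1) ^ n + \<psi> n" "\<psi> \<longlonglongrightarrow> 0"
  shows "schur_norm (\<lambda>x y. \<phi> (graph_dist E x y)) = cmod cp + cmod cm + trace_norm (\<lambda>i j. \<phi> (i + j) - \<phi> (i + j + 2))"
    (is "schur_norm ?\<phi>t = _ + _ + trace_norm ?H")
proof -
  let ?S = "{matrix_norm (\<lambda>x y. ?\<phi>t x y * a x y) | a. bounded_matrix a \<and> matrix_norm a \<le> 1}"
  let ?K = "schur_norm ?\<phi>t"
  have S_le: "r \<le> cmod cp + cmod cm + (\<Sum>k. l2_norm_seq (u k) * l2_norm_seq (v k))"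
    if r: "r \<in> ?S" and rep: "(u, v) \<in> nuclear_reps ?H" for r u v
  proof -
    obtain a where a: "bounded_matrix a" "matrix_norm a \<le> 1" "r = matrix_norm (\<lambda>x y. ?\<phi>t x y * a x y)"
      using r by blast
    note uv = nuclear_repsD[OF rep]
    have "0 \<le> (\<Sum>k. l2_norm_seq (u k) * l2_norm_seq (v k))"
      by (rule suminf_nonneg[OF uv(3)]) (simp add: uv)
    then have "(cmod cp + cmod cm + (\<Sum>k. l2_norm_seq (u k) * l2_norm_seq (v k))) * matrix_norm a
        \<le> (cmod cp + cmod cm + (\<Sum>k. l2_norm_seq (u k) * l2_norm_seq (v k))) * 1"
      by (intro mult_left_mono a) simp
    with radial_schur_bound[OF a(1) \<phi> rep] show ?thesis by (simp add: a(3))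
  qed
  obtain u0 v0 where rep0: "(u0, v0) \<in> nuclear_reps ?H" using tc by (auto simp: trace_class_def)
  have bdd: "bdd_above ?S" by (rule bdd_aboveI) (rule S_le[OF _ rep0])
  have "bounded_matrix (\<lambda>x y :: 'a. 0) \<and> matrix_norm (\<lambda>x y :: 'a. 0) \<le> 1"
    using contraction_zero contraction_iff by blast
  then have nonempty: "?S \<noteq> {}" by blast
  have "?K - cmod cp - cmod cm \<le> trace_norm ?H"
  proof (rule le_trace_norm[OF tc])
    fix u v assume rep: "(u, v) \<in> nuclear_reps ?H"
    have "?K \<le> cmod cp + cmod cm + (\<Sum>k. l2_norm_seq (u k) * l2_norm_seq (v k))"
      unfolding schur_norm_def by (rule cSup_least[OF nonempty]) (rule S_le[OF _ rep])
    then show "?K - cmod cp - cmod cm \<le> (\<Sum>k. l2_norm_seq (u k) * l2_norm_seq (v k))" by simp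
  qed
  moreover have "trace_norm ?H \<le> ?K - cmod cp - cmod cm"
  proof (rule trace_norm_le_of_dual_bound(2))
    fix M :: nat and T :: "nat \<Rightarrow> nat \<Rightarrow> complex" assume T: "contraction T"
    \<comment> \<open>Boundedness is known here from a representation, so the uniform constant can
      be the Schur norm itself, as sharpness demands.\<close>
    have K: "op_le F (\<lambda>x y. ?\<phi>t x y * a x y) ?K" if a: "contraction a" and F: "finite F" for a F
    proof -
      have a': "bounded_matrix a" "matrix_norm a \<le> 1" using a by (simp_all add: contraction_iff)
      have "matrix_norm (\<lambda>x y. ?\<phi>t x y * a x y) \<le> ?K"
        unfolding schur_norm_def by (rule cSup_upper[OF _ bdd]) (use a' in blast)
      with bounded_matrixD[OF conjunct1[OF radial_schur_bound[OF a'(1) \<phi> rep0]] F] show ?thesis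
        by (rule op_le_mono)
    qed
    let ?P = "pairing {..<M} {..<M} T ?H"
    obtain w1 where w1: "cmod w1 = 1" "w1 * cp = cmod cp" using phase_exists by blast
    obtain w2 where w2: "cmod w2 = 1" "w2 * cm = cmod cm" using phase_exists by blast
    obtain w3 where w3: "cmod w3 = 1" "w3 * ?P = cmod ?P" using phase_exists by blast
    \<comment> \<open>Then \<open>?A + ?B\<close> and \<open>?A - ?B\<close> are the phases of
      \<open>cp\<close> and \<open>cm\<close>. Together with the phase \<open>w3\<close> on
      \<open>T\<close> they align all three terms, so their moduli add up.\<close>
    let ?A = "(w1 + w2) / 2" and ?B = "(w1 - w2) / 2"
    have AB: "?A + ?B = w1" "?A - ?B = w2" by (simp_all add: field_simps)
    note lim = decomposition_limits[OF \<phi>]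
    have "cmod (?A * (cp + cm) + ?B * (cp - cm) + pairing {..<M} {..<M} (\<lambda>i j. w3 * T i j) ?H) \<le> ?K"
    proof (rule test_inequality[OF K])
      show "cmod (?A + ?B) \<le> 1" "cmod (?A - ?B) \<le> 1" unfolding AB by (simp_all add: w1 w2)
      show "contraction (\<lambda>i j. w3 * T i j)" by (rule contraction_scale[OF T w3(1)])
      show "(\<lambda>n. ?A * \<phi> (2 * n)) \<longlonglongrightarrow> ?A * (cp + cm)" "(\<lambda>n. ?B * \<phi> (2 * n + 1)) \<longlonglongrightarrow> ?B * (cp - cm)"
        by (rule tendsto_mult[OF tendsto_const lim(1)], rule tendsto_mult[OF tendsto_const lim(2)])
    qed
    moreover have "pairing {..<M} {..<M} (\<lambda>i j. w3 * T i j) ?H = w3 * ?P"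
      unfolding pairing_def by (simp only: sum_distrib_left mult.assoc)
    moreover have "?A * (cp + cm) + ?B * (cp - cm) = w1 * cp + w2 * cm" by (simp add: field_simps)
    ultimately have "cmod (complex_of_real (cmod cp + cmod cm + cmod ?P)) \<le> ?K"
      by (simp only: w1 w2 w3 of_real_add)
    then show "cmod ?P \<le> ?K - cmod cp - cmod cm" unfolding norm_of_real by simp
  qed
  ultimately show ?thesis by simp
qed

end

theorem theorem1p12:
  fixes E :: "'a \<Rightarrow> 'a \<Rightarrow> bool" and x0 :: 'a and \<phi> :: "nat \<Rightarrow> complex"
  assumes "homogeneous_tree_infinite_degree E"
  defines "\<phi>t \<equiv> (\<lambda>x y. \<phi> (graph_dist E x y))"
      and "H \<equiv> (\<lambda>i j. \<phi> (i + j) - \<phi> (i + j + 2))"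
  shows "(schur_multiplier \<phi>t \<longleftrightarrow> trace_class H) \<and>
         (schur_multiplier \<phi>t \<longrightarrow>
            (\<exists>!(cp, cm, \<psi>). (\<forall>n. \<phi> n = cp + cm * (-1) ^ n + \<psi> n) \<and> \<psi> \<longlonglongrightarrow> 0) \<and>
            (\<forall>cp cm \<psi>. (\<forall>n. \<phi> n = cp + cm * (-1) ^ n + \<psi> n) \<and> \<psi> \<longlonglongrightarrow> 0 \<longrightarrow>
               schur_norm \<phi>t = cmod cp + cmod cm + trace_norm H))"
proof -
  interpret infinite_rooted_tree E x0
    by unfold_locales (use assms(1) in \<open>auto simp: homogeneous_tree_infinite_degree_def\<close>)
  have iff: "schur_multiplier \<phi>t \<longleftrightarrow> trace_class H"
    unfolding \<phi>t_def H_def by (rule iffI[OF radial_trace_class radial_schur_multiplier])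
  have unique: "\<exists>!(cp, cm, \<psi>). (\<forall>n. \<phi> n = cp + cm * (-1) ^ n + \<psi> n) \<and> \<psi> \<longlonglongrightarrow> 0" if tc: "trace_class H"
  proof -
    obtain cp cm \<psi> where \<phi>: "\<forall>n. \<phi> n = cp + cm * (-1) ^ n + \<psi> n" "\<psi> \<longlonglongrightarrow> 0"
      using decomposition_exists[OF tc[unfolded H_def]] by blast
    show ?thesis
    proof (rule ex1I[of _ "(cp, cm, \<psi>)"])
      show "case (cp, cm, \<psi>) of (cp, cm, \<psi>) \<Rightarrow> (\<forall>n. \<phi> n = cp + cm * (-1) ^ n + \<psi> n) \<and> \<psi> \<longlonglongrightarrow> 0"
        unfolding prod.case by (rule conjI[OF \<phi>])
    next
      fix t :: "complex \<times> complex \<times> (nat \<Rightarrow> complex)"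
      assume t: "case t of (cp, cm, \<psi>) \<Rightarrow> (\<forall>n. \<phi> n = cp + cm * (-1) ^ n + \<psi> n) \<and> \<psi> \<longlonglongrightarrow> 0"
      obtain a b c where abc: "t = (a, b, c)" by (rule prod_cases3)
      then show "t = (cp, cm, \<psi>)"
        using decomposition_unique[OF conjunct1 conjunct2 \<phi>, OF t[unfolded abc prod.case] t[unfolded abc prod.case]]
        by (simp only: prod.inject)
    qed
  qed
  have norm: "schur_norm \<phi>t = cmod cp + cmod cm + trace_norm H"
    if "trace_class H" and "(\<forall>n. \<phi> n = cp + cm * (-1) ^ n + \<psi> n) \<and> \<psi> \<longlonglongrightarrow> 0" for cp cm \<psi>
    unfolding \<phi>t_def H_def
    by (rule radial_schur_norm[OF that(1)[unfolded H_def] conjunct1[OF that(2)] conjunct2[OF that(2)]])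
  show ?thesis
    by (rule conjI[OF iff], rule impI, rule conjI, rule unique, erule iffD1[OF iff],
        intro allI, rule impI, rule norm, erule iffD1[OF iff])
qed

end
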